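(* Let $v_1,\ldots,v_m\in\mathbb{R}^d$, let $k\ge d$ be an integer and let $0\le l'<l\le d$. Let $x\in\mathbb{R}^m_{\ge0}$ be an optimal solution of the relaxation \[ \text{minimize } \left(\frac{E_{l'}\big(\sum_{i=1}^m x(i)v_iv_i^\top\big)}{E_l\big(\sum_{i=1}^m x(i)v_iv_i^\top\big)}\right)^{\frac{1}{l-l'}}\quad\text{subject to}\quad \sum_{i=1}^m x(i)\le k,\ x(i)\ge 0\ (i\in[m]), \] normalized so that $\sum_i x(i)=k$. There is a rounding algorithm based on the method of interlacing polynomials that, given $v_1,\ldots,v_m$, $k$ and $x$, outputs $(s_1,\ldots,s_k)\in[m]^k$ (a multiset of $k$ of the vectors, repetitions allowed) whose generalized ratio objective \[ \left(\frac{E_{l'}\big(\sum_{j=1}^k v_{s_j}v_{s_j}^\top\big)}{E_l\big(\sum_{j=1}^k v_{s_j}v_{s_j}^\top\big)}\right)^{\frac{1}{l-l'}} \] is at most $k\cdot((k-l)!/k!)^{1/(l-l')}$ times the optimal value of the relaxation; i.e. it is a $k\cdot((k-l)!/k!)^{1/(l-l')}$-approximation algorithm for the experimental design problem with the generalized ratio objective. The rounding process runs in $O(kmd^{\omega+1})$ time, where $\omega$ is the matrix-multiplication exponent.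
   Context: For a symmetric $d\times d$ matrix $M$ with eigenvalues $\lambda_1(M),\ldots,\lambda_d(M)$, $E_l(M):=\sum_{S\subseteq[d],|S|=l}\prod_{i\in S}\lambda_i(M)$ is the $l$-th elementary symmetric polynomial of its eigenvalues ($E_0=1$). The experimental design problem with the generalized ratio objective is: choose a multiset $S$ of $k$ of the vectors (repetitions allowed) minimizing $\big(E_{l'}(\sum_{i\in S}v_iv_i^\top)/E_l(\sum_{i\in S}v_iv_i^\top)\big)^{1/(l-l')}$.
   Formalization: The factor is corrected to k·((k-l)!/(k-l')!)^{1/(l-l')}: the printed one (same for l'=0) is false for l'>0, e.g. it is 1/2<1 for d=l=2, l'=1, k=3, v_1=e_1, v_2=e_2. That the algorithm is based on interlacing polynomials is not part of the formal claim. *)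

theory Defs
  imports
    Complex_Main
    "HOL-Library.Multiset"
    "HOL-Library.Extended_Real"
    "Jordan_Normal_Form.Char_Poly"
begin

section \<open>The design problem and its relaxation\<close>

text \<open>
  The eigenvalues of a real symmetric matrix, in increasing order and repeated according to
  multiplicity. A real symmetric \<open>d \<times> d\<close> matrix has exactly \<open>d\<close> of them, all of them real.
\<close>
definition eigenvals :: "real mat \<Rightarrow> real list" where
  "eigenvals M = sorted_list_of_multiset (proots (char_poly M))"

definition E :: "nat \<Rightarrow> real mat \<Rightarrow> real" where
  "E l M = (\<Sum>S | S \<subseteq> {..<length (eigenvals M)} \<and> card S = l. \<Prod>i\<in>S. eigenvals M ! i)"

text \<open>The \<open>d \<times> d\<close> matrix \<open>\<Sum>i<n. w(i) u\<^sub>i u\<^sub>i\<^sup>T\<close>.\<close>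
definition sum_outer :: "nat \<Rightarrow> nat \<Rightarrow> (nat \<Rightarrow> real) \<Rightarrow> (nat \<Rightarrow> real vec) \<Rightarrow> real mat" where
  "sum_outer d n w u = mat d d (\<lambda>(a, b). \<Sum>i<n. w i * (u i $ a * u i $ b))"

text \<open>
  The matrices of interest are positive semidefinite, so \<open>E l M \<ge> 0\<close>; the objective is infinite
  when \<open>E l M = 0\<close> (also in the case \<open>0 / 0\<close>).
\<close>
definition gen_ratio :: "nat \<Rightarrow> nat \<Rightarrow> real mat \<Rightarrow> ereal" where
  "gen_ratio l' l M =
     (if E l M = 0 then \<infinity> else ereal ((E l' M / E l M) powr (1 / (real l - real l'))))"

definition relax_obj ::
  "nat \<Rightarrow> nat \<Rightarrow> (nat \<Rightarrow> real vec) \<Rightarrow> nat \<Rightarrow> nat \<Rightarrow> (nat \<Rightarrow> real) \<Rightarrow> ereal" where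
  "relax_obj d m v l' l x = gen_ratio l' l (sum_outer d m x v)"

definition relax_feasible :: "nat \<Rightarrow> nat \<Rightarrow> (nat \<Rightarrow> real) \<Rightarrow> bool" where
  "relax_feasible m k x \<longleftrightarrow> (\<Sum>i<m. x i) \<le> real k \<and> (\<forall>i<m. 0 \<le> x i)"

definition relax_opt ::
  "nat \<Rightarrow> nat \<Rightarrow> (nat \<Rightarrow> real vec) \<Rightarrow> nat \<Rightarrow> nat \<Rightarrow> nat \<Rightarrow> ereal" where
  "relax_opt d m v k l' l = (INF x\<in>{x. relax_feasible m k x}. relax_obj d m v l' l x)"

definition relax_optimal_solution ::
  "nat \<Rightarrow> nat \<Rightarrow> (nat \<Rightarrow> real vec) \<Rightarrow> nat \<Rightarrow> nat \<Rightarrow> nat \<Rightarrow> (nat \<Rightarrow> real) \<Rightarrow> bool" where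
  "relax_optimal_solution d m v k l' l x \<longleftrightarrow>
     relax_feasible m k x \<and>
     (\<forall>y. relax_feasible m k y \<longrightarrow> relax_obj d m v l' l x \<le> relax_obj d m v l' l y)"

text \<open>
  A multiset of \<open>k\<close> of the vectors \<open>v 0, \<dots>, v (m - 1)\<close> is given by the indices
  \<open>s 0, \<dots>, s (k - 1)\<close>.
\<close>
definition design_feasible :: "nat \<Rightarrow> nat \<Rightarrow> (nat \<Rightarrow> nat) \<Rightarrow> bool" where
  "design_feasible m k s \<longleftrightarrow> (\<forall>j<k. s j < m)"

definition design_obj ::
  "nat \<Rightarrow> (nat \<Rightarrow> real vec) \<Rightarrow> nat \<Rightarrow> nat \<Rightarrow> nat \<Rightarrow> (nat \<Rightarrow> nat) \<Rightarrow> ereal" where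
  "design_obj d v k l' l s = gen_ratio l' l (sum_outer d k (\<lambda>j. 1) (\<lambda>j. v (s j)))"

definition design_opt ::
  "nat \<Rightarrow> nat \<Rightarrow> (nat \<Rightarrow> real vec) \<Rightarrow> nat \<Rightarrow> nat \<Rightarrow> nat \<Rightarrow> ereal" where
  "design_opt d m v k l' l = (INF s\<in>{s. design_feasible m k s}. design_obj d v k l' l s)"

text \<open>
  If \<open>k\<close> indices are drawn independently with probabilities \<open>x(i) / k\<close>, then the expectation of
  \<open>E j\<close> of the sampled matrix is \<open>k! / ((k - j)! k^j)\<close> times \<open>E j\<close> of the fractional one. The
  factor is the quotient of these constants for \<open>j = l'\<close> and \<open>j = l\<close>, to the power
  \<open>1 / (l - l')\<close>. The denominator is \<open>(k - l')!\<close>; it is \<open>k!\<close> only for \<open>l' = 0\<close>. With \<open>k!\<close> for all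
  \<open>l'\<close> the factor would be \<open>1 / (k - 1) < 1\<close> for \<open>l' = 1\<close>, \<open>l = d = 2\<close>, \<open>k \<ge> 3\<close>, which no rounding
  can achieve, because every integral solution is feasible for the relaxation.
\<close>
definition approx_factor :: "nat \<Rightarrow> nat \<Rightarrow> nat \<Rightarrow> real" where
  "approx_factor k l' l =
     real k * (fact (k - l) / fact (k - l')) powr (1 / (real l - real l'))"


section \<open>A real random access machine\<close>

text \<open>
  Programs work on named arrays of natural numbers (one index) and of real numbers (two indices);
  scalars are arrays used at index 0 only. Natural numbers can be converted to real numbers but
  not conversely: real numbers influence the control flow and the indices only through comparisons.
\<close>

type_synonym vname = string

record state =
  nats :: "vname \<Rightarrow> nat \<Rightarrow> nat"
  reals :: "vname \<Rightarrow> nat \<Rightarrow> nat \<Rightarrow> real"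

datatype nexp =
    NConst nat
  | NArr vname nexp
  | NPlus nexp nexp
  | NMinus nexp nexp

datatype rexp =
    ROfNat nexp
  | RArr vname nexp nexp
  | RPlus rexp rexp
  | RMinus rexp rexp
  | RTimes rexp rexp
  | RDivide rexp rexp

datatype bexp =
    NLess nexp nexp
  | RLess rexp rexp

datatype com =
    Skip
  | NAssign vname nexp nexp
  | RAssign vname nexp nexp rexp
  | Seq com com
  | If bexp com com
  | While bexp com

primrec nval :: "nexp \<Rightarrow> state \<Rightarrow> nat" where
  "nval (NConst n) \<sigma> = n"
| "nval (NArr a e) \<sigma> = nats \<sigma> a (nval e \<sigma>)"
| "nval (NPlus e f) \<sigma> = nval e \<sigma> + nval f \<sigma>"
| "nval (NMinus e f) \<sigma> = nval e \<sigma> - nval f \<sigma>"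

primrec rval :: "rexp \<Rightarrow> state \<Rightarrow> real" where
  "rval (ROfNat e) \<sigma> = real (nval e \<sigma>)"
| "rval (RArr a e f) \<sigma> = reals \<sigma> a (nval e \<sigma>) (nval f \<sigma>)"
| "rval (RPlus p q) \<sigma> = rval p \<sigma> + rval q \<sigma>"
| "rval (RMinus p q) \<sigma> = rval p \<sigma> - rval q \<sigma>"
| "rval (RTimes p q) \<sigma> = rval p \<sigma> * rval q \<sigma>"
| "rval (RDivide p q) \<sigma> = rval p \<sigma> / rval q \<sigma>"

primrec bval :: "bexp \<Rightarrow> state \<Rightarrow> bool" where
  "bval (NLess e f) \<sigma> \<longleftrightarrow> nval e \<sigma> < nval f \<sigma>"
| "bval (RLess p q) \<sigma> \<longleftrightarrow> rval p \<sigma> < rval q \<sigma>"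

definition nupdate :: "vname \<Rightarrow> nat \<Rightarrow> nat \<Rightarrow> state \<Rightarrow> state" where
  "nupdate a i n \<sigma> = \<sigma>\<lparr>nats := (nats \<sigma>)(a := (nats \<sigma> a)(i := n))\<rparr>"

definition rupdate :: "vname \<Rightarrow> nat \<Rightarrow> nat \<Rightarrow> real \<Rightarrow> state \<Rightarrow> state" where
  "rupdate a i j r \<sigma> =
     \<sigma>\<lparr>reals := (reals \<sigma>)(a := (reals \<sigma> a)(i := (reals \<sigma> a i)(j := r)))\<rparr>"

text \<open>
  \<open>run c \<sigma> t \<sigma>'\<close>: started in \<open>\<sigma>\<close>, the program \<open>c\<close> terminates in \<open>\<sigma>'\<close> after \<open>t\<close> steps. Assignments
  and tests count as one step: the expressions in a fixed program have bounded size, so this is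
  the number of arithmetic operations, comparisons and memory accesses up to a constant factor.
\<close>
inductive run :: "com \<Rightarrow> state \<Rightarrow> nat \<Rightarrow> state \<Rightarrow> bool" where
  Skip: "run Skip \<sigma> 1 \<sigma>"
| NAssign: "run (NAssign a e f) \<sigma> 1 (nupdate a (nval e \<sigma>) (nval f \<sigma>) \<sigma>)"
| RAssign: "run (RAssign a e f p) \<sigma> 1 (rupdate a (nval e \<sigma>) (nval f \<sigma>) (rval p \<sigma>) \<sigma>)"
| Seq: "run c1 \<sigma>1 t1 \<sigma>2 \<Longrightarrow> run c2 \<sigma>2 t2 \<sigma>3 \<Longrightarrow> run (Seq c1 c2) \<sigma>1 (t1 + t2) \<sigma>3"
| IfTrue: "bval b \<sigma> \<Longrightarrow> run c1 \<sigma> t \<sigma>' \<Longrightarrow> run (If b c1 c2) \<sigma> (1 + t) \<sigma>'"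
| IfFalse: "\<not> bval b \<sigma> \<Longrightarrow> run c2 \<sigma> t \<sigma>' \<Longrightarrow> run (If b c1 c2) \<sigma> (1 + t) \<sigma>'"
| WhileFalse: "\<not> bval b \<sigma> \<Longrightarrow> run (While b c) \<sigma> 1 \<sigma>"
| WhileTrue: "bval b \<sigma>1 \<Longrightarrow> run c \<sigma>1 t1 \<sigma>2 \<Longrightarrow> run (While b c) \<sigma>2 t2 \<sigma>3 \<Longrightarrow>
    run (While b c) \<sigma>1 (1 + t1 + t2) \<sigma>3"

text \<open>
  \<open>w\<close> is an exponent for matrix multiplication: one program multiplies any two real \<open>n \<times> n\<close>
  matrices in \<open>O(n\<^sup>w)\<close> steps, whatever the rest of the memory contains. The condition \<open>2 \<le> w\<close>
  excludes nothing, since \<open>n\<^sup>2\<close> entries have to be computed.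
\<close>
definition matmul_exponent :: "real \<Rightarrow> bool" where
  "matmul_exponent w \<longleftrightarrow> 2 \<le> w \<and>
     (\<exists>P C. \<forall>n \<sigma>. 1 \<le> n \<and> nats \<sigma> ''n'' 0 = n \<longrightarrow>
       (\<exists>t \<sigma>'. run P \<sigma> t \<sigma>' \<and> real t \<le> C * real n powr w \<and>
         (\<forall>i<n. \<forall>j<n. reals \<sigma>' ''C'' i j = (\<Sum>p<n. reals \<sigma> ''A'' i p * reals \<sigma> ''B'' p j))))"

definition holds_input ::
  "state \<Rightarrow> nat \<Rightarrow> nat \<Rightarrow> (nat \<Rightarrow> real vec) \<Rightarrow> nat \<Rightarrow> nat \<Rightarrow> nat \<Rightarrow> (nat \<Rightarrow> real) \<Rightarrow> bool" where
  "holds_input \<sigma> d m v k l' l x \<longleftrightarrow>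
     nats \<sigma> ''d'' 0 = d \<and> nats \<sigma> ''m'' 0 = m \<and> nats \<sigma> ''k'' 0 = k \<and>
     nats \<sigma> ''l1'' 0 = l' \<and> nats \<sigma> ''l'' 0 = l \<and>
     (\<forall>i<m. \<forall>a<d. reals \<sigma> ''v'' i a = v i $ a) \<and>
     (\<forall>i<m. reals \<sigma> ''x'' i 0 = x i)"

end

theory Submission
  imports Defs
begin

text \<open>
  Draw \<open>k\<close> indices independently with probabilities \<open>x(i) / k\<close>. Conditioned on a prefix with sum
  \<open>A\<close>, the expectations of \<open>E\<^sub>l\<^sub>'\<close> and \<open>E\<^sub>l\<close> are averages, over the next index, of the
  expectations conditioned on the longer prefix, so by the mediant inequality some next index does not
  increase their quotient. Choosing greedily the index with the least quotient therefore ends with a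
  design whose quotient is at most the quotient of the unconditional expectations.

  The conditional expectations are computed by a Faddeev-LeVerrier recursion. Let \<open>G\<^sub>p\<close> be the
  coefficients of the adjugate, \<open>G\<^sub>p\<^sub>+\<^sub>1 = E\<^sub>p\<^sub>+\<^sub>1 I - M G\<^sub>p\<close>, \<open>(p + 1) E\<^sub>p\<^sub>+\<^sub>1 = tr (M G\<^sub>p)\<close>. Since
  \<open>v\<^sup>T G\<^sub>p(M + v v\<^sup>T) = v\<^sup>T G\<^sub>p(M)\<close>, the expectation of \<open>M G\<^sub>p(M)\<close> over \<open>r\<close> further samples is
  \<open>A \<Gamma>\<^sub>p\<^sub>,\<^sub>r + r Y \<Gamma>\<^sub>p\<^sub>,\<^sub>r\<^sub>-\<^sub>1\<close>, where \<open>\<Gamma>\<^sub>p\<^sub>,\<^sub>r\<close> is the expectation of \<open>G\<^sub>p\<close> and \<open>Y\<close> the mean of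
  \<open>v v\<^sup>T\<close>. This takes \<open>O(l\<^sup>2)\<close> matrix products per chosen index, and each candidate is then
  evaluated in \<open>O(d\<^sup>2)\<close> steps by \<open>E\<^sub>p\<^sub>+\<^sub>1(M + v v\<^sup>T) = E\<^sub>p\<^sub>+\<^sub>1(M) + v\<^sup>T G\<^sub>p(M) v\<close>. If \<open>m < l\<close>, every
  design has \<open>E\<^sub>l = 0\<close>; otherwise \<open>l\<^sup>2 d\<^sup>\<omega> \<le> m d\<^sup>\<omega>\<^sup>+\<^sup>1\<close>.
\<close>

section \<open>The Faddeev-LeVerrier recursion\<close>

text \<open>The obstacle is that a conditional expectation averages over m^r continuations. The
  recursion avoids this because each level multiplies by M only once: one of the r samples is
  exposed at a time, the rank-one invariance removes that sample from the remaining factor, and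
  independence leaves a product of two expectations. Only the number of free samples changes, from r
  to r - 1, so a table indexed by level and by number of samples is closed under the recursion.
  Started from the zero matrix, every level contributes the number of samples still free. Hence E_p
  has expectation k(k-1)...(k-p+1) times E_p of the mean matrix, which is the relaxed matrix divided
  by k; the quotient of these constants for l' and l is the origin of \<open>approx_factor\<close>.
  Eigenvalues enter only to identify \<open>E\<close> with algebraic coefficients and to show that
  these are nonnegative on sums of outer products. Quotients are kept in cross-multiplied form,
  because the expectation of E_l can vanish for some candidates even when the average over all
  candidates is positive.\<close>

text \<open>The matrix determinant lemma with the adjugate in place of the inverse, so that it
  applies over polynomials. The block matrix \<open>?K\<close> is multiplied by \<open>?R\<close>,
  which clears \<open>-v\<close> and yields det (N + u v), and by \<open>?T\<close>, which clears
  \<open>u\<close> and yields det N times the right-hand side. Since \<open>?T\<close> has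
  determinant det N, cancelling it needs \<open>nz\<close>.\<close>

lemma det_rank_one_update:
  fixes N :: "'a :: idom mat"
  assumes N: "N \<in> carrier_mat n n" and u: "u \<in> carrier_mat n 1" and v: "v \<in> carrier_mat 1 n"
    and nz: "det N \<noteq> 0"
  shows "det (N + u * v) = det N + (v * adj_mat N * u) $$ (0, 0)"
proof -
  let ?B = "adj_mat N"
  have B: "?B \<in> carrier_mat n n" and NB: "N * ?B = det N \<cdot>\<^sub>m 1\<^sub>m n"
    using adj_mat[OF N] by auto
  let ?K = "four_block_mat N u (-v) (1\<^sub>m 1)"
  let ?R = "four_block_mat (1\<^sub>m n) (0\<^sub>m n 1) v (1\<^sub>m 1)"
  let ?T = "four_block_mat (1\<^sub>m n) (- (?B * u)) (0\<^sub>m 1 n) (det N \<cdot>\<^sub>m 1\<^sub>m 1)"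
  have K: "?K \<in> carrier_mat (n + 1) (n + 1)" and R: "?R \<in> carrier_mat (n + 1) (n + 1)"
    and T: "?T \<in> carrier_mat (n + 1) (n + 1)"
    using N u v B by auto
  have "?K * ?R = four_block_mat (N * 1\<^sub>m n + u * v) (N * 0\<^sub>m n 1 + u * 1\<^sub>m 1)
      (- v * 1\<^sub>m n + 1\<^sub>m 1 * v) (- v * 0\<^sub>m n 1 + 1\<^sub>m 1 * 1\<^sub>m 1)"
    by (rule mult_four_block_mat) (use N u v in auto)
  also have "\<dots> = four_block_mat (N + u * v) u (0\<^sub>m 1 n) (1\<^sub>m 1)"
    using N u v by (simp add: uminus_l_inv_mat)
  finally have KR: "?K * ?R = four_block_mat (N + u * v) u (0\<^sub>m 1 n) (1\<^sub>m 1)" .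
  have "det (?K * ?R) = det (N + u * v)"
    unfolding KR by (subst det_four_block_mat_lower_left_zero) (use N u v in auto)
  moreover have "det ?R = 1"
    by (subst det_four_block_mat_upper_right_zero) (use v in auto)
  ultimately have dK: "det ?K = det (N + u * v)"
    using det_mult[OF K R] by simp
  let ?c = "(v * ?B * u) $$ (0, 0)"
  have NBu: "N * (- (?B * u)) + u * (det N \<cdot>\<^sub>m 1\<^sub>m 1) = 0\<^sub>m n 1"
  proof -
    have "N * (- (?B * u)) = - (N * (?B * u))"
      using N B u by simp
    also have "N * (?B * u) = (N * ?B) * u"
      using N B u by simp
    also have "\<dots> = det N \<cdot>\<^sub>m u"
      unfolding NB using u by (simp add: mult_smult_assoc_mat[of _ n n])
    finally have "N * (- (?B * u)) = - (det N \<cdot>\<^sub>m u)" .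
    moreover have "u * (det N \<cdot>\<^sub>m 1\<^sub>m 1) = det N \<cdot>\<^sub>m u"
      unfolding mult_smult_distrib[OF u one_carrier_mat] using u by simp
    moreover have "- (det N \<cdot>\<^sub>m u) + det N \<cdot>\<^sub>m u = 0\<^sub>m n 1"
      by (rule uminus_l_inv_mat) (use u in simp)
    ultimately show ?thesis by simp
  qed
  have "?K * ?T = four_block_mat (N * 1\<^sub>m n + u * 0\<^sub>m 1 n) 
      (N * (- (?B * u)) + u * (det N \<cdot>\<^sub>m 1\<^sub>m 1))
      (- v * 1\<^sub>m n + 1\<^sub>m 1 * 0\<^sub>m 1 n) (- v * (- (?B * u)) + 1\<^sub>m 1 * (det N \<cdot>\<^sub>m 1\<^sub>m 1))"
    by (rule mult_four_block_mat) (use N u v B in auto)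
  also have "\<dots> = four_block_mat N (0\<^sub>m n 1) (- v) (- v * (- (?B * u)) + det N \<cdot>\<^sub>m 1\<^sub>m 1)"
    unfolding NBu using N u v by simp
  finally have KT: "?K * ?T = four_block_mat N (0\<^sub>m n 1) (- v) (- v * (- (?B * u)) + det N \<cdot>\<^sub>m 1\<^sub>m 1)" .
  have D: "- v * (- (?B * u)) + det N \<cdot>\<^sub>m 1\<^sub>m 1 \<in> carrier_mat 1 1"
    using v B u by auto
  have "- v * (- (?B * u)) = v * ?B * u"
    using v B u by simp
  hence "det (- v * (- (?B * u)) + det N \<cdot>\<^sub>m 1\<^sub>m 1) = ?c + det N"
    using v B u by (subst det_single) auto
  hence "det (?K * ?T) = det N * (?c + det N)"
    unfolding KT by (subst det_four_block_mat_upper_right_zero) (use N u v B D in auto)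
  moreover have "det ?T = det N"
    by (subst det_four_block_mat_lower_left_zero) (use u B in auto)
  ultimately have "det (N + u * v) * det N = det N * (?c + det N)"
    using det_mult[OF K T] dK by metis
  hence "det (N + u * v) * det N = (det N + ?c) * det N"
    by (simp only: mult.commute add.commute)
  thus ?thesis using mult_right_cancel[OF nz] by blast
qed

text \<open>Up to the sign (-1)^p this is the coefficient of X^(d-1-p) in the adjugate of X I - M.
  Matrices are plain functions, so sums and expectations need no carrier conditions; only entries
  with indices below d are meaningful. The trace term is \<open>fl_coeff\<close> at
  \<open>Suc p\<close>, written out because that constant is itself defined from
  \<open>fl_mat\<close>.\<close>

primrec fl_mat :: "nat \<Rightarrow> (nat \<Rightarrow> nat \<Rightarrow> real) \<Rightarrow> nat \<Rightarrow> nat \<Rightarrow> nat \<Rightarrow> real" where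
  "fl_mat d M 0 = (\<lambda>a b. if a = b then 1 else 0)"
| "fl_mat d M (Suc p) = (\<lambda>a b.
     (if a = b then (\<Sum>i<d. \<Sum>c<d. M i c * fl_mat d M p c i) / real (Suc p) else 0)
     - (\<Sum>c<d. M a c * fl_mat d M p c b))"

definition fl_coeff :: "nat \<Rightarrow> (nat \<Rightarrow> nat \<Rightarrow> real) \<Rightarrow> nat \<Rightarrow> real" where
  "fl_coeff d M p = (case p of 0 \<Rightarrow> 1
     | Suc q \<Rightarrow> (\<Sum>i<d. \<Sum>c<d. M i c * fl_mat d M q c i) / real (Suc q))"

lemma fl_coeff_0 [simp]: "fl_coeff d M 0 = 1"
  and fl_coeff_Suc: "fl_coeff d M (Suc p) = (\<Sum>i<d. \<Sum>c<d. M i c * fl_mat d M p c i) / real (Suc p)"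
  by (simp_all add: fl_coeff_def)

lemma fl_coeff_Suc_times: "real (Suc p) * fl_coeff d M (Suc p) = (\<Sum>i<d. \<Sum>c<d. M i c * fl_mat d M p c i)"
  by (simp add: fl_coeff_Suc del: of_nat_Suc)

lemma fl_mat_Suc:
  "fl_mat d M (Suc p) a b = (if a = b then fl_coeff d M (Suc p) else 0) - (\<Sum>c<d. M a c * fl_mat d M p c b)"
  by (simp add: fl_coeff_Suc)

text \<open>Comparing coefficients in (X I - A) adj = char_poly A * I gives a recursion that runs
  down from the leading coefficients, and the trace of the adjugate is the derivative of the
  characteristic polynomial. Together they determine both families of coefficients, and
  \<open>fl_mat\<close>, \<open>fl_coeff\<close> satisfy the same equations up to sign.\<close>

lemma fl_adj_char_poly_matrix:
  fixes d :: nat and M :: "nat \<Rightarrow> nat \<Rightarrow> real"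
  defines "A \<equiv> mat d d (\<lambda>(a, b). M a b)"
  shows "\<And>p a b. p < d \<Longrightarrow> a < d \<Longrightarrow> b < d \<Longrightarrow>
      coeff (adj_mat (char_poly_matrix A) $$ (a, b)) (d - Suc p) = (-1) ^ p * fl_mat d M p a b"
    and "\<And>p. p \<le> d \<Longrightarrow> coeff (char_poly A) (d - p) = (-1) ^ p * fl_coeff d M p"
proof -
  have A: "A \<in> carrier_mat d d" by (simp add: A_def)
  let ?N = "char_poly_matrix A"
  define B where "B = adj_mat ?N"
  have N: "?N \<in> carrier_mat d d" using A by simp
  note adj = adj_mat[OF N, folded B_def]
  define \<beta> where "\<beta> n a b = coeff (B $$ (a, b)) n" for n a b
  define c where "c n = coeff (char_poly A) n" for n
  have entry: "[:0, 1:] * B $$ (a, b) - (\<Sum>i<d. [:M a i:] * B $$ (i, b)) = (if a = b then char_poly A else 0)"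
    if "a < d" "b < d" for a b
  proof -
    have "(if a = b then char_poly A else 0) = (?N * B) $$ (a, b)"
      unfolding adj(2) using that by (simp add: char_poly_def)
    also have "\<dots> = (\<Sum>i<d. ?N $$ (a, i) * B $$ (i, b))"
      using that N adj(1) by (auto simp: scalar_prod_def lessThan_atLeast0)
    also have "\<dots> = (\<Sum>i<d. (if a = i then [:0, 1:] * B $$ (i, b) else 0) - [:M a i:] * B $$ (i, b))"
      using that by (intro sum.cong) (auto simp: char_poly_matrix_def A_def algebra_simps)
    also have "\<dots> = [:0, 1:] * B $$ (a, b) - (\<Sum>i<d. [:M a i:] * B $$ (i, b))"
      using that by (simp add: sum_subtractf)
    finally show ?thesis by simp
  qed
  have rec: "\<beta> n a b = (if a = b then c (Suc n) else 0) + (\<Sum>i<d. M a i * \<beta> (Suc n) i b)"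
    if "a < d" "b < d" for n a b
    using arg_cong[OF entry[OF that], of "\<lambda>p. coeff p (Suc n)"]
    by (simp add: coeff_sum \<beta>_def c_def algebra_simps split: if_splits)
  have rec0: "(\<Sum>i<d. M a i * \<beta> 0 i b) = - (if a = b then c 0 else 0)"
    if "a < d" "b < d" for a b
    using arg_cong[OF entry[OF that], of "\<lambda>p. coeff p 0"]
    by (simp add: coeff_sum \<beta>_def c_def algebra_simps split: if_splits)
  have deg: "degree (char_poly A) = d" and monic: "c d = 1"
    using degree_monic_char_poly[OF A] by (auto simp: c_def)
  have c_big: "c n = 0" if "n > d" for n
    using that deg by (simp add: c_def coeff_eq_0)
  \<comment> \<open>A common degree bound for the entries of the adjugate. Above it all coefficients
    vanish, and \<open>rec\<close> carries the vanishing down to degree d, because the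
    characteristic polynomial has no coefficients beyond d.\<close>
  define K where "K = Max (insert d ((\<lambda>(a, b). degree (B $$ (a, b))) ` ({..<d} \<times> {..<d})))"
  have Kd: "d \<le> K" and KB: "degree (B $$ (a, b)) \<le> K" if "a < d" "b < d" for a b
    unfolding K_def using that by (auto intro!: Max_ge)
  have \<beta>_big': "\<beta> n a b = 0" if "n > K" "a < d" "b < d" for n a b
    using KB[of a b] that by (simp add: \<beta>_def coeff_eq_0)
  have "\<forall>a<d. \<forall>b<d. \<beta> n a b = 0" if "d \<le> n" for n
  proof (cases "n \<le> Suc K")
    case True
    then show ?thesis using that
    proof (induction rule: inc_induct)
      case base
      then show ?case using \<beta>_big' by simp
    next
      case (step n)
      then show ?case using rec[of _ _ n] c_big[of "Suc n"] by auto
    qed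
  next
    case False
    then show ?thesis using \<beta>_big' by simp
  qed
  hence \<beta>_big: "\<beta> n a b = 0" if "d \<le> n" "a < d" "b < d" for n a b
    using that by blast
  have del: "B $$ (i, i) = char_poly (mat_delete A i i)" if "i < d" for i
  proof -
    have "B $$ (i, i) = det (mat_delete ?N i i)"
      using that N by (simp add: B_def adj_mat_def cofactor_def)
    also have "mat_delete ?N i i = char_poly_matrix (mat_delete A i i)"
      using that A by (intro eq_matI) (auto simp: mat_delete_def char_poly_matrix_def)
    finally show ?thesis by (simp add: char_poly_def)
  qed
  \<comment> \<open>Jacobi's formula: the derivative is the sum of the characteristic polynomials of
    the principal minors, which are the diagonal entries of the adjugate.\<close>
  have "pderiv (char_poly A) = (\<Sum>i<d. B $$ (i, i))"
    unfolding pderiv_char_poly[OF A] using del by simp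
  hence "coeff (pderiv (char_poly A)) n = coeff (\<Sum>i<d. B $$ (i, i)) n" for n
    by simp
  hence tr: "real (Suc n) * c (Suc n) = (\<Sum>i<d. \<beta> n i i)" for n
    unfolding \<beta>_def c_def coeff_pderiv coeff_sum .
  \<comment> \<open>The trace of \<open>rec\<close> counts c (d - p) with factor d, the derivative
    counts it with factor d - p; the difference p is the divisor in \<open>fl_coeff\<close>. For p =
    d there is no lower adjugate coefficient, and \<open>rec0\<close> takes the place of
    \<open>rec\<close>.\<close>
  have tr': "real p * c (d - p) = - (\<Sum>i<d. \<Sum>j<d. M i j * \<beta> (d - p) j i)" if "p \<le> d" for p
  proof (cases "p = d")
    case True
    have "(\<Sum>i<d. \<Sum>j<d. M i j * \<beta> 0 j i) = (\<Sum>i<d. - c 0)"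
      by (intro sum.cong) (auto simp: rec0)
    then show ?thesis using True by simp
  next
    case False
    hence S: "Suc (d - Suc p) = d - p" using that by simp
    have "real (d - p) * c (d - p) = (\<Sum>i<d. c (d - p) + (\<Sum>j<d. M i j * \<beta> (d - p) j i))"
      unfolding S[symmetric] tr by (intro sum.cong) (auto simp: rec[of _ _ "d - Suc p"])
    then show ?thesis using that by (simp add: sum.distrib of_nat_diff algebra_simps)
  qed
  \<comment> \<open>Restricted to p < d, where \<open>d - Suc p\<close> is not truncated; the
    constant coefficient is treated separately at the end.\<close>
  have main: "p < d \<longrightarrow> (\<forall>a<d. \<forall>b<d. \<beta> (d - Suc p) a b = (-1) ^ p * fl_mat d M p a b)
      \<and> c (d - p) = (-1) ^ p * fl_coeff d M p" for p
  proof (induction p)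
    case 0
    show ?case using rec[of _ _ "d - 1"] \<beta>_big[of d] monic by auto
  next
    case (Suc p)
    show ?case
    proof (intro impI)
      assume p: "Suc p < d"
      hence IH: "\<beta> (d - Suc p) a b = (-1) ^ p * fl_mat d M p a b" if "a < d" "b < d" for a b
        using Suc that by simp
      have "real (Suc p) * c (d - Suc p) = - (\<Sum>i<d. \<Sum>j<d. M i j * ((-1) ^ p * fl_mat d M p j i))"
        using tr'[of "Suc p"] p IH by simp
      also have "\<dots> = (-1) ^ Suc p * (real (Suc p) * fl_coeff d M (Suc p))"
        unfolding fl_coeff_Suc_times by (simp add: sum_distrib_left mult.left_commute sum_negf)
      finally have "real (Suc p) * c (d - Suc p) = real (Suc p) * ((-1) ^ Suc p * fl_coeff d M (Suc p))"
        by (simp only: mult.left_commute)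
      hence c: "c (d - Suc p) = (-1) ^ Suc p * fl_coeff d M (Suc p)"
        by (simp del: of_nat_Suc power_Suc)
      have S: "Suc (d - Suc (Suc p)) = d - Suc p" using p by simp
      have "\<beta> (d - Suc (Suc p)) a b = (-1) ^ Suc p * fl_mat d M (Suc p) a b" if "a < d" "b < d" for a b
        unfolding rec[OF that, of "d - Suc (Suc p)"] S using that IH
        by (simp add: c fl_mat_Suc sum_distrib_left algebra_simps sum_negf del: fl_mat.simps)
      with c show "(\<forall>a<d. \<forall>b<d. \<beta> (d - Suc (Suc p)) a b = (-1) ^ Suc p * fl_mat d M (Suc p) a b)
          \<and> c (d - Suc p) = (-1) ^ Suc p * fl_coeff d M (Suc p)" by blast
    qed
  qed
  show "coeff (adj_mat (char_poly_matrix A) $$ (a, b)) (d - Suc p) = (-1) ^ p * fl_mat d M p a b"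
    if "p < d" "a < d" "b < d" for p a b
    using main[of p] that by (simp add: \<beta>_def B_def)
  show "coeff (char_poly A) (d - p) = (-1) ^ p * fl_coeff d M p" if "p \<le> d" for p
  proof (cases "p = d")
    case False
    then show ?thesis using main[of p] that by (simp add: c_def)
  next
    case True
    show ?thesis
    proof (cases p)
      case 0
      then show ?thesis using True monic by (simp add: c_def)
    next
      case (Suc q)
      have "real (Suc q) * c (d - p) = - (\<Sum>i<d. \<Sum>j<d. M i j * ((-1) ^ q * fl_mat d M q j i))"
        using tr'[of p] main[of q] True Suc by simp
      also have "\<dots> = (-1) ^ Suc q * (real (Suc q) * fl_coeff d M (Suc q))"
        unfolding fl_coeff_Suc_times by (simp add: sum_distrib_left mult.left_commute sum_negf)
      finally have "real (Suc q) * c (d - p) = real (Suc q) * ((-1) ^ p * fl_coeff d M p)"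
        by (simp only: mult.left_commute Suc)
      thus ?thesis by (simp add: c_def del: of_nat_Suc)
    qed
  qed
qed

definition add_outer :: "(nat \<Rightarrow> nat \<Rightarrow> real) \<Rightarrow> (nat \<Rightarrow> real) \<Rightarrow> nat \<Rightarrow> nat \<Rightarrow> real" where
  "add_outer M v = (\<lambda>a b. M a b + v a * v b)"

text \<open>X I - (M + v v^T) is a rank-one update of X I - M by -v and v^T. Applying
  \<open>det_rank_one_update\<close> over polynomials and reading off the coefficient of X^(d-1-p)
  leaves the matching adjugate coefficient between v^T and v.\<close>

lemma fl_coeff_add_outer:
  assumes p: "p < d"
  shows "fl_coeff d (add_outer M v) (Suc p) =
    fl_coeff d M (Suc p) + (\<Sum>a<d. \<Sum>b<d. v a * fl_mat d M p a b * v b)"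
proof -
  let ?A = "mat d d (\<lambda>(a, b). M a b)" and ?A' = "mat d d (\<lambda>(a, b). add_outer M v a b)"
  let ?N = "char_poly_matrix ?A"
  let ?u = "mat d 1 (\<lambda>(a, _). [:- v a:])" and ?w = "mat 1 d (\<lambda>(_, b). [:v b:])"
  have N: "?N \<in> carrier_mat d d" by simp
  have "char_poly_matrix ?A' = ?N + ?u * ?w"
    by (intro eq_matI) (auto simp: char_poly_matrix_def add_outer_def scalar_prod_def)
  moreover have "det ?N \<noteq> 0"
    using degree_monic_char_poly[of ?A d] p unfolding char_poly_def by auto
  ultimately have cp: "char_poly ?A' = char_poly ?A + (?w * adj_mat ?N * ?u) $$ (0, 0)"
    unfolding char_poly_def using det_rank_one_update[OF N, of ?u ?w] by simp
  have "(?w * adj_mat ?N * ?u) $$ (0, 0) =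
      - (\<Sum>b<d. \<Sum>a<d. [:v a:] * adj_mat ?N $$ (a, b) * [:v b:])"
    using adj_mat(1)[OF N]
    by (simp add: scalar_prod_def lessThan_atLeast0 sum_distrib_right sum_negf smult_sum2 mult_ac)
  hence "coeff (char_poly ?A') (d - Suc p) = coeff (char_poly ?A) (d - Suc p)
      - (\<Sum>b<d. \<Sum>a<d. v a * coeff (adj_mat ?N $$ (a, b)) (d - Suc p) * v b)"
    unfolding cp by (simp add: coeff_sum mult_ac)
  also have "(\<Sum>b<d. \<Sum>a<d. v a * coeff (adj_mat ?N $$ (a, b)) (d - Suc p) * v b)
      = (-1) ^ p * (\<Sum>b<d. \<Sum>a<d. v a * fl_mat d M p a b * v b)"
    using p by (simp add: fl_adj_char_poly_matrix(1) sum_distrib_left mult_ac)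
  also have "(\<Sum>b<d. \<Sum>a<d. v a * fl_mat d M p a b * v b) = (\<Sum>a<d. \<Sum>b<d. v a * fl_mat d M p a b * v b)"
    by (rule sum.swap)
  finally have "(-1) ^ Suc p * fl_coeff d (add_outer M v) (Suc p) =
      (-1) ^ Suc p * (fl_coeff d M (Suc p) + (\<Sum>a<d. \<Sum>b<d. v a * fl_mat d M p a b * v b))"
    using fl_adj_char_poly_matrix(2)[of "Suc p" d M] fl_adj_char_poly_matrix(2)[of "Suc p" d "add_outer M v"] p
    by (simp add: algebra_simps)
  thus ?thesis by simp
qed

text \<open>Each \<open>fl_mat d M p\<close> is a polynomial in M. This allows the recursion to be
  written with M on the right, where a row vector can be multiplied from the left.\<close>

lemma fl_mat_commute:
  assumes "a < d" "b < d"
  shows "(\<Sum>c<d. M a c * fl_mat d M p c b) = (\<Sum>c<d. fl_mat d M p a c * M c b)"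
  using assms
proof (induction p arbitrary: a b)
  case 0
  have "(\<Sum>c<d. M a c * fl_mat d M 0 c b) = (\<Sum>c<d. if c = b then M a b else 0)"
    by (intro sum.cong) auto
  moreover have "(\<Sum>c<d. fl_mat d M 0 a c * M c b) = (\<Sum>c<d. if a = c then M a b else 0)"
    by (intro sum.cong) auto
  ultimately show ?case using 0 by simp
next
  case (Suc p)
  let ?e = "fl_coeff d M (Suc p)" and ?G = "fl_mat d M p"
  have "(\<Sum>c<d. M a c * fl_mat d M (Suc p) c b) =
      (\<Sum>c<d. (if c = b then M a b * ?e else 0) - M a c * (\<Sum>i<d. M c i * ?G i b))"
    unfolding fl_mat_Suc by (intro sum.cong) (auto simp: algebra_simps)
  also have "\<dots> = M a b * ?e - (\<Sum>c<d. M a c * (\<Sum>i<d. ?G c i * M i b))"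
    using Suc by (simp add: sum_subtractf)
  also have "(\<Sum>c<d. M a c * (\<Sum>i<d. ?G c i * M i b)) = (\<Sum>i<d. (\<Sum>c<d. M a c * ?G c i) * M i b)"
    unfolding sum_distrib_left sum_distrib_right by (subst sum.swap) (simp add: mult_ac)
  also have "M a b * ?e - (\<Sum>i<d. (\<Sum>c<d. M a c * ?G c i) * M i b) =
      (\<Sum>c<d. (if a = c then M a b * ?e else 0) - (\<Sum>i<d. M a i * ?G i c) * M c b)"
    using Suc.prems by (simp add: sum_subtractf)
  also have "\<dots> = (\<Sum>c<d. fl_mat d M (Suc p) a c * M c b)"
    unfolding fl_mat_Suc by (intro sum.cong) (auto simp: algebra_simps)
  finally show ?case .
qed

text \<open>With q = v^T G_p, the same for both matrices by induction, the next row is E_(p+1) v^T -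
  q M. Passing to M + v v^T increases E_(p+1) by q v, by \<open>fl_coeff_add_outer\<close>, and q M
  by (q v) v^T, so the two changes cancel.\<close>

lemma fl_mat_add_outer:
  assumes "p < d" "b < d"
  shows "(\<Sum>a<d. v a * fl_mat d (add_outer M v) p a b) = (\<Sum>a<d. v a * fl_mat d M p a b)"
  using assms
proof (induction p arbitrary: b)
  case 0
  then show ?case by simp
next
  case (Suc p)
  let ?M = "add_outer M v"
  have row: "(\<Sum>a<d. v a * fl_mat d X (Suc p) a b) =
      v b * fl_coeff d X (Suc p) - (\<Sum>c<d. (\<Sum>a<d. v a * fl_mat d X p a c) * X c b)" for X
  proof -
    have "(\<Sum>a<d. v a * fl_mat d X (Suc p) a b) =
        (\<Sum>a<d. (if a = b then v b * fl_coeff d X (Suc p) else 0) - v a * (\<Sum>c<d. fl_mat d X p a c * X c b))"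
      unfolding fl_mat_Suc using Suc.prems
      by (intro sum.cong) (auto simp: algebra_simps fl_mat_commute)
    also have "\<dots> = v b * fl_coeff d X (Suc p) - (\<Sum>a<d. v a * (\<Sum>c<d. fl_mat d X p a c * X c b))"
      using Suc.prems by (simp add: sum_subtractf)
    also have "(\<Sum>a<d. v a * (\<Sum>c<d. fl_mat d X p a c * X c b)) =
        (\<Sum>c<d. (\<Sum>a<d. v a * fl_mat d X p a c) * X c b)"
      unfolding sum_distrib_left sum_distrib_right by (subst sum.swap) (simp add: mult_ac)
    finally show ?thesis .
  qed
  let ?q = "\<lambda>c. \<Sum>a<d. v a * fl_mat d M p a c"
  have "(\<Sum>c<d. (\<Sum>a<d. v a * fl_mat d ?M p a c) * ?M c b) = (\<Sum>c<d. ?q c * M c b + ?q c * v c * v b)"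
    using Suc by (intro sum.cong) (auto simp: add_outer_def algebra_simps)
  also have "\<dots> = (\<Sum>c<d. ?q c * M c b) + (\<Sum>c<d. ?q c * v c) * v b"
    by (simp add: sum.distrib sum_distrib_right)
  also have "(\<Sum>c<d. ?q c * v c) = (\<Sum>a<d. \<Sum>c<d. v a * fl_mat d M p a c * v c)"
    unfolding sum_distrib_right by (rule sum.swap)
  also have "\<dots> = fl_coeff d ?M (Suc p) - fl_coeff d M (Suc p)"
    using fl_coeff_add_outer[of p d M v] Suc.prems by simp
  finally show ?case
    unfolding row by (simp add: algebra_simps)
qed

section \<open>Elementary symmetric polynomials of the eigenvalues as coefficients\<close>

lemma coeff_prod_linear_factors:
  fixes f :: "nat \<Rightarrow> 'a :: comm_ring_1"
  assumes "l \<le> n"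
  shows "coeff (\<Prod>i<n. [:- f i, 1:]) (n - l) = (-1) ^ l * (\<Sum>S | S \<subseteq> {..<n} \<and> card S = l. \<Prod>i\<in>S. f i)"
proof -
  have "(\<Prod>i<n. [:- f i, 1:]) = (\<Prod>i<n. [:- f i:] + [:0, 1:])"
    by simp
  also have "\<dots> = (\<Sum>X\<in>Pow {..<n}. (\<Prod>i\<in>X. [:- f i:]) * [:0, 1:] ^ card ({..<n} - X))"
    by (subst prod_add) auto
  also have "\<dots> = (\<Sum>X\<in>Pow {..<n}. monom ((-1) ^ card X * (\<Prod>i\<in>X. f i)) (n - card X))"
  proof (intro sum.cong refl)
    fix X assume X: "X \<in> Pow {..<n}"
    hence "finite X" by (auto intro: finite_subset)
    hence "(\<Prod>i\<in>X. [:- f i:]) = [:(-1) ^ card X * (\<Prod>i\<in>X. f i):]"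
      by induction auto
    moreover have "card ({..<n} - X) = n - card X"
      using X \<open>finite X\<close> by (subst card_Diff_subset) auto
    moreover have "[:0, 1:] ^ m = monom (1 :: 'a) m" for m
      by (simp add: monom_altdef)
    ultimately show "(\<Prod>i\<in>X. [:- f i:]) * [:0, 1:] ^ card ({..<n} - X)
        = monom ((-1) ^ card X * (\<Prod>i\<in>X. f i)) (n - card X)"
      by (simp add: smult_monom)
  qed
  also have "coeff \<dots> (n - l) = (\<Sum>X\<in>Pow {..<n}. if card X = l then (-1) ^ l * (\<Prod>i\<in>X. f i) else 0)"
    unfolding coeff_sum
  proof (intro sum.cong refl)
    fix X assume "X \<in> Pow {..<n}"
    hence "card X \<le> n" using card_mono[of "{..<n}" X] by auto
    thus "coeff (monom ((-1) ^ card X * (\<Prod>i\<in>X. f i)) (n - card X)) (n - l) =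
        (if card X = l then (-1) ^ l * (\<Prod>i\<in>X. f i) else 0)"
      using assms by auto
  qed
  also have "\<dots> = (\<Sum>X | X \<subseteq> {..<n} \<and> card X = l. (-1) ^ l * (\<Prod>i\<in>X. f i))"
    by (subst sum.inter_filter[symmetric]) (auto simp: Pow_def intro!: sum.cong)
  finally show ?thesis by (simp add: sum_distrib_left)
qed

text \<open>Over the complex numbers the polynomial factors. For an eigenvector v the Hermitian form
  \<open>S\<close> equals its own conjugate by symmetry and also equals a times the positive number
  \<open>R\<close>, so every root a is real; injectivity of the embedding then transfers the
  factorization to the reals.\<close>

lemma symmetric_char_poly_splits:
  fixes A :: "real mat"
  assumes A: "A \<in> carrier_mat d d" and sym: "\<And>i j. i < d \<Longrightarrow> j < d \<Longrightarrow> A $$ (i, j) = A $$ (j, i)"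
  shows "\<exists>as. char_poly A = (\<Prod>a\<leftarrow>as. [:- a, 1:]) \<and> length as = d"
proof -
  let ?A = "map_mat complex_of_real A"
  have A': "?A \<in> carrier_mat d d" using A by simp
  obtain as where as: "char_poly ?A = (\<Prod>a\<leftarrow>as. [:- a, 1:])" "length as = d"
    using char_poly_factorized[OF A'] by blast
  have real: "complex_of_real (Re a) = a" if "a \<in> set as" for a
  proof -
    have "poly (char_poly ?A) a = 0"
      using that unfolding as(1) by (simp add: poly_prod_list prod_list_zero_iff image_iff)
    hence "eigenvalue ?A a" using eigenvalue_root_char_poly[OF A'] by simp
    then obtain v where v: "v \<in> carrier_vec d" "v \<noteq> 0\<^sub>v d" "?A *\<^sub>v v = a \<cdot>\<^sub>v v"
      using A' unfolding eigenvalue_def eigenvector_def by auto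
    have ev: "(\<Sum>j<d. complex_of_real (A $$ (i, j)) * v $ j) = a * v $ i" if "i < d" for i
      using arg_cong[OF v(3), of "\<lambda>w. w $ i"] that A v(1)
      by (simp add: scalar_prod_def lessThan_atLeast0)
    define S where "S = (\<Sum>i<d. \<Sum>j<d. cnj (v $ i) * complex_of_real (A $$ (i, j)) * v $ j)"
    define R where "R = (\<Sum>i<d. (cmod (v $ i))\<^sup>2)"
    have "S = (\<Sum>i<d. cnj (v $ i) * (\<Sum>j<d. complex_of_real (A $$ (i, j)) * v $ j))"
      by (simp add: S_def sum_distrib_left mult_ac)
    also have "\<dots> = (\<Sum>i<d. a * complex_of_real ((cmod (v $ i))\<^sup>2))"
    proof (intro sum.cong refl)
      fix i assume "i \<in> {..<d}"
      hence "cnj (v $ i) * (\<Sum>j<d. complex_of_real (A $$ (i, j)) * v $ j) = a * (v $ i * cnj (v $ i))"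
        by (simp add: ev)
      thus "cnj (v $ i) * (\<Sum>j<d. complex_of_real (A $$ (i, j)) * v $ j) = a * complex_of_real ((cmod (v $ i))\<^sup>2)"
        by (simp only: complex_norm_square)
    qed
    finally have S: "S = a * complex_of_real R"
      by (simp add: R_def sum_distrib_left)
    have "cnj S = (\<Sum>i<d. \<Sum>j<d. v $ i * complex_of_real (A $$ (i, j)) * cnj (v $ j))"
      by (simp add: S_def)
    also have "\<dots> = (\<Sum>j<d. \<Sum>i<d. v $ i * complex_of_real (A $$ (i, j)) * cnj (v $ j))"
      by (rule sum.swap)
    also have "\<dots> = S"
      unfolding S_def by (intro sum.cong) (auto simp: sym mult_ac)
    finally have "cnj a * complex_of_real R = a * complex_of_real R"
      unfolding S by simp
    moreover obtain i where "i < d" "v $ i \<noteq> 0"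
      using v(1,2) by (metis carrier_vecD eq_vecI index_zero_vec(1) index_zero_vec(2))
    hence "R > 0"
      unfolding R_def by (intro sum_pos2[of _ i]) auto
    ultimately have "cnj a = a" by simp
    thus ?thesis by (simp add: complex_eq_iff)
  qed
  interpret mp: map_poly_inj_idom_hom complex_of_real ..
  have hom: "(\<Prod>a\<leftarrow>as. [:- a, 1:]) = map_poly complex_of_real (\<Prod>a\<leftarrow>map Re as. [:- a, 1:])"
    using real
  proof (induction as)
    case (Cons a as)
    have "map_poly complex_of_real [:- Re a, 1:] = [:- a, 1:]"
      using Cons.prems[of a] by (simp add: map_poly_pCons)
    then show ?case using Cons by (simp add: mp.hom_mult del: mult_pCons_left)
  qed simp
  have "map_poly complex_of_real (char_poly A) = map_poly complex_of_real (\<Prod>a\<leftarrow>map Re as. [:- a, 1:])"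
    unfolding hom[symmetric] as(1)[symmetric] by (rule of_real_hom.char_poly_hom[OF A, symmetric])
  hence "char_poly A = (\<Prod>a\<leftarrow>map Re as. [:- a, 1:])"
    by (simp only: mp.eq_iff)
  thus ?thesis using as(2) by (intro exI[of _ "map Re as"]) simp
qed

text \<open>The bridge from the spectral definition to the recursion: Vieta's formulas and
  \<open>fl_adj_char_poly_matrix\<close> describe the same coefficient. Symmetry ensures that
  \<open>eigenvals\<close> lists all d roots.\<close>

lemma E_eq_fl_coeff:
  assumes l: "l \<le> d" and sym: "\<And>a b. a < d \<Longrightarrow> b < d \<Longrightarrow> M a b = M b a"
  shows "E l (mat d d (\<lambda>(a, b). M a b)) = fl_coeff d M l"
proof -
  let ?A = "mat d d (\<lambda>(a, b). M a b)"
  let ?e = "eigenvals ?A"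
  obtain as where as: "char_poly ?A = (\<Prod>a\<leftarrow>as. [:- a, 1:])" "length as = d"
    using symmetric_char_poly_splits[of ?A d] sym by auto
  have "proots (char_poly ?A) = mset as"
    unfolding as(1)
  proof (induction as)
    case (Cons a as)
    have "(\<Prod>a\<leftarrow>as. [:- a, 1:]) \<noteq> 0" by (auto simp: prod_list_zero_iff)
    hence "proots ([:- a, 1:] * (\<Prod>a\<leftarrow>as. [:- a, 1:])) = {#a#} + mset as"
      using Cons by (subst proots_mult) auto
    thus ?case by simp
  qed simp
  hence me: "mset ?e = mset as" by (simp add: eigenvals_def)
  hence len: "length ?e = d" using as(2) by (metis size_mset)
  have "char_poly ?A = prod_mset (image_mset (\<lambda>a. [:- a, 1:]) (mset as))"
    unfolding as(1) by (simp flip: prod_mset_prod_list)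
  also have "\<dots> = (\<Prod>a\<leftarrow>?e. [:- a, 1:])"
    unfolding me[symmetric] by (simp flip: prod_mset_prod_list)
  also have "\<dots> = (\<Prod>i<d. [:- (?e ! i), 1:])"
    unfolding prod.list_conv_set_nth using len by (simp add: lessThan_atLeast0)
  finally have "coeff (char_poly ?A) (d - l) = (-1) ^ l * E l ?A"
    using coeff_prod_linear_factors[OF l, of "\<lambda>i. ?e ! i"] by (simp add: E_def len)
  thus ?thesis using fl_adj_char_poly_matrix(2)[OF l, of M] by simp
qed

text \<open>On an eigenvector x the quadratic form is the eigenvalue times |x|^2, and it is also a
  sum of squares with weights \<open>w\<close>; hence all eigenvalues are nonnegative.\<close>

lemma E_sum_outer_nonneg:
  assumes w: "\<And>i. i < n \<Longrightarrow> 0 \<le> w i"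
  shows "0 \<le> E l (sum_outer d n w u)"
proof -
  let ?A = "sum_outer d n w u"
  have A: "?A \<in> carrier_mat d d" by (simp add: sum_outer_def)
  have nz: "char_poly ?A \<noteq> 0" using degree_monic_char_poly[OF A] by auto
  have "0 \<le> \<mu>" if "\<mu> \<in> set (eigenvals ?A)" for \<mu>
  proof -
    have "eigenvalue ?A \<mu>"
      using that nz eigenvalue_root_char_poly[OF A] by (simp add: eigenvals_def)
    then obtain x where x: "x \<in> carrier_vec d" "x \<noteq> 0\<^sub>v d" "?A *\<^sub>v x = \<mu> \<cdot>\<^sub>v x"
      using A unfolding eigenvalue_def eigenvector_def by auto
    have ev: "(\<Sum>j<d. ?A $$ (i, j) * x $ j) = \<mu> * x $ i" if "i < d" for i
      using arg_cong[OF x(3), of "\<lambda>w. w $ i"] that A x(1)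
      by (simp add: scalar_prod_def lessThan_atLeast0)
    have "\<mu> * (\<Sum>i<d. (x $ i)\<^sup>2) = (\<Sum>i<d. x $ i * (\<Sum>j<d. ?A $$ (i, j) * x $ j))"
      by (simp add: ev sum_distrib_left power2_eq_square mult.left_commute)
    also have "\<dots> = (\<Sum>i<d. \<Sum>j<d. \<Sum>k<n. w k * ((x $ i * u k $ i) * (x $ j * u k $ j)))"
      by (auto simp: sum_outer_def sum_distrib_left sum_distrib_right mult_ac intro!: sum.cong)
    also have "\<dots> = (\<Sum>i<d. \<Sum>k<n. \<Sum>j<d. w k * ((x $ i * u k $ i) * (x $ j * u k $ j)))"
      by (intro sum.cong refl sum.swap)
    also have "\<dots> = (\<Sum>k<n. \<Sum>i<d. \<Sum>j<d. w k * ((x $ i * u k $ i) * (x $ j * u k $ j)))"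
      by (rule sum.swap)
    also have "\<dots> = (\<Sum>k<n. w k * (\<Sum>i<d. x $ i * u k $ i)\<^sup>2)"
      by (simp add: power2_eq_square sum_distrib_left sum_distrib_right mult_ac)
    also have "\<dots> \<ge> 0" using w by (intro sum_nonneg mult_nonneg_nonneg) auto
    finally have "0 \<le> \<mu> * (\<Sum>i<d. (x $ i)\<^sup>2)" .
    moreover obtain i where "i < d" "x $ i \<noteq> 0"
      using x(1,2) by (metis carrier_vecD eq_vecI index_zero_vec(1) index_zero_vec(2))
    hence "(\<Sum>i<d. (x $ i)\<^sup>2) > 0"
      by (intro sum_pos2[of _ i]) auto
    ultimately show ?thesis by (simp add: zero_le_mult_iff)
  qed
  thus ?thesis
    unfolding E_def by (intro sum_nonneg prod_nonneg) (auto intro: nth_mem)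
qed

section \<open>Conditional expectations\<close>

text \<open>Homogeneity, used to pass from the mean matrix to the relaxed matrix, which is k times
  as large.\<close>

lemma fl_coeff_scale: "fl_coeff d (\<lambda>a b. c * M a b) p = c ^ p * fl_coeff d M p"
proof -
  have "fl_mat d (\<lambda>a b. c * M a b) p a b = c ^ p * fl_mat d M p a b" for p a b
    by (induction p arbitrary: a b) (auto simp: sum_distrib_left algebra_simps)
  thus ?thesis
    by (cases p) (auto simp: fl_coeff_Suc sum_distrib_left algebra_simps)
qed

text \<open>The falling factorial r(r-1)...(r-p+1). Lowering r and p together matches the recursion
  for the expectations, and the value 0 for p > r is what makes E_p vanish for too few
  samples.\<close>

primrec falling :: "nat \<Rightarrow> nat \<Rightarrow> nat" where
  "falling r 0 = 1"
| "falling r (Suc p) = (case r of 0 \<Rightarrow> 0 | Suc q \<Rightarrow> Suc q * falling q p)"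

lemma falling_Suc: "falling r (Suc p) = r * falling (r - 1) p"
  by (cases r) auto

lemma falling_eq_0: "r < p \<Longrightarrow> falling r p = 0"
  by (induction p arbitrary: r) (auto split: nat.split)

lemma falling_times_fact: "p \<le> r \<Longrightarrow> falling r p * fact (r - p) = fact r"
  by (induction p arbitrary: r) (auto split: nat.split simp: mult.assoc simp del: mult_Suc)

text \<open>
  \<open>expect m w u r g A\<close> is the expectation of \<open>g\<close> at \<open>A\<close> plus \<open>r\<close> independent samples of
  \<open>u\<^sub>i u\<^sub>i\<^sup>T\<close>, \<open>i < m\<close>, drawn with weights \<open>w\<close>.
\<close>
primrec expect :: "nat \<Rightarrow> (nat \<Rightarrow> real) \<Rightarrow> (nat \<Rightarrow> nat \<Rightarrow> real) \<Rightarrow> nat \<Rightarrow>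
    ((nat \<Rightarrow> nat \<Rightarrow> real) \<Rightarrow> real) \<Rightarrow> (nat \<Rightarrow> nat \<Rightarrow> real) \<Rightarrow> real" where
  "expect m w u 0 g A = g A"
| "expect m w u (Suc r) g A = (\<Sum>i<m. w i * expect m w u r g (add_outer A (u i)))"

lemma expect_diff: "expect m w u r (\<lambda>M. g M - h M) A = expect m w u r g A - expect m w u r h A"
  by (induction r arbitrary: A) (auto simp: sum_subtractf right_diff_distrib)

lemma expect_add: "expect m w u r (\<lambda>M. g M + h M) A = expect m w u r g A + expect m w u r h A"
  by (induction r arbitrary: A) (auto simp: sum.distrib algebra_simps)

lemma expect_cmult: "expect m w u r (\<lambda>M. c * g M) A = c * expect m w u r g A"
  by (induction r arbitrary: A) (auto simp: sum_distrib_left algebra_simps)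

lemma expect_uminus: "expect m w u r (\<lambda>M. - g M) A = - expect m w u r g A"
  using expect_cmult[of m w u r "-1" g A] by simp

lemma expect_zero: "expect m w u r (\<lambda>M. 0) A = 0"
  by (induction r arbitrary: A) auto

lemma expect_sum: "expect m w u r (\<lambda>M. \<Sum>c<(n::nat). g c M) A = (\<Sum>c<n. expect m w u r (g c) A)"
  by (induction n) (simp_all add: expect_zero expect_add)

lemma expect_const: "(\<Sum>i<m. w i) = 1 \<Longrightarrow> expect m w u r (\<lambda>M. c) A = c"
  by (induction r arbitrary: A) (auto simp flip: sum_distrib_right)

text \<open>Added outer products commute, so a shift of the starting matrix can be moved past all
  samples into the integrand.\<close>

lemma expect_add_outer: "expect m w u r g (add_outer A v) = expect m w u r (\<lambda>M. g (add_outer M v)) A"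
proof (induction r arbitrary: A)
  case (Suc r)
  have "add_outer (add_outer A v) (u i) = add_outer (add_outer A (u i)) v" for i
    by (simp add: add_outer_def fun_eq_iff)
  then show ?case using Suc by simp
qed simp

definition mean_outer :: "nat \<Rightarrow> (nat \<Rightarrow> real) \<Rightarrow> (nat \<Rightarrow> nat \<Rightarrow> real) \<Rightarrow> nat \<Rightarrow> nat \<Rightarrow> real" where
  "mean_outer n w u = (\<lambda>a b. \<Sum>i<n. w i * (u i a * u i b))"

text \<open>M is A plus r sampled outer products. Each sample contributes u u^T G_p(M), in which G_p
  no longer depends on that sample by \<open>fl_mat_add_outer\<close>, so averaging factors into the
  mean matrix times an expectation over r - 1 samples. The truncation of r - 1 at r = 0 is harmless
  because of the factor \<open>real r\<close>.\<close>

lemma expect_mat_mult: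
  assumes p: "p < d" and b: "b < d"
  shows "expect m w u r (\<lambda>M. \<Sum>c<d. M a c * fl_mat d M p c b) A =
    (\<Sum>c<d. A a c * expect m w u r (\<lambda>M. fl_mat d M p c b) A)
    + real r * (\<Sum>c<d. mean_outer m w u a c * expect m w u (r - 1) (\<lambda>M. fl_mat d M p c b) A)"
proof (induction r arbitrary: A)
  case 0
  then show ?case by simp
next
  case (Suc r)
  let ?F = "\<lambda>r c A. expect m w u r (\<lambda>M. fl_mat d M p c b) A"
  \<comment> \<open>Here the first sample disappears from the matrix factor, as it is multiplied
    from the left by its own vector.\<close>
  have inv: "(\<Sum>c<d. u i c * ?F r c (add_outer A (u i))) = (\<Sum>c<d. u i c * ?F r c A)" for i
    unfolding expect_add_outer[of m w u r _ A] expect_cmult[symmetric] expect_sum[symmetric]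
    using fl_mat_add_outer[OF p b] by simp
  have "expect m w u (Suc r) (\<lambda>M. \<Sum>c<d. M a c * fl_mat d M p c b) A
      = (\<Sum>i<m. w i * ((\<Sum>c<d. add_outer A (u i) a c * ?F r c (add_outer A (u i)))
        + real r * (\<Sum>c<d. mean_outer m w u a c * ?F (r - 1) c (add_outer A (u i)))))"
    using Suc by simp
  also have "\<dots> = (\<Sum>i<m. (\<Sum>c<d. A a c * (w i * ?F r c (add_outer A (u i))))
      + w i * u i a * (\<Sum>c<d. u i c * ?F r c (add_outer A (u i)))
      + (\<Sum>c<d. real r * (mean_outer m w u a c * (w i * ?F (r - 1) c (add_outer A (u i))))))"
    by (intro sum.cong refl)
       (simp add: add_outer_def algebra_simps sum.distrib sum_distrib_left)
  also have "\<dots> = (\<Sum>i<m. \<Sum>c<d. A a c * (w i * ?F r c (add_outer A (u i))))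
      + (\<Sum>i<m. w i * u i a * (\<Sum>c<d. u i c * ?F r c A))
      + (\<Sum>i<m. \<Sum>c<d. real r * (mean_outer m w u a c * (w i * ?F (r - 1) c (add_outer A (u i)))))"
    by (simp add: sum.distrib inv)
  also have "(\<Sum>i<m. \<Sum>c<d. A a c * (w i * ?F r c (add_outer A (u i)))) = (\<Sum>c<d. A a c * ?F (Suc r) c A)"
    by (subst sum.swap) (simp add: sum_distrib_left)
  also have "(\<Sum>i<m. w i * u i a * (\<Sum>c<d. u i c * ?F r c A)) = (\<Sum>c<d. mean_outer m w u a c * ?F r c A)"
    unfolding mean_outer_def sum_distrib_left sum_distrib_right
    by (subst sum.swap) (simp add: mult_ac)
  also have "(\<Sum>i<m. \<Sum>c<d. real r * (mean_outer m w u a c * (w i * ?F (r - 1) c (add_outer A (u i)))))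
      = real r * (\<Sum>c<d. mean_outer m w u a c * ?F r c A)"
  proof (cases r)
    case (Suc q)
    then show ?thesis by (subst sum.swap) (simp add: sum_distrib_left)
  qed simp
  finally show ?case by (simp add: algebra_simps)
qed

definition ecoeff :: "nat \<Rightarrow> nat \<Rightarrow> (nat \<Rightarrow> real) \<Rightarrow> (nat \<Rightarrow> nat \<Rightarrow> real) \<Rightarrow> nat \<Rightarrow> nat \<Rightarrow>
    (nat \<Rightarrow> nat \<Rightarrow> real) \<Rightarrow> real" where
  "ecoeff d m w u p r A = expect m w u r (\<lambda>M. fl_coeff d M p) A"

definition emat :: "nat \<Rightarrow> nat \<Rightarrow> (nat \<Rightarrow> real) \<Rightarrow> (nat \<Rightarrow> nat \<Rightarrow> real) \<Rightarrow> nat \<Rightarrow> nat \<Rightarrow>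
    (nat \<Rightarrow> nat \<Rightarrow> real) \<Rightarrow> nat \<Rightarrow> nat \<Rightarrow> real" where
  "emat d m w u p r A a b = expect m w u r (\<lambda>M. fl_mat d M p a b) A"

text \<open>The expectation of M G_p(M) in the form supplied by \<open>expect_mat_mult\<close>: two
  matrix products with entries of the preceding level, which is exactly what the program
  evaluates.\<close>

definition emul :: "nat \<Rightarrow> nat \<Rightarrow> (nat \<Rightarrow> real) \<Rightarrow> (nat \<Rightarrow> nat \<Rightarrow> real) \<Rightarrow> nat \<Rightarrow> nat \<Rightarrow>
    (nat \<Rightarrow> nat \<Rightarrow> real) \<Rightarrow> nat \<Rightarrow> nat \<Rightarrow> real" where
  "emul d m w u p r A a b = (\<Sum>c<d. A a c * emat d m w u p r A c b)
     + real r * (\<Sum>c<d. mean_outer m w u a c * emat d m w u p (r - 1) A c b)"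

lemma emat_0: "(\<Sum>i<m. w i) = 1 \<Longrightarrow> emat d m w u 0 r A a b = (if a = b then 1 else 0)"
  by (simp add: emat_def expect_const)

lemma ecoeff_0: "(\<Sum>i<m. w i) = 1 \<Longrightarrow> ecoeff d m w u 0 r A = 1"
  by (simp add: ecoeff_def expect_const)

lemma ecoeff_Suc:
  assumes "p < d"
  shows "ecoeff d m w u (Suc p) r A = (\<Sum>a<d. emul d m w u p r A a a) / real (Suc p)"
proof -
  have "ecoeff d m w u (Suc p) r A =
      inverse (real (Suc p)) * expect m w u r (\<lambda>M. \<Sum>a<d. \<Sum>c<d. M a c * fl_mat d M p c a) A"
    unfolding ecoeff_def fl_coeff_Suc expect_cmult[symmetric] by (simp add: field_simps)
  also have "expect m w u r (\<lambda>M. \<Sum>a<d. \<Sum>c<d. M a c * fl_mat d M p c a) A = (\<Sum>a<d. emul d m w u p r A a a)"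
    unfolding expect_sum[where g = "\<lambda>a M. \<Sum>c<d. M a c * fl_mat d M p c a"]
    using assms by (intro sum.cong) (auto simp: expect_mat_mult emul_def emat_def)
  finally show ?thesis by (simp add: field_simps)
qed

lemma emat_Suc:
  assumes "p < d" "b < d"
  shows "emat d m w u (Suc p) r A a b =
    (if a = b then ecoeff d m w u (Suc p) r A else 0) - emul d m w u p r A a b"
  using assms
  by (cases "a = b")
     (simp_all add: emat_def fl_mat_Suc expect_diff expect_mat_mult emul_def ecoeff_def expect_uminus
        del: fl_mat.simps)

lemma ecoeff_add_outer:
  assumes "p < d"
  shows "ecoeff d m w u (Suc p) r (add_outer A v) =
    ecoeff d m w u (Suc p) r A + (\<Sum>a<d. \<Sum>b<d. v a * emat d m w u p r A a b * v b)"
proof -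
  have "ecoeff d m w u (Suc p) r (add_outer A v) = ecoeff d m w u (Suc p) r A
      + expect m w u r (\<lambda>M. \<Sum>a<d. \<Sum>b<d. (v a * v b) * fl_mat d M p a b) A"
    unfolding ecoeff_def expect_add_outer fl_coeff_add_outer[OF assms] expect_add
    by (simp add: mult_ac)
  also have "expect m w u r (\<lambda>M. \<Sum>a<d. \<Sum>b<d. (v a * v b) * fl_mat d M p a b) A =
      (\<Sum>a<d. \<Sum>b<d. (v a * v b) * emat d m w u p r A a b)"
    unfolding emat_def expect_cmult[symmetric] expect_sum[symmetric] ..
  finally show ?thesis by (simp add: mult_ac)
qed

lemma ecoeff_step: "ecoeff d m w u p (Suc r) A = (\<Sum>i<m. w i * ecoeff d m w u p r (add_outer A (u i)))"
  by (simp add: ecoeff_def)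

text \<open>For A = 0 the first product in \<open>emul\<close> drops out; each level multiplies by r
  and lowers r by one, which builds up the falling factorial and otherwise repeats the recursion for
  the mean matrix.\<close>

lemma ecoeff_zero_matrix:
  assumes w: "(\<Sum>i<m. w i) = 1" and p: "p \<le> d"
  shows "ecoeff d m w u p r (\<lambda>a b. 0) = real (falling r p) * fl_coeff d (mean_outer m w u) p"
proof -
  let ?Y = "mean_outer m w u"
  have mat: "\<forall>a<d. \<forall>b<d. emat d m w u p r (\<lambda>a b. 0) a b = real (falling r p) * fl_mat d ?Y p a b"
    if "p < d" for p r
    using that
  proof (induction p arbitrary: r)
    case 0
    show ?case using w by (simp add: emat_0)
  next
    case (Suc p)
    have mul: "emul d m w u p r (\<lambda>a b. 0) a b =
        real (falling r (Suc p)) * (\<Sum>c<d. ?Y a c * fl_mat d ?Y p c b)" if "b < d" for a b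
      using Suc that by (simp add: emul_def falling_Suc sum_distrib_left mult_ac del: falling.simps)
    hence "ecoeff d m w u (Suc p) r (\<lambda>a b. 0) = real (falling r (Suc p)) * fl_coeff d ?Y (Suc p)"
      using Suc.prems by (simp add: ecoeff_Suc fl_coeff_Suc sum_distrib_left del: falling.simps)
    then show ?case
      using mul Suc.prems
      by (auto simp: emat_Suc fl_mat_Suc right_diff_distrib simp del: falling.simps fl_mat.simps)
  qed
  show ?thesis
  proof (cases p)
    case 0
    then show ?thesis using w by (simp add: ecoeff_0)
  next
    case (Suc q)
    have mul: "emul d m w u q r (\<lambda>a b. 0) a b =
        real (falling r (Suc q)) * (\<Sum>c<d. ?Y a c * fl_mat d ?Y q c b)" if "b < d" for a b
      using Suc p mat that by (simp add: emul_def falling_Suc sum_distrib_left mult_ac del: falling.simps)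
    then show ?thesis
      using Suc p by (simp add: ecoeff_Suc fl_coeff_Suc sum_distrib_left del: falling.simps)
  qed
qed

section \<open>Positivity, and vanishing of E_l for fewer than l vectors\<close>

text \<open>Positive semidefiniteness given by an explicit sum of outer products: closure under
  \<open>add_outer\<close> is then immediate, and every matrix reached by sampling from 0 has this
  form.\<close>

definition psd_sum :: "(nat \<Rightarrow> nat \<Rightarrow> real) \<Rightarrow> bool" where
  "psd_sum A \<longleftrightarrow> (\<exists>n c z. (\<forall>i<n. 0 \<le> c i) \<and> A = mean_outer n c z)"

lemma psd_sum_mean_outer: "(\<And>i. i < n \<Longrightarrow> 0 \<le> c i) \<Longrightarrow> psd_sum (mean_outer n c z)"
  by (auto simp: psd_sum_def)

lemma psd_sum_zero: "psd_sum (\<lambda>a b. 0)"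
  using psd_sum_mean_outer[of 0] by (simp add: mean_outer_def)

lemma psd_sum_add_outer:
  assumes "psd_sum A"
  shows "psd_sum (add_outer A v)"
proof -
  obtain n c z where c: "\<forall>i<n. 0 \<le> c i" and A: "A = mean_outer n c z"
    using assms by (auto simp: psd_sum_def)
  have "add_outer A v = mean_outer (Suc n) (c(n := 1)) (z(n := v))"
    unfolding A by (simp add: add_outer_def mean_outer_def fun_eq_iff)
  moreover have "psd_sum (mean_outer (Suc n) (c(n := 1)) (z(n := v)))"
    by (rule psd_sum_mean_outer) (use c in auto)
  ultimately show ?thesis by simp
qed

lemma sum_outer_eq_mean_outer:
  "sum_outer d n w u = mat d d (\<lambda>(a, b). mean_outer n w (\<lambda>i a. u i $ a) a b)"
  by (simp add: sum_outer_def mean_outer_def)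

lemma E_sum_outer: "l \<le> d \<Longrightarrow> E l (sum_outer d n w u) = fl_coeff d (mean_outer n w (\<lambda>i a. u i $ a)) l"
  unfolding sum_outer_eq_mean_outer
  by (rule E_eq_fl_coeff) (auto simp: mean_outer_def mult_ac)

lemma fl_mat_cong:
  assumes "\<And>a b. a < d \<Longrightarrow> b < d \<Longrightarrow> M a b = N a b"
  shows "a < d \<Longrightarrow> fl_mat d M p a b = fl_mat d N p a b"
  by (induction p arbitrary: a b) (auto simp: assms)

lemma fl_coeff_cong:
  assumes "\<And>a b. a < d \<Longrightarrow> b < d \<Longrightarrow> M a b = N a b"
  shows "fl_coeff d M p = fl_coeff d N p"
  using fl_mat_cong[of d M N] assms by (cases p) (simp_all add: fl_coeff_Suc)

lemma fl_coeff_nonneg: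
  assumes "psd_sum A" "p \<le> d"
  shows "0 \<le> fl_coeff d A p"
proof -
  obtain n c z where c: "\<forall>i<n. 0 \<le> c i" and A: "A = mean_outer n c z"
    using assms by (auto simp: psd_sum_def)
  have "E p (sum_outer d n c (\<lambda>i. vec d (z i))) = fl_coeff d A p"
    unfolding E_sum_outer[OF assms(2)] A
    by (rule fl_coeff_cong) (simp add: mean_outer_def)
  thus ?thesis using E_sum_outer_nonneg[of n c p d] c by metis
qed

lemma expect_nonneg:
  assumes "\<And>i. i < m \<Longrightarrow> 0 \<le> w i" "\<And>M. psd_sum M \<Longrightarrow> 0 \<le> g M" "psd_sum A"
  shows "0 \<le> expect m w u r g A"
  using assms(3)
  by (induction r arbitrary: A) (auto intro!: sum_nonneg mult_nonneg_nonneg assms psd_sum_add_outer)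

lemma ecoeff_nonneg:
  assumes "\<And>i. i < m \<Longrightarrow> 0 \<le> w i" "psd_sum A" "p \<le> d"
  shows "0 \<le> ecoeff d m w u p r A"
  unfolding ecoeff_def by (intro expect_nonneg assms fl_coeff_nonneg)

text \<open>
  Sampling \<open>n < l\<close> vectors uniformly gives \<open>E\<^sub>l\<close> expectation \<open>0\<close>, so the nonnegative term of the sample
  that contains every vector once vanishes.
\<close>
lemma fl_coeff_mean_outer_eq_0:
  assumes c: "\<And>i. i < n \<Longrightarrow> 0 \<le> c i" and l: "n < l" "l \<le> d"
  shows "fl_coeff d (mean_outer n c z) l = 0"
proof (cases "n = 0")
  case True
  have "fl_coeff d (\<lambda>a b. 0) l = 0"
    using l by (cases l) (auto simp: fl_coeff_Suc)
  then show ?thesis using True by (simp add: mean_outer_def)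
next
  case False
  \<comment> \<open>The square root absorbs the weight, so that drawing each index exactly once
    produces the weighted matrix itself.\<close>
  define u where "u i = (\<lambda>a. sqrt (c i) * z i a)" for i
  define w where "w = (\<lambda>i::nat. 1 / real n)"
  let ?g = "\<lambda>M. fl_coeff d M l"
  \<comment> \<open>Of all sequences of r draws only r - 1, ..., 1, 0 is kept; the other summands
    are nonnegative and are discarded.\<close>
  have path: "(1 / real n) ^ r * ?g (\<lambda>a b. A a b + mean_outer r (\<lambda>_. 1) u a b) \<le> expect n w u r ?g A"
    if "r \<le> n" "psd_sum A" for r A
    using that
  proof (induction r arbitrary: A)
    case 0
    then show ?case by (simp add: mean_outer_def)
  next
    case (Suc r)
    let ?A = "add_outer A (u r)"
    have psd: "psd_sum ?A" using Suc.prems by (simp add: psd_sum_add_outer)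
    have eq: "(\<lambda>a b. A a b + mean_outer (Suc r) (\<lambda>_. 1) u a b)
        = (\<lambda>a b. ?A a b + mean_outer r (\<lambda>_. 1) u a b)"
      by (simp add: add_outer_def mean_outer_def fun_eq_iff)
    have "(1 / real n) ^ Suc r * ?g (\<lambda>a b. A a b + mean_outer (Suc r) (\<lambda>_. 1) u a b)
        = w r * ((1 / real n) ^ r * ?g (\<lambda>a b. ?A a b + mean_outer r (\<lambda>_. 1) u a b))"
      unfolding eq by (simp add: w_def)
    also have "\<dots> \<le> w r * expect n w u r ?g ?A"
      using Suc.IH[OF _ psd] Suc.prems by (intro mult_left_mono) (auto simp: w_def)
    also have "\<dots> \<le> expect n w u (Suc r) ?g A"
      unfolding expect.simps using Suc.prems l
      by (intro member_le_sum)
         (auto simp: w_def intro!: divide_nonneg_nonneg expect_nonneg psd_sum_add_outer fl_coeff_nonneg)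
    finally show ?case .
  qed
  have "(\<Sum>i<n. w i) = 1" using False by (simp add: w_def)
  hence "expect n w u n ?g (\<lambda>a b. 0) = 0"
    using ecoeff_zero_matrix[of w n l d u n] l by (simp add: ecoeff_def falling_eq_0)
  moreover have "mean_outer n c z = mean_outer n (\<lambda>_. 1) u"
  proof -
    have "c i * (z i a * z i b) = u i a * u i b" if "i < n" for i a b
    proof -
      have "u i a * u i b = (sqrt (c i) * sqrt (c i)) * (z i a * z i b)"
        by (simp only: u_def mult_ac)
      thus ?thesis using c[OF that] by simp
    qed
    thus ?thesis by (simp add: mean_outer_def)
  qed
  ultimately have "(1 / real n) ^ n * ?g (mean_outer n c z) \<le> 0"
    using path[of n "\<lambda>a b. 0"] psd_sum_zero by simp
  moreover have "0 \<le> ?g (mean_outer n c z)"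
    using l c by (intro fl_coeff_nonneg psd_sum_mean_outer) auto
  moreover have "(1 / real n) ^ n > 0" using False by simp
  ultimately show ?thesis by (smt (verit) mult_pos_pos)
qed

text \<open>The mediant inequality. Weighting and summing the optimality of \<open>b\<close> gives N
  b * ?SD <= ?SN * D b; chaining with the invariant \<open>inv\<close> and cancelling the positive
  \<open>?SD\<close> gives the invariant for the chosen candidate. A positive average of the D i
  guarantees a candidate with positive denominator, which triggers \<open>best\<close>.\<close>

lemma greedy_step:
  fixes N D :: "nat \<Rightarrow> real"
  assumes wt: "\<And>i. i < m \<Longrightarrow> 0 \<le> wt i"
    and D0: "0 < (\<Sum>i<m. wt i * D i)"
    and inv: "(\<Sum>i<m. wt i * N i) * D0 \<le> (\<Sum>i<m. wt i * D i) * N0"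
    and best: "(\<exists>i<m. 0 < D i) \<longrightarrow> 0 < D b \<and> (\<forall>i<m. N b * D i \<le> N i * D b)"
    and "0 \<le> D0"
  shows "0 < D b \<and> N b * D0 \<le> D b * N0"
proof -
  have "\<exists>i<m. 0 < D i"
  proof (rule ccontr)
    assume "\<not> ?thesis"
    hence "(\<Sum>i<m. wt i * D i) \<le> 0" by (intro sum_nonpos mult_nonneg_nonpos wt) auto
    thus False using D0 by simp
  qed
  hence Db: "0 < D b" and le: "\<And>i. i < m \<Longrightarrow> N b * D i \<le> N i * D b" using best by auto
  let ?SD = "\<Sum>i<m. wt i * D i" and ?SN = "\<Sum>i<m. wt i * N i"
  have "N b * ?SD = (\<Sum>i<m. wt i * (N b * D i))"
    by (simp add: sum_distrib_left mult_ac)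
  also have "\<dots> \<le> (\<Sum>i<m. wt i * (N i * D b))"
    by (intro sum_mono mult_left_mono le wt) auto
  also have "\<dots> = ?SN * D b" by (simp add: sum_distrib_left mult_ac)
  finally have 1: "N b * ?SD \<le> ?SN * D b" .
  have "?SD * (N b * D0) = (N b * ?SD) * D0" by (simp only: mult_ac)
  also have "\<dots> \<le> (?SN * D b) * D0" using 1 \<open>0 \<le> D0\<close> by (rule mult_right_mono)
  also have "\<dots> = D b * (?SN * D0)" by (simp only: mult_ac)
  also have "\<dots> \<le> D b * (?SD * N0)" using inv Db by (intro mult_left_mono) auto
  also have "\<dots> = ?SD * (D b * N0)" by (simp only: mult_ac)
  finally show ?thesis using D0 Db by simp
qed

section \<open>Total correctness with running time\<close>

primrec nmods :: "com \<Rightarrow> vname set" where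
  "nmods Skip = {}"
| "nmods (NAssign a e f) = {a}"
| "nmods (RAssign a e f p) = {}"
| "nmods (Seq c1 c2) = nmods c1 \<union> nmods c2"
| "nmods (If b c1 c2) = nmods c1 \<union> nmods c2"
| "nmods (While b c) = nmods c"

primrec rmods :: "com \<Rightarrow> vname set" where
  "rmods Skip = {}"
| "rmods (NAssign a e f) = {}"
| "rmods (RAssign a e f p) = {a}"
| "rmods (Seq c1 c2) = rmods c1 \<union> rmods c2"
| "rmods (If b c1 c2) = rmods c1 \<union> rmods c2"
| "rmods (While b c) = rmods c"

lemma finite_nmods: "finite (nmods c)" and finite_rmods: "finite (rmods c)"
  by (induction c) auto

text \<open>Preservation is recorded for whole arrays: a name outside the sets keeps its array,
  whereas untouched cells of a modified array have to be listed in a postcondition.\<close>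

definition frame :: "vname set \<Rightarrow> vname set \<Rightarrow> state \<Rightarrow> state \<Rightarrow> bool" where
  "frame ns rs \<sigma> \<sigma>' \<longleftrightarrow> (\<forall>a. a \<notin> ns \<longrightarrow> nats \<sigma>' a = nats \<sigma> a) \<and> (\<forall>a. a \<notin> rs \<longrightarrow> reals \<sigma>' a = reals \<sigma> a)"

lemma frame_trans: "frame ns rs \<sigma>1 \<sigma>2 \<Longrightarrow> frame ns rs \<sigma>2 \<sigma>3 \<Longrightarrow> frame ns rs \<sigma>1 \<sigma>3"
  by (simp add: frame_def)

lemma frame_mono: "frame ns rs \<sigma> \<sigma>' \<Longrightarrow> ns \<subseteq> ns' \<Longrightarrow> rs \<subseteq> rs' \<Longrightarrow> frame ns' rs' \<sigma> \<sigma>'"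
  by (auto simp: frame_def)

lemma nats_nupdate [simp]: "nats (nupdate a i n \<sigma>) b = (if b = a then (nats \<sigma> a)(i := n) else nats \<sigma> b)"
  and reals_nupdate [simp]: "reals (nupdate a i n \<sigma>) = reals \<sigma>"
  and nats_rupdate [simp]: "nats (rupdate a i j r \<sigma>) = nats \<sigma>"
  and reals_rupdate [simp]: "reals (rupdate a i j r \<sigma>) b =
    (if b = a then (reals \<sigma> a)(i := (reals \<sigma> a i)(j := r)) else reals \<sigma> b)"
  by (auto simp: nupdate_def rupdate_def)

lemma run_frame: "run c \<sigma> t \<sigma>' \<Longrightarrow> frame (nmods c) (rmods c) \<sigma> \<sigma>'"
  by (induction rule: run.induct) (auto simp: frame_def)

text \<open>
  From \<open>\<sigma>\<close>, the program \<open>c\<close> terminates within \<open>T\<close> steps in a state satisfying \<open>R\<close>.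
\<close>
definition wpt :: "com \<Rightarrow> real \<Rightarrow> (state \<Rightarrow> bool) \<Rightarrow> state \<Rightarrow> bool" where
  "wpt c T R \<sigma> \<longleftrightarrow> (\<exists>t \<sigma>'. run c \<sigma> t \<sigma>' \<and> real t \<le> T \<and> R \<sigma>')"

text \<open>The syntactic frame is supplied with every postcondition, so specifications describe
  only the arrays that a program writes.\<close>

lemma wpt_conseq:
  "wpt c T R \<sigma> \<Longrightarrow> T \<le> T' \<Longrightarrow> (\<And>\<sigma>'. frame (nmods c) (rmods c) \<sigma> \<sigma>' \<Longrightarrow> R \<sigma>' \<Longrightarrow> R' \<sigma>') \<Longrightarrow> wpt c T' R' \<sigma>"
  unfolding wpt_def using run_frame by (meson order_trans)

lemma wpt_Skip: "R \<sigma> \<Longrightarrow> 1 \<le> T \<Longrightarrow> wpt Skip T R \<sigma>"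
  unfolding wpt_def using run.Skip by (metis of_nat_1)

lemma wpt_NAssign: "R (nupdate a (nval e \<sigma>) (nval f \<sigma>) \<sigma>) \<Longrightarrow> 1 \<le> T \<Longrightarrow> wpt (NAssign a e f) T R \<sigma>"
  unfolding wpt_def using run.NAssign by (metis of_nat_1)

lemma wpt_RAssign:
  "R (rupdate a (nval e \<sigma>) (nval f \<sigma>) (rval p \<sigma>) \<sigma>) \<Longrightarrow> 1 \<le> T \<Longrightarrow> wpt (RAssign a e f p) T R \<sigma>"
  unfolding wpt_def using run.RAssign by (metis of_nat_1)

lemma wpt_Seq: "wpt c1 T1 (wpt c2 T2 R) \<sigma> \<Longrightarrow> T1 + T2 \<le> T \<Longrightarrow> wpt (Seq c1 c2) T R \<sigma>"
  unfolding wpt_def using run.Seq by (smt (verit) of_nat_add)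

lemma wpt_Seq_frame:
  assumes "wpt c S Q \<sigma>"
    and "\<And>\<sigma>'. frame (nmods c) (rmods c) \<sigma> \<sigma>' \<Longrightarrow> Q \<sigma>' \<Longrightarrow> wpt c' S' R \<sigma>'"
    and "S + S' \<le> T"
  shows "wpt (Seq c c') T R \<sigma>"
  using wpt_conseq[OF assms(1) order_refl assms(2)] assms(3) by (intro wpt_Seq)

lemma wpt_Seq_NAssign:
  "wpt c T R (nupdate a (nval e \<sigma>) (nval f \<sigma>) \<sigma>) \<Longrightarrow> 1 + T \<le> T' \<Longrightarrow> wpt (Seq (NAssign a e f) c) T' R \<sigma>"
  by (rule wpt_Seq[OF wpt_NAssign[OF _ order_refl]])

lemma wpt_Seq_RAssign:
  "wpt c T R (rupdate a (nval e \<sigma>) (nval f \<sigma>) (rval p \<sigma>) \<sigma>) \<Longrightarrow> 1 + T \<le> T' \<Longrightarrow>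
    wpt (Seq (RAssign a e f p) c) T' R \<sigma>"
  by (rule wpt_Seq[OF wpt_RAssign[OF _ order_refl]])

lemma wpt_If:
  assumes "bval b \<sigma> \<Longrightarrow> wpt c1 T1 R \<sigma>" "\<not> bval b \<sigma> \<Longrightarrow> wpt c2 T1 R \<sigma>" "1 + T1 \<le> T"
  shows "wpt (If b c1 c2) T R \<sigma>"
  using assms run.IfTrue[of b \<sigma> c1 _ _ c2] run.IfFalse[of b \<sigma> c2 _ _ c1]
  unfolding wpt_def by (smt (verit) of_nat_add of_nat_1)

definition For :: "vname \<Rightarrow> nexp \<Rightarrow> com \<Rightarrow> com" where
  "For i e c = Seq (NAssign i (NConst 0) (NConst 0))
     (While (NLess (NArr i (NConst 0)) e)
       (Seq c (NAssign i (NConst 0) (NPlus (NArr i (NConst 0)) (NConst 1)))))"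

lemma nmods_For [simp]: "nmods (For i e c) = insert i (nmods c)"
  and rmods_For [simp]: "rmods (For i e c) = rmods c"
  by (auto simp: For_def)

text \<open>An iteration costs two steps besides its body, the test and the increment; the initial
  assignment and the final failing test give the constant 2. The bound \<open>e\<close> is
  reevaluated each time, so it must be constant under the frame, and \<open>step\<close> states the
  invariant after the increment.\<close>

lemma wpt_For:
  assumes i: "i \<notin> nmods c"
    and e: "\<And>\<sigma>'. frame (insert i (nmods c)) (rmods c) \<sigma> \<sigma>' \<Longrightarrow> nval e \<sigma>' = n"
    and init: "Inv 0 (nupdate i 0 0 \<sigma>)"
    and step: "\<And>j \<sigma>'. j < n \<Longrightarrow> frame (insert i (nmods c)) (rmods c) \<sigma> \<sigma>' \<Longrightarrow> nats \<sigma>' i 0 = j \<Longrightarrow>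
      Inv j \<sigma>' \<Longrightarrow> wpt c T (\<lambda>\<sigma>''. Inv (Suc j) (nupdate i 0 (Suc j) \<sigma>'')) \<sigma>'"
    and post: "\<And>\<sigma>'. frame (insert i (nmods c)) (rmods c) \<sigma> \<sigma>' \<Longrightarrow> Inv n \<sigma>' \<Longrightarrow> R \<sigma>'"
    and T: "2 + real n * (T + 2) \<le> T'"
  shows "wpt (For i e c) T' R \<sigma>"
proof -
  let ?b = "NLess (NArr i (NConst 0)) e"
  let ?c = "Seq c (NAssign i (NConst 0) (NPlus (NArr i (NConst 0)) (NConst 1)))"
  let ?F = "frame (insert i (nmods c)) (rmods c)"
  have loop: "wpt (While ?b ?c) (1 + real (n - j) * (T + 2)) R \<sigma>'"
    if "j \<le> n" "?F \<sigma> \<sigma>'" "nats \<sigma>' i 0 = j" "Inv j \<sigma>'" for j \<sigma>'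
    using that
  proof (induction "n - j" arbitrary: j \<sigma>')
    case 0
    hence "\<not> bval ?b \<sigma>'" using e[of \<sigma>'] by simp
    hence "run (While ?b ?c) \<sigma>' 1 \<sigma>'" by (rule run.WhileFalse)
    moreover have "R \<sigma>'" using 0 post by simp
    moreover have "real 1 \<le> 1 + real (n - j) * (T + 2)" using 0(1) by simp
    ultimately show ?case unfolding wpt_def by blast
  next
    case (Suc k)
    hence j: "j < n" by simp
    hence b: "bval ?b \<sigma>'" using e[of \<sigma>'] Suc.prems by simp
    obtain t1 \<sigma>1 where 1: "run c \<sigma>' t1 \<sigma>1" "real t1 \<le> T" "Inv (Suc j) (nupdate i 0 (Suc j) \<sigma>1)"
      using step[OF j Suc.prems(2-4)] unfolding wpt_def by auto
    have fr1: "frame (nmods c) (rmods c) \<sigma>' \<sigma>1" using run_frame[OF 1(1)] .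
    hence "nats \<sigma>1 i 0 = j" using i Suc.prems(3) by (simp add: frame_def)
    hence 2: "run ?c \<sigma>' (t1 + 1) (nupdate i 0 (Suc j) \<sigma>1)"
      using run.Seq[OF 1(1) run.NAssign[of i "NConst 0" "NPlus (NArr i (NConst 0)) (NConst 1)"]] by simp
    have "?F \<sigma> (nupdate i 0 (Suc j) \<sigma>1)"
      using fr1 Suc.prems(2) by (auto simp: frame_def)
    hence "wpt (While ?b ?c) (1 + real (n - Suc j) * (T + 2)) R (nupdate i 0 (Suc j) \<sigma>1)"
      using Suc.hyps(2) j 1(3) by (intro Suc.hyps(1)) auto
    then obtain t2 \<sigma>2 where 3: "run (While ?b ?c) (nupdate i 0 (Suc j) \<sigma>1) t2 \<sigma>2"
        "real t2 \<le> 1 + real (n - Suc j) * (T + 2)" "R \<sigma>2"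
      unfolding wpt_def by auto
    have n: "real (n - j) = 1 + real (n - Suc j)" using j by simp
    have "real (1 + (t1 + 1) + t2) \<le> 1 + real (n - j) * (T + 2)"
      unfolding n using 1(2) 3(2) by (simp add: algebra_simps)
    then show ?case
      unfolding wpt_def using run.WhileTrue[OF b 2 3(1)] 3(3) by blast
  qed
  have "wpt (While ?b ?c) (1 + real n * (T + 2)) R (nupdate i 0 0 \<sigma>)"
    using loop[of 0 "nupdate i 0 0 \<sigma>"] init by (simp add: frame_def)
  hence "wpt (NAssign i (NConst 0) (NConst 0)) 1 (wpt (While ?b ?c) (1 + real n * (T + 2)) R) \<sigma>"
    by (intro wpt_NAssign) auto
  thus ?thesis
    unfolding For_def by (rule wpt_Seq) (use T in simp)
qed

definition MatSet :: "vname \<Rightarrow> vname \<Rightarrow> nexp \<Rightarrow> nexp \<Rightarrow> vname \<Rightarrow> nexp \<Rightarrow> rexp \<Rightarrow> com" where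
  "MatSet i j er ec X eo p =
     For i er (For j ec (RAssign X (NPlus eo (NArr i (NConst 0))) (NArr j (NConst 0)) p))"

lemma nmods_MatSet [simp]: "nmods (MatSet i j er ec X eo p) = {i, j}"
  and rmods_MatSet [simp]: "rmods (MatSet i j er ec X eo p) = {X}"
  by (auto simp: MatSet_def)

text \<open>In \<open>pv\<close> the cell about to be written still has its old value, which permits
  accumulating assignments such as adding to a matrix in place. The invariants describe all cells of
  \<open>X\<close>, so that cells outside the block are known to be unchanged.\<close>

lemma wpt_MatSet:
  assumes ij: "i \<noteq> j"
    and ev: "\<And>\<sigma>'. frame {i, j} {X} \<sigma> \<sigma>' \<Longrightarrow> nval er \<sigma>' = nr \<and> nval ec \<sigma>' = nc \<and> nval eo \<sigma>' = off"
    and pv: "\<And>\<sigma>' a b. a < nr \<Longrightarrow> b < nc \<Longrightarrow> frame {i, j} {X} \<sigma> \<sigma>' \<Longrightarrow> nats \<sigma>' i 0 = a \<Longrightarrow>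
      nats \<sigma>' j 0 = b \<Longrightarrow> reals \<sigma>' X (off + a) b = reals \<sigma> X (off + a) b \<Longrightarrow> rval p \<sigma>' = F a b"
    and post: "\<And>\<sigma>'. frame {i, j} {X} \<sigma> \<sigma>' \<Longrightarrow> (\<And>a b. a < nr \<Longrightarrow> b < nc \<Longrightarrow> reals \<sigma>' X (off + a) b = F a b) \<Longrightarrow>
      (\<And>a b. \<not> (off \<le> a \<and> a < off + nr \<and> b < nc) \<Longrightarrow> reals \<sigma>' X a b = reals \<sigma> X a b) \<Longrightarrow> R \<sigma>'"
    and T: "2 + real nr * (4 + real nc * 3) \<le> T"
  shows "wpt (MatSet i j er ec X eo p) T R \<sigma>"
  unfolding MatSet_def
proof (rule wpt_For[where n = nr and T = "2 + real nc * 3"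
      and Inv = "\<lambda>a \<sigma>'. (\<forall>x y. reals \<sigma>' X x y =
        (if off \<le> x \<and> x < off + a \<and> y < nc then F (x - off) y else reals \<sigma> X x y))"])
  fix a \<sigma>1
  assume a: "a < nr" and "frame (insert i (nmods (For j ec (RAssign X (NPlus eo (NArr i (NConst 0))) (NArr j (NConst 0)) p))))
     (rmods (For j ec (RAssign X (NPlus eo (NArr i (NConst 0))) (NArr j (NConst 0)) p))) \<sigma> \<sigma>1"
    and i1: "nats \<sigma>1 i 0 = a"
    and I1: "\<forall>x y. reals \<sigma>1 X x y = (if off \<le> x \<and> x < off + a \<and> y < nc then F (x - off) y else reals \<sigma> X x y)"
  hence fr1: "frame {i, j} {X} \<sigma> \<sigma>1" by simp
  show "wpt (For j ec (RAssign X (NPlus eo (NArr i (NConst 0))) (NArr j (NConst 0)) p)) (2 + real nc * 3)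
     (\<lambda>\<sigma>''. \<forall>x y. reals (nupdate i 0 (Suc a) \<sigma>'') X x y =
        (if off \<le> x \<and> x < off + Suc a \<and> y < nc then F (x - off) y else reals \<sigma> X x y)) \<sigma>1"
  proof (rule wpt_For[where n = nc and T = 1 and Inv = "\<lambda>b \<sigma>'. (\<forall>x y. reals \<sigma>' X x y =
        (if off \<le> x \<and> x < off + a \<and> y < nc \<or> x = off + a \<and> y < b then F (x - off) y else reals \<sigma> X x y))"])
    fix \<sigma>2
    assume "frame (insert j (nmods (RAssign X (NPlus eo (NArr i (NConst 0))) (NArr j (NConst 0)) p)))
       (rmods (RAssign X (NPlus eo (NArr i (NConst 0))) (NArr j (NConst 0)) p)) \<sigma>1 \<sigma>2"
    hence "frame {i, j} {X} \<sigma>1 \<sigma>2" by (auto elim: frame_mono)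
    thus "nval ec \<sigma>2 = nc" using ev frame_trans[OF fr1] by blast
  next
    fix b \<sigma>2
    assume b: "b < nc" and fr2: "frame (insert j (nmods (RAssign X (NPlus eo (NArr i (NConst 0))) (NArr j (NConst 0)) p)))
       (rmods (RAssign X (NPlus eo (NArr i (NConst 0))) (NArr j (NConst 0)) p)) \<sigma>1 \<sigma>2"
      and j2: "nats \<sigma>2 j 0 = b"
      and I2: "\<forall>x y. reals \<sigma>2 X x y = (if off \<le> x \<and> x < off + a \<and> y < nc \<or> x = off + a \<and> y < b
        then F (x - off) y else reals \<sigma> X x y)"
    have i2: "nats \<sigma>2 i 0 = a" using fr2 i1 ij by (simp add: frame_def)
    have "frame {i, j} {X} \<sigma>1 \<sigma>2" using fr2 by (auto elim: frame_mono)
    hence fr: "frame {i, j} {X} \<sigma> \<sigma>2" using frame_trans[OF fr1] by blast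
    have v: "rval p \<sigma>2 = F a b"
      by (rule pv[OF a b fr i2 j2]) (use I2 in simp)
    have o: "nval eo \<sigma>2 = off" using ev[OF fr] by simp
    show "wpt (RAssign X (NPlus eo (NArr i (NConst 0))) (NArr j (NConst 0)) p) 1
        (\<lambda>\<sigma>''. \<forall>x y. reals (nupdate j 0 (Suc b) \<sigma>'') X x y =
          (if off \<le> x \<and> x < off + a \<and> y < nc \<or> x = off + a \<and> y < Suc b then F (x - off) y else reals \<sigma> X x y)) \<sigma>2"
      by (rule wpt_RAssign) (auto simp: v o i2 j2 I2 less_Suc_eq)
  qed (use I1 in auto)
next
  fix \<sigma>'
  assume "frame (insert i (nmods (For j ec (RAssign X (NPlus eo (NArr i (NConst 0))) (NArr j (NConst 0)) p))))
      (rmods (For j ec (RAssign X (NPlus eo (NArr i (NConst 0))) (NArr j (NConst 0)) p))) \<sigma> \<sigma>'"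
    and "\<forall>x y. reals \<sigma>' X x y = (if off \<le> x \<and> x < off + nr \<and> y < nc then F (x - off) y else reals \<sigma> X x y)"
  thus "R \<sigma>'" by (intro post) auto
qed (use ij ev T in \<open>auto simp: algebra_simps\<close>)

section \<open>The rounding program\<close>

text \<open>
  The multiplication program \<open>P\<close> may overwrite any array that it names, so all data that have to
  survive a call are kept in arrays whose names start with a prefix not occurring in \<open>P\<close>.
\<close>
locale fresh_matmul =
  fixes P :: com and pre :: string and K w :: real
  assumes fresh [simp]: "pre @ s \<notin> nmods P" "pre @ s \<notin> rmods P"
    and len: "3 \<le> length pre"
    and matmul: "\<And>n \<sigma>. 1 \<le> n \<Longrightarrow> nats \<sigma> ''n'' 0 = n \<Longrightarrow> wpt P (K * real n powr w)
      (\<lambda>\<sigma>'. \<forall>i<n. \<forall>j<n. reals \<sigma>' ''C'' i j = (\<Sum>p<n. reals \<sigma> ''A'' i p * reals \<sigma> ''B'' p j)) \<sigma>"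
begin

text \<open>The unprefixed names in use have at most two characters, so a prefix of length three
  separates them from all private arrays.\<close>

lemma fresh_neq [simp]: "pre @ s \<noteq> [x]" "[x] \<noteq> pre @ s" "pre @ s \<noteq> [x, y]" "[x, y] \<noteq> pre @ s" "pre \<noteq> []"
  using len by (auto dest: arg_cong[of _ _ length])

abbreviation nv :: "string \<Rightarrow> nexp" where "nv x \<equiv> NArr (pre @ x) (NConst 0)"

abbreviation rm :: "string \<Rightarrow> rexp" where "rm x \<equiv> RArr (pre @ x) (nv ''a'') (nv ''b'')"

abbreviation rs :: "string \<Rightarrow> rexp" where "rs x \<equiv> RArr (pre @ x) (NConst 0) (NConst 0)"

abbreviation rset :: "string \<Rightarrow> rexp \<Rightarrow> com" where "rset x p \<equiv> RAssign (pre @ x) (NConst 0) (NConst 0) p"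

abbreviation nset :: "string \<Rightarrow> nexp \<Rightarrow> com" where "nset x e \<equiv> NAssign (pre @ x) (NConst 0) e"

abbreviation MS :: "vname \<Rightarrow> nexp \<Rightarrow> rexp \<Rightarrow> com" where
  "MS X eo p \<equiv> MatSet (pre @ ''a'') (pre @ ''b'') (nv ''d'') (nv ''d'') X eo p"

definition mat_time :: "nat \<Rightarrow> real" where "mat_time d = 2 + real d * (4 + real d * 3)"

lemma wpt_MS:
  assumes d: "nats \<sigma> (pre @ ''d'') 0 = d"
    and ev: "\<And>\<sigma>'. frame {pre @ ''a'', pre @ ''b''} {X} \<sigma> \<sigma>' \<Longrightarrow> nval eo \<sigma>' = off"
    and pv: "\<And>\<sigma>' a b. a < d \<Longrightarrow> b < d \<Longrightarrow> frame {pre @ ''a'', pre @ ''b''} {X} \<sigma> \<sigma>' \<Longrightarrow>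
      nats \<sigma>' (pre @ ''a'') 0 = a \<Longrightarrow> nats \<sigma>' (pre @ ''b'') 0 = b \<Longrightarrow>
      reals \<sigma>' X (off + a) b = reals \<sigma> X (off + a) b \<Longrightarrow> rval p \<sigma>' = F a b"
  shows "wpt (MS X eo p) (mat_time d) (\<lambda>\<sigma>'. (\<forall>a<d. \<forall>b<d. reals \<sigma>' X (off + a) b = F a b) \<and>
      (\<forall>a b. \<not> (off \<le> a \<and> a < off + d \<and> b < d) \<longrightarrow> reals \<sigma>' X a b = reals \<sigma> X a b)) \<sigma>"
  by (rule wpt_MatSet[where nr = d and nc = d and off = off and F = F])
     (use d ev pv in \<open>auto simp: frame_def mat_time_def\<close>)

text \<open>Operands are copied to the fixed names on which \<open>P\<close> works, and the product
  is added to \<open>W\<close> with a factor, so that two calls accumulate both terms of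
  \<open>emul\<close>.\<close>

definition mul_com :: "string \<Rightarrow> nexp \<Rightarrow> rexp \<Rightarrow> com" where
  "mul_com x eo ec = Seq (NAssign ''n'' (NConst 0) (nv ''d''))
     (Seq (MS ''A'' (NConst 0) (rm x))
     (Seq (MS ''B'' (NConst 0) (RArr (pre @ ''G'') (NPlus eo (nv ''a'')) (nv ''b'')))
     (Seq P
       (MS (pre @ ''W'') (NConst 0) (RPlus (rm ''W'') (RTimes ec (RArr ''C'' (nv ''a'') (nv ''b''))))))))"

lemma mods_mul_com [simp]:
  "nmods (mul_com x eo ec) = {''n'', pre @ ''a'', pre @ ''b''} \<union> nmods P"
  "rmods (mul_com x eo ec) = {''A'', ''B'', pre @ ''W''} \<union> rmods P"
  by (auto simp: mul_com_def)

definition mul_time :: "nat \<Rightarrow> real" where "mul_time d = 1 + 3 * mat_time d + K * real d powr w"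

text \<open>The condition \<open>e\<close> requires the offset and the factor to be determined by
  the private natural arrays other than the two loop counters, since everything named by
  \<open>P\<close> is arbitrary after the call.\<close>

lemma wpt_mul_com:
  assumes d: "nats \<sigma> (pre @ ''d'') 0 = d" "1 \<le> d"
    and e: "\<And>\<sigma>'. (\<And>s. s \<noteq> ''a'' \<Longrightarrow> s \<noteq> ''b'' \<Longrightarrow> nats \<sigma>' (pre @ s) = nats \<sigma> (pre @ s)) \<Longrightarrow>
      nval eo \<sigma>' = off \<and> rval ec \<sigma>' = c"
  shows "wpt (mul_com x eo ec) (mul_time d) (\<lambda>\<sigma>'. \<forall>a<d. \<forall>b<d. reals \<sigma>' (pre @ ''W'') a b =
    reals \<sigma> (pre @ ''W'') a b + c * (\<Sum>e<d. reals \<sigma> (pre @ x) a e * reals \<sigma> (pre @ ''G'') (off + e) b)) \<sigma>"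
  unfolding mul_com_def
proof (rule wpt_Seq_frame[where Q = "\<lambda>\<sigma>'. nats \<sigma>' ''n'' 0 = d" and S = 1 and S' = "mul_time d - 1"])
  show "wpt (NAssign ''n'' (NConst 0) (nv ''d'')) 1 (\<lambda>\<sigma>'. nats \<sigma>' ''n'' 0 = d) \<sigma>"
    by (rule wpt_NAssign) (use d in auto)
  fix \<sigma>1 assume f1: "frame (nmods (NAssign ''n'' (NConst 0) (nv ''d''))) (rmods (NAssign ''n'' (NConst 0) (nv ''d''))) \<sigma> \<sigma>1"
    and n1: "nats \<sigma>1 ''n'' 0 = d"
  show "wpt (Seq (MS ''A'' (NConst 0) (rm x))
     (Seq (MS ''B'' (NConst 0) (RArr (pre @ ''G'') (NPlus eo (nv ''a'')) (nv ''b'')))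
     (Seq P
       (MS (pre @ ''W'') (NConst 0) (RPlus (rm ''W'') (RTimes ec (RArr ''C'' (nv ''a'') (nv ''b''))))))))
     (mul_time d - 1) (\<lambda>\<sigma>'. \<forall>a<d. \<forall>b<d. reals \<sigma>' (pre @ ''W'') a b =
    reals \<sigma> (pre @ ''W'') a b + c * (\<Sum>e<d. reals \<sigma> (pre @ x) a e * reals \<sigma> (pre @ ''G'') (off + e) b)) \<sigma>1"
  proof (rule wpt_Seq_frame[OF wpt_MS[where d = d and off = 0 and F = "\<lambda>a b. reals \<sigma> (pre @ x) a b"]])
    fix \<sigma>2 assume f2: "frame (nmods (MS ''A'' (NConst 0) (rm x))) (rmods (MS ''A'' (NConst 0) (rm x))) \<sigma>1 \<sigma>2"
      and A: "(\<forall>a<d. \<forall>b<d. reals \<sigma>2 ''A'' (0 + a) b = reals \<sigma> (pre @ x) a b) \<and>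
        (\<forall>a b. \<not> (0 \<le> a \<and> a < 0 + d \<and> b < d) \<longrightarrow> reals \<sigma>2 ''A'' a b = reals \<sigma>1 ''A'' a b)"
    show "wpt (Seq (MS ''B'' (NConst 0) (RArr (pre @ ''G'') (NPlus eo (nv ''a'')) (nv ''b'')))
     (Seq P
       (MS (pre @ ''W'') (NConst 0) (RPlus (rm ''W'') (RTimes ec (RArr ''C'' (nv ''a'') (nv ''b'')))))))
     (mul_time d - 1 - mat_time d) (\<lambda>\<sigma>'. \<forall>a<d. \<forall>b<d. reals \<sigma>' (pre @ ''W'') a b =
    reals \<sigma> (pre @ ''W'') a b + c * (\<Sum>e<d. reals \<sigma> (pre @ x) a e * reals \<sigma> (pre @ ''G'') (off + e) b)) \<sigma>2"
    proof (rule wpt_Seq_frame[OF wpt_MS[where d = d and off = 0 and F = "\<lambda>a b. reals \<sigma> (pre @ ''G'') (off + a) b"]])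
      fix \<sigma>3 assume f3: "frame (nmods (MS ''B'' (NConst 0) (RArr (pre @ ''G'') (NPlus eo (nv ''a'')) (nv ''b''))))
          (rmods (MS ''B'' (NConst 0) (RArr (pre @ ''G'') (NPlus eo (nv ''a'')) (nv ''b'')))) \<sigma>2 \<sigma>3"
        and B: "(\<forall>a<d. \<forall>b<d. reals \<sigma>3 ''B'' (0 + a) b = reals \<sigma> (pre @ ''G'') (off + a) b) \<and>
        (\<forall>a b. \<not> (0 \<le> a \<and> a < 0 + d \<and> b < d) \<longrightarrow> reals \<sigma>3 ''B'' a b = reals \<sigma>2 ''B'' a b)"
      show "wpt (Seq P
       (MS (pre @ ''W'') (NConst 0) (RPlus (rm ''W'') (RTimes ec (RArr ''C'' (nv ''a'') (nv ''b''))))))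
        (mul_time d - 1 - mat_time d - mat_time d) (\<lambda>\<sigma>'. \<forall>a<d. \<forall>b<d. reals \<sigma>' (pre @ ''W'') a b =
    reals \<sigma> (pre @ ''W'') a b + c * (\<Sum>e<d. reals \<sigma> (pre @ x) a e * reals \<sigma> (pre @ ''G'') (off + e) b)) \<sigma>3"
      proof (rule wpt_Seq_frame[OF matmul[where n = d]])
        fix \<sigma>4 assume f4: "frame (nmods P) (rmods P) \<sigma>3 \<sigma>4"
          and C: "\<forall>i<d. \<forall>j<d. reals \<sigma>4 ''C'' i j = (\<Sum>p<d. reals \<sigma>3 ''A'' i p * reals \<sigma>3 ''B'' p j)"
        have "reals \<sigma>4 ''C'' a b = (\<Sum>e<d. reals \<sigma> (pre @ x) a e * reals \<sigma> (pre @ ''G'') (off + e) b)"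
          if "a < d" "b < d" for a b
          using C that A B f3 by (auto simp: frame_def intro!: sum.cong)
        thus "wpt (MS (pre @ ''W'') (NConst 0) (RPlus (rm ''W'') (RTimes ec (RArr ''C'' (nv ''a'') (nv ''b'')))))
          (mat_time d) (\<lambda>\<sigma>'. \<forall>a<d. \<forall>b<d. reals \<sigma>' (pre @ ''W'') a b =
          reals \<sigma> (pre @ ''W'') a b + c * (\<Sum>e<d. reals \<sigma> (pre @ x) a e * reals \<sigma> (pre @ ''G'') (off + e) b)) \<sigma>4"
          using f1 f2 f3 f4 d e
          by (intro wpt_conseq[OF wpt_MS[where d = d and off = 0 and F = "\<lambda>a b. reals \<sigma> (pre @ ''W'') a b
            + c * (\<Sum>e<d. reals \<sigma> (pre @ x) a e * reals \<sigma> (pre @ ''G'') (off + e) b)"]])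
             (auto simp: frame_def)
      qed (use n1 f2 f3 d in \<open>auto simp: frame_def mul_time_def\<close>)
    qed (use f1 f2 d e in \<open>auto simp: frame_def\<close>)
  qed (use f1 d in \<open>auto simp: frame_def\<close>)
qed auto

section \<open>Computing one table of conditional expectations\<close>

text \<open>The Kronecker delta, as expressions contain no conditional: with truncated subtraction
  the two differences add up to |a - b|, and 1 minus that is 1 or 0.\<close>

abbreviation delta :: rexp where
  "delta \<equiv> ROfNat (NMinus (NConst 1) (NPlus (NMinus (nv ''a'') (nv ''b'')) (NMinus (nv ''b'') (nv ''a''))))"

lemma delta_nat: "(1::nat) - ((a - b) + (b - a)) = (if a = b then 1 else 0)"
  by auto

abbreviation p1 :: nexp where "p1 \<equiv> NPlus (nv ''p'') (NConst 1)"

text \<open>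
  The array \<open>G\<close> holds the matrices \<open>\<Gamma>\<^sub>p\<^sub>,\<^sub>r\<^sub>-\<^sub>q\<close> for the current level \<open>p\<close>, slot \<open>q\<close> in the rows from \<open>q d\<close> on;
  this offset is \<open>o\<close>. Slot \<open>q\<close> of level \<open>p + 1\<close> depends on the slots \<open>q\<close> and \<open>q + 1\<close> of level \<open>p\<close>, so
  the slots can be overwritten in increasing order. Only the slots with \<open>p + q \<le> l\<close> are meaningful.
\<close>
definition step_com :: com where
  "step_com =
    Seq (MS (pre @ ''W'') (NConst 0) (ROfNat (NConst 0)))
   (Seq (mul_com ''A'' (nv ''o'') (ROfNat (NConst 1)))
   (Seq (mul_com ''Y'' (NPlus (nv ''o'') (nv ''d'')) (ROfNat (NMinus (nv ''r'') (nv ''q''))))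
   (Seq (rset ''tr'' (ROfNat (NConst 0)))
   (Seq (For (pre @ ''a'') (nv ''d'') (rset ''tr'' (RPlus (rs ''tr'') (RArr (pre @ ''W'') (nv ''a'') (nv ''a'')))))
   (Seq (RAssign (pre @ ''Psi'') p1 (nv ''q'') (RDivide (rs ''tr'') (ROfNat p1)))
     (MS (pre @ ''G'') (nv ''o'') (RMinus (RTimes (RArr (pre @ ''Psi'') p1 (nv ''q'')) delta) (rm ''W''))))))))"

lemma mods_step_com [simp]:
  "nmods step_com = {''n'', pre @ ''a'', pre @ ''b''} \<union> nmods P"
  "rmods step_com = {''A'', ''B'', pre @ ''W'', pre @ ''tr'', pre @ ''Psi'', pre @ ''G''} \<union> rmods P"
  by (auto simp: step_com_def)

definition step_time :: "nat \<Rightarrow> real" where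
  "step_time d = 2 * mat_time d + 2 * mul_time d + real d * 3 + 4"

text \<open>\<open>W\<close> becomes \<open>emul\<close> for r - q samples once the blocks at
  \<open>off\<close> and \<open>off + d\<close> hold \<open>emat\<close> for r - q and r - q - 1.
  The statement is about raw array contents, because the loop over the slots also runs through slots
  without a meaning.\<close>

lemma wpt_step_com:
  assumes d: "nats \<sigma> (pre @ ''d'') 0 = d" "1 \<le> d"
    and o: "nats \<sigma> (pre @ ''o'') 0 = off" and r: "nats \<sigma> (pre @ ''r'') 0 = r"
    and q: "nats \<sigma> (pre @ ''q'') 0 = q" and p: "nats \<sigma> (pre @ ''p'') 0 = p"
  defines "W \<equiv> \<lambda>a b. (\<Sum>e<d. reals \<sigma> (pre @ ''A'') a e * reals \<sigma> (pre @ ''G'') (off + e) b)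
      + real (r - q) * (\<Sum>e<d. reals \<sigma> (pre @ ''Y'') a e * reals \<sigma> (pre @ ''G'') (off + d + e) b)"
  defines "t \<equiv> (\<Sum>a<d. W a a) / real (Suc p)"
  shows "wpt step_com (step_time d) (\<lambda>\<sigma>'.
      reals \<sigma>' (pre @ ''Psi'') = (reals \<sigma> (pre @ ''Psi''))(Suc p := (reals \<sigma> (pre @ ''Psi'') (Suc p))(q := t)) \<and>
      (\<forall>a<d. \<forall>b<d. reals \<sigma>' (pre @ ''G'') (off + a) b = (if a = b then t else 0) - W a b) \<and>
      (\<forall>a b. \<not> (off \<le> a \<and> a < off + d \<and> b < d) \<longrightarrow> reals \<sigma>' (pre @ ''G'') a b = reals \<sigma> (pre @ ''G'') a b)) \<sigma>"
proof -
  let ?c1 = "MS (pre @ ''W'') (NConst 0) (ROfNat (NConst 0))"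
  let ?c2 = "mul_com ''A'' (nv ''o'') (ROfNat (NConst 1))"
  let ?c3 = "mul_com ''Y'' (NPlus (nv ''o'') (nv ''d'')) (ROfNat (NMinus (nv ''r'') (nv ''q'')))"
  let ?c4 = "rset ''tr'' (ROfNat (NConst 0))"
  let ?c5 = "For (pre @ ''a'') (nv ''d'') (rset ''tr'' (RPlus (rs ''tr'') (RArr (pre @ ''W'') (nv ''a'') (nv ''a''))))"
  let ?c6 = "RAssign (pre @ ''Psi'') p1 (nv ''q'') (RDivide (rs ''tr'') (ROfNat p1))"
  let ?c7 = "MS (pre @ ''G'') (nv ''o'') (RMinus (RTimes (RArr (pre @ ''Psi'') p1 (nv ''q'')) delta) (rm ''W''))"
  let ?R = "\<lambda>\<sigma>'. reals \<sigma>' (pre @ ''Psi'') = (reals \<sigma> (pre @ ''Psi''))(Suc p := (reals \<sigma> (pre @ ''Psi'') (Suc p))(q := t)) \<and>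
      (\<forall>a<d. \<forall>b<d. reals \<sigma>' (pre @ ''G'') (off + a) b = (if a = b then t else 0) - W a b) \<and>
      (\<forall>a b. \<not> (off \<le> a \<and> a < off + d \<and> b < d) \<longrightarrow> reals \<sigma>' (pre @ ''G'') a b = reals \<sigma> (pre @ ''G'') a b)"
  \<comment> \<open>At this point \<open>Psi\<close> has already been updated; resetting it to its
    old value lets one frame condition express that \<open>G\<close> and all other arrays of
    interest are still unchanged.\<close>
  have c7: "wpt ?c7 (mat_time d) ?R \<tau>"
    if f: "frame (nmods step_com) (rmods step_com - {pre @ ''Psi'', pre @ ''G''}) \<sigma> (\<tau>\<lparr>reals := (reals \<tau>)(pre @ ''Psi'' := reals \<sigma> (pre @ ''Psi''))\<rparr>)"
      and Psi: "reals \<tau> (pre @ ''Psi'') = (reals \<sigma> (pre @ ''Psi''))(Suc p := (reals \<sigma> (pre @ ''Psi'') (Suc p))(q := t))"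
      and W': "\<And>a b. a < d \<Longrightarrow> b < d \<Longrightarrow> reals \<tau> (pre @ ''W'') a b = W a b" for \<tau>
  proof (rule wpt_conseq[OF wpt_MS[where d = d and off = off and F = "\<lambda>a b. (if a = b then t else 0) - W a b"]])
    fix \<tau>' a b assume "a < d" "b < d" "frame {pre @ ''a'', pre @ ''b''} {pre @ ''G''} \<tau> \<tau>'"
      "nats \<tau>' (pre @ ''a'') 0 = a" "nats \<tau>' (pre @ ''b'') 0 = b"
    thus "rval (RMinus (RTimes (RArr (pre @ ''Psi'') p1 (nv ''q'')) delta) (rm ''W'')) \<tau>' =
       (if a = b then t else 0) - W a b"
      using f Psi W' p q unfolding rval.simps nval.simps delta_nat by (simp add: frame_def)
  qed (use f Psi d o in \<open>auto simp: frame_def\<close>)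
  have c5: "wpt ?c5 (2 + real d * 3) (\<lambda>\<sigma>'. reals \<sigma>' (pre @ ''tr'') 0 0 = (\<Sum>a<d. W a a)) \<tau>"
    if "nats \<tau> (pre @ ''d'') 0 = d" "reals \<tau> (pre @ ''tr'') 0 0 = 0"
      "\<And>a b. a < d \<Longrightarrow> b < d \<Longrightarrow> reals \<tau> (pre @ ''W'') a b = W a b" for \<tau>
  proof (rule wpt_For[where n = d and T = 1 and Inv = "\<lambda>n \<sigma>'. reals \<sigma>' (pre @ ''tr'') 0 0 = (\<Sum>a<n. W a a)"])
    fix j \<tau>' 
    assume "j < d"
      "frame (insert (pre @ ''a'') (nmods (rset ''tr'' (RPlus (rs ''tr'') (RArr (pre @ ''W'') (nv ''a'') (nv ''a''))))))
        (rmods (rset ''tr'' (RPlus (rs ''tr'') (RArr (pre @ ''W'') (nv ''a'') (nv ''a''))))) \<tau> \<tau>'"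
      "nats \<tau>' (pre @ ''a'') 0 = j" "reals \<tau>' (pre @ ''tr'') 0 0 = (\<Sum>a<j. W a a)"
    thus "wpt (rset ''tr'' (RPlus (rs ''tr'') (RArr (pre @ ''W'') (nv ''a'') (nv ''a'')))) 1
       (\<lambda>\<sigma>''. reals (nupdate (pre @ ''a'') 0 (Suc j) \<sigma>'') (pre @ ''tr'') 0 0 = (\<Sum>a<Suc j. W a a)) \<tau>'"
      using that by (intro wpt_RAssign) (auto simp: frame_def)
  qed (use that in \<open>auto simp: frame_def\<close>)
  show ?thesis
    unfolding step_com_def
  proof (rule wpt_Seq_frame[OF wpt_MS[where d = d and off = 0 and F = "\<lambda>a b. 0"]])
    fix \<sigma>1 assume f1: "frame (nmods ?c1) (rmods ?c1) \<sigma> \<sigma>1"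
      and W1: "(\<forall>a<d. \<forall>b<d. reals \<sigma>1 (pre @ ''W'') (0 + a) b = 0) \<and>
        (\<forall>a b. \<not> (0 \<le> a \<and> a < 0 + d \<and> b < d) \<longrightarrow> reals \<sigma>1 (pre @ ''W'') a b = reals \<sigma> (pre @ ''W'') a b)"
    show "wpt (Seq ?c2 (Seq ?c3 (Seq ?c4 (Seq ?c5 (Seq ?c6 ?c7))))) (step_time d - mat_time d) ?R \<sigma>1"
    proof (rule wpt_Seq_frame[OF wpt_mul_com[where d = d and off = off and c = 1]])
      fix \<sigma>2 assume f2: "frame (nmods ?c2) (rmods ?c2) \<sigma>1 \<sigma>2"
        and W2: "\<forall>a<d. \<forall>b<d. reals \<sigma>2 (pre @ ''W'') a b = reals \<sigma>1 (pre @ ''W'') a b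
          + 1 * (\<Sum>e<d. reals \<sigma>1 (pre @ ''A'') a e * reals \<sigma>1 (pre @ ''G'') (off + e) b)"
      show "wpt (Seq ?c3 (Seq ?c4 (Seq ?c5 (Seq ?c6 ?c7)))) (step_time d - mat_time d - mul_time d) ?R \<sigma>2"
      proof (rule wpt_Seq_frame[OF wpt_mul_com[where d = d and off = "off + d" and c = "real (r - q)"]])
        fix \<sigma>3 assume f3: "frame (nmods ?c3) (rmods ?c3) \<sigma>2 \<sigma>3"
          and W3: "\<forall>a<d. \<forall>b<d. reals \<sigma>3 (pre @ ''W'') a b = reals \<sigma>2 (pre @ ''W'') a b
            + real (r - q) * (\<Sum>e<d. reals \<sigma>2 (pre @ ''Y'') a e * reals \<sigma>2 (pre @ ''G'') (off + d + e) b)"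
        have W: "reals \<sigma>3 (pre @ ''W'') a b = W a b" if "a < d" "b < d" for a b
          using W1 W2 W3 that f1 f2 by (simp add: W_def frame_def)
        show "wpt (Seq ?c4 (Seq ?c5 (Seq ?c6 ?c7))) (mat_time d + real d * 3 + 4) ?R \<sigma>3"
        proof (rule wpt_Seq[OF wpt_RAssign[where T = 1]])
          let ?s4 = "rupdate (pre @ ''tr'') (nval (NConst 0) \<sigma>3) (nval (NConst 0) \<sigma>3) (rval (ROfNat (NConst 0)) \<sigma>3) \<sigma>3"
          show "wpt (Seq ?c5 (Seq ?c6 ?c7)) (mat_time d + real d * 3 + 3) ?R ?s4"
          proof (rule wpt_Seq_frame[OF c5])
            fix \<sigma>5 assume f5: "frame (nmods ?c5) (rmods ?c5) ?s4 \<sigma>5"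
              and tr: "reals \<sigma>5 (pre @ ''tr'') 0 0 = (\<Sum>a<d. W a a)"
            have p5: "nats \<sigma>5 (pre @ ''p'') 0 = p" "nats \<sigma>5 (pre @ ''q'') 0 = q"
              using f1 f2 f3 f5 p q by (simp_all add: frame_def)
            show "wpt (Seq ?c6 ?c7) (mat_time d + 1) ?R \<sigma>5"
            proof (rule wpt_Seq[OF wpt_RAssign[where T = 1]])
              show "wpt ?c7 (mat_time d) ?R (rupdate (pre @ ''Psi'') (nval p1 \<sigma>5) (nval (nv ''q'') \<sigma>5)
                 (rval (RDivide (rs ''tr'') (ROfNat p1)) \<sigma>5) \<sigma>5)"
                using f1 f2 f3 f5 W p q by (intro c7) (auto simp: frame_def p5 tr t_def)
            qed auto
          qed (use f1 f2 f3 d W in \<open>auto simp: frame_def\<close>)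
        qed auto
      qed (use f1 f2 d o r q in \<open>auto simp: frame_def step_time_def\<close>)
    qed (use f1 d o in \<open>auto simp: frame_def\<close>)
  qed (use d in \<open>auto simp: frame_def\<close>)
qed

end

text \<open>Distinct slots of d consecutive rows are disjoint, so writing one slot leaves the others
  intact.\<close>

lemma block_row_iff:
  fixes a d q q' :: nat
  assumes "a < d"
  shows "q * d \<le> q' * d + a \<and> q' * d + a < q * d + d \<longleftrightarrow> q' = q"
proof
  assume *: "q * d \<le> q' * d + a \<and> q' * d + a < q * d + d"
  hence "(q' * d + a) div d = q"
    by (intro div_nat_eqI) (auto simp: mult.commute)
  thus "q' = q" using assms by simp
qed (use assms in auto)

context fresh_matmul
begin

text \<open>Level 0: the adjugate coefficient is the identity for every number of samples, E_0 = 1,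
  and the quadratic form belonging to E_0 is zero. There are l + 1 slots because slot l - 1 of level
  1 reads slot l of level 0.\<close>

definition init_com :: com where
  "init_com =
    Seq (MS (pre @ ''H'') (NConst 0) (ROfNat (NConst 0)))
   (Seq (MS (pre @ ''H1'') (NConst 0) (ROfNat (NConst 0)))
   (Seq (RAssign (pre @ ''Psi'') (NConst 0) (NConst 0) (ROfNat (NConst 1)))
   (Seq (nset ''o'' (NConst 0))
     (For (pre @ ''q'') (NPlus (nv ''l'') (NConst 1))
       (Seq (MS (pre @ ''G'') (nv ''o'') delta) (nset ''o'' (NPlus (nv ''o'') (nv ''d''))))))))"

lemma mods_init_com [simp]:
  "nmods init_com = {pre @ ''a'', pre @ ''b'', pre @ ''q'', pre @ ''o''}"
  "rmods init_com = {pre @ ''H'', pre @ ''H1'', pre @ ''Psi'', pre @ ''G''}"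
  by (auto simp: init_com_def)

definition init_time :: "nat \<Rightarrow> nat \<Rightarrow> real" where
  "init_time d l = 2 * mat_time d + 4 + real (l + 1) * (mat_time d + 3)"

lemma wpt_init_com:
  assumes d: "nats \<sigma> (pre @ ''d'') 0 = d" and l: "nats \<sigma> (pre @ ''l'') 0 = l"
  shows "wpt init_com (init_time d l) (\<lambda>\<sigma>'. (\<forall>a<d. \<forall>b<d. reals \<sigma>' (pre @ ''H'') a b = 0) \<and>
    (\<forall>a<d. \<forall>b<d. reals \<sigma>' (pre @ ''H1'') a b = 0) \<and> reals \<sigma>' (pre @ ''Psi'') 0 0 = 1 \<and>
    (\<forall>q\<le>l. \<forall>a<d. \<forall>b<d. reals \<sigma>' (pre @ ''G'') (q * d + a) b = (if a = b then 1 else 0))) \<sigma>"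
proof -
  let ?c1 = "MS (pre @ ''H'') (NConst 0) (ROfNat (NConst 0))"
  let ?c2 = "MS (pre @ ''H1'') (NConst 0) (ROfNat (NConst 0))"
  let ?c3 = "RAssign (pre @ ''Psi'') (NConst 0) (NConst 0) (ROfNat (NConst 1))"
  let ?c4 = "nset ''o'' (NConst 0)"
  let ?c6 = "Seq (MS (pre @ ''G'') (nv ''o'') delta) (nset ''o'' (NPlus (nv ''o'') (nv ''d'')))"
  let ?c5 = "For (pre @ ''q'') (NPlus (nv ''l'') (NConst 1)) ?c6"
  let ?R = "\<lambda>\<sigma>'. (\<forall>a<d. \<forall>b<d. reals \<sigma>' (pre @ ''H'') a b = 0) \<and>
    (\<forall>a<d. \<forall>b<d. reals \<sigma>' (pre @ ''H1'') a b = 0) \<and> reals \<sigma>' (pre @ ''Psi'') 0 0 = 1 \<and>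
    (\<forall>q\<le>l. \<forall>a<d. \<forall>b<d. reals \<sigma>' (pre @ ''G'') (q * d + a) b = (if a = b then 1 else 0))"
  have c5: "wpt ?c5 (2 + real (l + 1) * (mat_time d + 3)) (\<lambda>\<sigma>'.
      \<forall>q\<le>l. \<forall>a<d. \<forall>b<d. reals \<sigma>' (pre @ ''G'') (q * d + a) b = (if a = b then 1 else 0)) \<tau>"
    if t: "nats \<tau> (pre @ ''d'') 0 = d" "nats \<tau> (pre @ ''l'') 0 = l" "nats \<tau> (pre @ ''o'') 0 = 0" for \<tau>
  proof (rule wpt_For[where n = "l + 1" and T = "mat_time d + 1" and Inv = "\<lambda>n \<sigma>'. nats \<sigma>' (pre @ ''o'') 0 = n * d \<and>
      (\<forall>q<n. \<forall>a<d. \<forall>b<d. reals \<sigma>' (pre @ ''G'') (q * d + a) b = (if a = b then 1 else 0))"])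
    fix n \<tau>' assume f: "frame (insert (pre @ ''q'') (nmods ?c6)) (rmods ?c6) \<tau> \<tau>'"
      and I: "nats \<tau>' (pre @ ''o'') 0 = n * d \<and>
        (\<forall>q<n. \<forall>a<d. \<forall>b<d. reals \<tau>' (pre @ ''G'') (q * d + a) b = (if a = b then 1 else 0))"
    show "wpt ?c6 (mat_time d + 1) (\<lambda>\<sigma>''. nats (nupdate (pre @ ''q'') 0 (Suc n) \<sigma>'') (pre @ ''o'') 0 = Suc n * d \<and>
      (\<forall>q<Suc n. \<forall>a<d. \<forall>b<d. reals (nupdate (pre @ ''q'') 0 (Suc n) \<sigma>'') (pre @ ''G'') (q * d + a) b
        = (if a = b then 1 else 0))) \<tau>'"
    proof (rule wpt_Seq_frame[OF wpt_MS[where d = d and off = "n * d" and F = "\<lambda>a b. if a = b then 1 else 0"]])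
      fix \<tau>1 assume f1: "frame (nmods (MS (pre @ ''G'') (nv ''o'') delta)) (rmods (MS (pre @ ''G'') (nv ''o'') delta)) \<tau>' \<tau>1"
        and G: "(\<forall>a<d. \<forall>b<d. reals \<tau>1 (pre @ ''G'') (n * d + a) b = (if a = b then 1 else 0)) \<and>
          (\<forall>a b. \<not> (n * d \<le> a \<and> a < n * d + d \<and> b < d) \<longrightarrow> reals \<tau>1 (pre @ ''G'') a b = reals \<tau>' (pre @ ''G'') a b)"
      have G': "reals \<tau>1 (pre @ ''G'') (q * d + a) b = (if a = b then 1 else 0)" if "q < Suc n" "a < d" "b < d" for q a b
        using G I that block_row_iff[of a d n q] by (cases "q = n") (auto simp: less_Suc_eq)
      show "wpt (nset ''o'' (NPlus (nv ''o'') (nv ''d''))) 1 (\<lambda>\<sigma>''. nats (nupdate (pre @ ''q'') 0 (Suc n) \<sigma>'') (pre @ ''o'') 0 = Suc n * d \<and>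
      (\<forall>q<Suc n. \<forall>a<d. \<forall>b<d. reals (nupdate (pre @ ''q'') 0 (Suc n) \<sigma>'') (pre @ ''G'') (q * d + a) b
        = (if a = b then 1 else 0))) \<tau>1"
        using f f1 I t G' by (intro wpt_NAssign) (auto simp: frame_def)
    next
      fix \<sigma>' :: state and a b assume "nats \<sigma>' (pre @ ''a'') 0 = a" "nats \<sigma>' (pre @ ''b'') 0 = b"
      thus "rval delta \<sigma>' = (if a = b then 1 else 0)"
        unfolding rval.simps nval.simps delta_nat by simp
    qed (use f I t in \<open>auto simp: frame_def\<close>)
  qed (use t in \<open>auto simp: frame_def algebra_simps\<close>)
  show ?thesis
    unfolding init_com_def
  proof (rule wpt_Seq_frame[OF wpt_MS[where d = d and off = 0 and F = "\<lambda>a b. 0"]])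
    fix \<sigma>1 assume f1: "frame (nmods ?c1) (rmods ?c1) \<sigma> \<sigma>1"
      and H: "(\<forall>a<d. \<forall>b<d. reals \<sigma>1 (pre @ ''H'') (0 + a) b = 0) \<and>
        (\<forall>a b. \<not> (0 \<le> a \<and> a < 0 + d \<and> b < d) \<longrightarrow> reals \<sigma>1 (pre @ ''H'') a b = reals \<sigma> (pre @ ''H'') a b)"
    show "wpt (Seq ?c2 (Seq ?c3 (Seq ?c4 ?c5))) (init_time d l - mat_time d) ?R \<sigma>1"
    proof (rule wpt_Seq_frame[OF wpt_MS[where d = d and off = 0 and F = "\<lambda>a b. 0"]])
      fix \<sigma>2 assume f2: "frame (nmods ?c2) (rmods ?c2) \<sigma>1 \<sigma>2"
        and H1: "(\<forall>a<d. \<forall>b<d. reals \<sigma>2 (pre @ ''H1'') (0 + a) b = 0) \<and>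
        (\<forall>a b. \<not> (0 \<le> a \<and> a < 0 + d \<and> b < d) \<longrightarrow> reals \<sigma>2 (pre @ ''H1'') a b = reals \<sigma>1 (pre @ ''H1'') a b)"
      show "wpt (Seq ?c3 (Seq ?c4 ?c5)) (init_time d l - mat_time d - mat_time d) ?R \<sigma>2"
      proof (rule wpt_Seq_RAssign[where T = "3 + real (l + 1) * (mat_time d + 3)"],
          rule wpt_Seq_NAssign[where T = "2 + real (l + 1) * (mat_time d + 3)"])
        let ?s = "rupdate (pre @ ''Psi'') (nval (NConst 0) \<sigma>2) (nval (NConst 0) \<sigma>2) (rval (ROfNat (NConst 1)) \<sigma>2) \<sigma>2"
        show "wpt ?c5 (2 + real (l + 1) * (mat_time d + 3)) ?R
            (nupdate (pre @ ''o'') (nval (NConst 0) ?s) (nval (NConst 0) ?s) ?s)"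
          by (rule wpt_conseq[OF c5 order_refl]) (use f1 f2 H H1 d l in \<open>auto simp: frame_def\<close>)
      qed (auto simp: init_time_def)
    qed (use f1 d in \<open>auto simp: frame_def\<close>)
  qed (use d in \<open>auto simp: frame_def\<close>)
qed

definition level_com :: com where
  "level_com = Seq (nset ''o'' (NConst 0)) (For (pre @ ''q'') (nv ''l'')
     (Seq step_com (nset ''o'' (NPlus (nv ''o'') (nv ''d'')))))"

lemma mods_level_com [simp]:
  "nmods level_com = {''n'', pre @ ''a'', pre @ ''b'', pre @ ''q'', pre @ ''o''} \<union> nmods P"
  "rmods level_com = {''A'', ''B'', pre @ ''W'', pre @ ''tr'', pre @ ''Psi'', pre @ ''G''} \<union> rmods P"
  by (auto simp: level_com_def)

definition level_time :: "nat \<Rightarrow> nat \<Rightarrow> real" where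
  "level_time d l = 3 + real l * (step_time d + 3)"

lemma wpt_level_com:
  assumes d: "nats \<sigma> (pre @ ''d'') 0 = d" and l: "nats \<sigma> (pre @ ''l'') 0 = l"
    and r: "nats \<sigma> (pre @ ''r'') 0 = r" and p: "nats \<sigma> (pre @ ''p'') 0 = p"
    and pl: "p < l" and ld: "l \<le> d"
    and A: "\<And>a b. a < d \<Longrightarrow> b < d \<Longrightarrow> reals \<sigma> (pre @ ''A'') a b = A a b"
    and Y: "\<And>a b. a < d \<Longrightarrow> b < d \<Longrightarrow> reals \<sigma> (pre @ ''Y'') a b = mean_outer m wt u a b"
    and G: "\<And>q a b. p + q \<le> l \<Longrightarrow> a < d \<Longrightarrow> b < d \<Longrightarrow>
      reals \<sigma> (pre @ ''G'') (q * d + a) b = emat d m wt u p (r - q) A a b"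
  shows "wpt level_com (level_time d l) (\<lambda>\<sigma>'.
    (\<forall>q a b. Suc p + q \<le> l \<longrightarrow> a < d \<longrightarrow> b < d \<longrightarrow>
      reals \<sigma>' (pre @ ''G'') (q * d + a) b = emat d m wt u (Suc p) (r - q) A a b) \<and>
    reals \<sigma>' (pre @ ''Psi'') (Suc p) 0 = ecoeff d m wt u (Suc p) r A \<and>
    (\<forall>p'. p' \<noteq> Suc p \<longrightarrow> reals \<sigma>' (pre @ ''Psi'') p' = reals \<sigma> (pre @ ''Psi'') p')) \<sigma>"
  unfolding level_com_def
proof (rule wpt_Seq[OF wpt_NAssign[where T = 1]])
  let ?c = "Seq step_com (nset ''o'' (NPlus (nv ''o'') (nv ''d'')))"
  let ?s = "nupdate (pre @ ''o'') (nval (NConst 0) \<sigma>) (nval (NConst 0) \<sigma>) \<sigma>"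
  \<comment> \<open>Slots below n have reached level p + 1, the others are still at level p. Of
    \<open>Psi\<close> only column 0, for the full number r of samples, is tracked, and it is
    written in the first round; hence the guard 0 < n.\<close>
  let ?I = "\<lambda>n \<sigma>'. nats \<sigma>' (pre @ ''o'') 0 = n * d \<and>
      (\<forall>q a b. a < d \<longrightarrow> b < d \<longrightarrow>
        (q < n \<and> Suc p + q \<le> l \<longrightarrow> reals \<sigma>' (pre @ ''G'') (q * d + a) b = emat d m wt u (Suc p) (r - q) A a b) \<and>
        (n \<le> q \<and> p + q \<le> l \<longrightarrow> reals \<sigma>' (pre @ ''G'') (q * d + a) b = emat d m wt u p (r - q) A a b)) \<and>
      (0 < n \<longrightarrow> reals \<sigma>' (pre @ ''Psi'') (Suc p) 0 = ecoeff d m wt u (Suc p) r A) \<and>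
      (\<forall>p'. p' \<noteq> Suc p \<longrightarrow> reals \<sigma>' (pre @ ''Psi'') p' = reals \<sigma> (pre @ ''Psi'') p')"
  show "wpt (For (pre @ ''q'') (nv ''l'') ?c) (2 + real l * (step_time d + 3)) (\<lambda>\<sigma>'.
    (\<forall>q a b. Suc p + q \<le> l \<longrightarrow> a < d \<longrightarrow> b < d \<longrightarrow>
      reals \<sigma>' (pre @ ''G'') (q * d + a) b = emat d m wt u (Suc p) (r - q) A a b) \<and>
    reals \<sigma>' (pre @ ''Psi'') (Suc p) 0 = ecoeff d m wt u (Suc p) r A \<and>
    (\<forall>p'. p' \<noteq> Suc p \<longrightarrow> reals \<sigma>' (pre @ ''Psi'') p' = reals \<sigma> (pre @ ''Psi'') p')) ?s"
  proof (rule wpt_For[where n = l and T = "step_time d + 1" and Inv = ?I])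
    fix n \<tau> assume n: "n < l" and f: "frame (insert (pre @ ''q'') (nmods ?c)) (rmods ?c) ?s \<tau>"
      and qn: "nats \<tau> (pre @ ''q'') 0 = n" and I: "?I n \<tau>"
    show "wpt ?c (step_time d + 1) (\<lambda>\<sigma>''. ?I (Suc n) (nupdate (pre @ ''q'') 0 (Suc n) \<sigma>'')) \<tau>"
    proof (rule wpt_Seq_frame[OF wpt_step_com[where d = d and off = "n * d" and r = r and q = n and p = p]])
      let ?W = "\<lambda>a b. (\<Sum>e<d. reals \<tau> (pre @ ''A'') a e * reals \<tau> (pre @ ''G'') (n * d + e) b)
        + real (r - n) * (\<Sum>e<d. reals \<tau> (pre @ ''Y'') a e * reals \<tau> (pre @ ''G'') (n * d + d + e) b)"
      let ?t = "(\<Sum>a<d. ?W a a) / real (Suc p)"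
      fix \<tau>1 assume f1: "frame (nmods step_com) (rmods step_com) \<tau> \<tau>1"
        and R: "reals \<tau>1 (pre @ ''Psi'') = (reals \<tau> (pre @ ''Psi''))(Suc p := (reals \<tau> (pre @ ''Psi'') (Suc p))(n := ?t)) \<and>
          (\<forall>a<d. \<forall>b<d. reals \<tau>1 (pre @ ''G'') (n * d + a) b = (if a = b then ?t else 0) - ?W a b) \<and>
          (\<forall>a b. \<not> (n * d \<le> a \<and> a < n * d + d \<and> b < d) \<longrightarrow> reals \<tau>1 (pre @ ''G'') a b = reals \<tau> (pre @ ''G'') a b)"
      have W: "?W a b = emul d m wt u p (r - n) A a b" if "Suc p + n \<le> l" "a < d" "b < d" for a b
      proof -
        have "reals \<tau> (pre @ ''G'') (n * d + e) b = emat d m wt u p (r - n) A e b" if "e < d" for e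
          using I \<open>Suc p + n \<le> l\<close> \<open>b < d\<close> that by simp
        moreover have "reals \<tau> (pre @ ''G'') (n * d + d + e) b = emat d m wt u p (r - n - 1) A e b" if "e < d" for e
          using I[THEN conjunct2, THEN conjunct1, rule_format, of e b "Suc n"] \<open>Suc p + n \<le> l\<close> \<open>b < d\<close> that
          by (simp add: add.commute)
        moreover have "reals \<tau> (pre @ ''A'') a e = A a e" "reals \<tau> (pre @ ''Y'') a e = mean_outer m wt u a e" if "e < d" for e
          using f A Y \<open>a < d\<close> that by (simp_all add: frame_def)
        ultimately show ?thesis by (simp add: emul_def)
      qed
      have t: "?t = ecoeff d m wt u (Suc p) (r - n) A" if "Suc p + n \<le> l"
        using W[OF that] pl ld by (simp add: ecoeff_Suc)
      have G0: "reals \<tau>1 (pre @ ''G'') (n * d + a) b = emat d m wt u (Suc p) (r - n) A a b"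
        if "Suc p + n \<le> l" "a < d" "b < d" for a b
        using R t W that pl ld by (simp add: emat_Suc)
      have Gq: "reals \<tau>1 (pre @ ''G'') (q * d + a) b = reals \<tau> (pre @ ''G'') (q * d + a) b"
        if "q \<noteq> n" "a < d" for q a b
        using R block_row_iff[OF that(2), of n q] that(1) by blast
      have "(q < Suc n \<and> Suc p + q \<le> l \<longrightarrow> reals \<tau>1 (pre @ ''G'') (q * d + a) b = emat d m wt u (Suc p) (r - q) A a b) \<and>
        (Suc n \<le> q \<and> p + q \<le> l \<longrightarrow> reals \<tau>1 (pre @ ''G'') (q * d + a) b = emat d m wt u p (r - q) A a b)"
        if "a < d" "b < d" for q a b
        using I G0[of a b] Gq[of q a b] that by (cases "q = n") auto
      moreover have "reals \<tau>1 (pre @ ''Psi'') (Suc p) 0 = ecoeff d m wt u (Suc p) r A"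
        using R I t pl by (cases "n = 0") auto
      moreover have "reals \<tau>1 (pre @ ''Psi'') p' = reals \<sigma> (pre @ ''Psi'') p'" if "p' \<noteq> Suc p" for p'
        using R I that by simp
      ultimately show "wpt (nset ''o'' (NPlus (nv ''o'') (nv ''d''))) 1
          (\<lambda>\<sigma>''. ?I (Suc n) (nupdate (pre @ ''q'') 0 (Suc n) \<sigma>'')) \<tau>1"
        using f f1 I d by (intro wpt_NAssign) (auto simp: frame_def)
    qed (use f d l r p pl ld qn I in \<open>auto simp: frame_def\<close>)
  qed (use d l pl G in \<open>auto simp: frame_def algebra_simps\<close>)
qed (auto simp: level_time_def)

end

text \<open>
  The matrix of the quadratic form \<open>E\<^sub>p(M + v v\<^sup>T) - E\<^sub>p(M)\<close>, which is zero for \<open>p = 0\<close>.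
\<close>
definition eprev :: "nat \<Rightarrow> nat \<Rightarrow> (nat \<Rightarrow> real) \<Rightarrow> (nat \<Rightarrow> nat \<Rightarrow> real) \<Rightarrow> nat \<Rightarrow> nat \<Rightarrow>
    (nat \<Rightarrow> nat \<Rightarrow> real) \<Rightarrow> nat \<Rightarrow> nat \<Rightarrow> real" where
  "eprev d m w u p r A a b = (case p of 0 \<Rightarrow> 0 | Suc q \<Rightarrow> emat d m w u q r A a b)"

lemma ecoeff_add_outer_eprev:
  assumes "(\<Sum>i<m. w i) = 1" "p \<le> d"
  shows "ecoeff d m w u p r (add_outer A v) =
    ecoeff d m w u p r A + (\<Sum>a<d. \<Sum>b<d. v a * eprev d m w u p r A a b * v b)"
  using assms by (cases p) (simp_all add: ecoeff_0 eprev_def ecoeff_add_outer)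

context fresh_matmul
begin

text \<open>Slot 0 is saved before its level is overwritten, so \<open>H\<close> ends as the matrix
  of level l - 1. \<open>H1\<close> is updated only while p < l' and thus stops at level l' - 1, or
  keeps the initial zero matrix if l' = 0. These are the matrices \<open>eprev\<close> for l and
  l'.\<close>

definition table_com :: com where
  "table_com = Seq init_com (For (pre @ ''p'') (nv ''l'')
     (Seq (MS (pre @ ''H'') (NConst 0) (rm ''G''))
     (Seq (If (NLess (nv ''p'') (nv ''l1'')) (MS (pre @ ''H1'') (NConst 0) (rm ''G'')) Skip) level_com)))"

lemma mods_table_com [simp]:
  "nmods table_com = {''n'', pre @ ''a'', pre @ ''b'', pre @ ''q'', pre @ ''o'', pre @ ''p''} \<union> nmods P"
  "rmods table_com = {''A'', ''B'', pre @ ''W'', pre @ ''tr'', pre @ ''Psi'', pre @ ''G'', pre @ ''H'', pre @ ''H1''} \<union> rmods P"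
  by (auto simp: table_com_def)

definition table_time :: "nat \<Rightarrow> nat \<Rightarrow> real" where
  "table_time d l = init_time d l + 2 + real l * (2 * mat_time d + level_time d l + 3)"

lemma mat_time_ge: "2 \<le> mat_time d"
  by (simp add: mat_time_def)

lemma wpt_table_com:
  assumes d: "nats \<sigma> (pre @ ''d'') 0 = d" and l: "nats \<sigma> (pre @ ''l'') 0 = l" and l1: "nats \<sigma> (pre @ ''l1'') 0 = l'"
    and r: "nats \<sigma> (pre @ ''r'') 0 = r"
    and ll: "l' < l" and ld: "l \<le> d"
    and A: "\<And>a b. a < d \<Longrightarrow> b < d \<Longrightarrow> reals \<sigma> (pre @ ''A'') a b = A a b"
    and Y: "\<And>a b. a < d \<Longrightarrow> b < d \<Longrightarrow> reals \<sigma> (pre @ ''Y'') a b = mean_outer m wt u a b"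
    and wt: "(\<Sum>i<m. wt i) = 1"
  shows "wpt table_com (table_time d l) (\<lambda>\<sigma>'.
    (\<forall>a<d. \<forall>b<d. reals \<sigma>' (pre @ ''H'') a b = eprev d m wt u l r A a b) \<and>
    (\<forall>a<d. \<forall>b<d. reals \<sigma>' (pre @ ''H1'') a b = eprev d m wt u l' r A a b) \<and>
    reals \<sigma>' (pre @ ''Psi'') l 0 = ecoeff d m wt u l r A \<and>
    reals \<sigma>' (pre @ ''Psi'') l' 0 = ecoeff d m wt u l' r A) \<sigma>"
  unfolding table_com_def
proof (rule wpt_Seq_frame[OF wpt_init_com[where d = d and l = l]])
  let ?c1 = "MS (pre @ ''H'') (NConst 0) (rm ''G'')"
  let ?c2 = "If (NLess (nv ''p'') (nv ''l1'')) (MS (pre @ ''H1'') (NConst 0) (rm ''G'')) Skip"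
  let ?c = "Seq ?c1 (Seq ?c2 level_com)"
  let ?I = "\<lambda>n \<sigma>'. (\<forall>q a b. n + q \<le> l \<longrightarrow> a < d \<longrightarrow> b < d \<longrightarrow>
      reals \<sigma>' (pre @ ''G'') (q * d + a) b = emat d m wt u n (r - q) A a b) \<and>
    (\<forall>p'\<le>n. reals \<sigma>' (pre @ ''Psi'') p' 0 = ecoeff d m wt u p' r A) \<and>
    (\<forall>a<d. \<forall>b<d. reals \<sigma>' (pre @ ''H'') a b = eprev d m wt u n r A a b) \<and>
    (\<forall>a<d. \<forall>b<d. reals \<sigma>' (pre @ ''H1'') a b = eprev d m wt u (min n l') r A a b)"
  fix \<sigma>0 assume f0: "frame (nmods init_com) (rmods init_com) \<sigma> \<sigma>0"
    and R0: "(\<forall>a<d. \<forall>b<d. reals \<sigma>0 (pre @ ''H'') a b = 0) \<and>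
    (\<forall>a<d. \<forall>b<d. reals \<sigma>0 (pre @ ''H1'') a b = 0) \<and> reals \<sigma>0 (pre @ ''Psi'') 0 0 = 1 \<and>
    (\<forall>q\<le>l. \<forall>a<d. \<forall>b<d. reals \<sigma>0 (pre @ ''G'') (q * d + a) b = (if a = b then 1 else 0))"
  show "wpt (For (pre @ ''p'') (nv ''l'') ?c) (2 + real l * (2 * mat_time d + level_time d l + 3)) (\<lambda>\<sigma>'.
    (\<forall>a<d. \<forall>b<d. reals \<sigma>' (pre @ ''H'') a b = eprev d m wt u l r A a b) \<and>
    (\<forall>a<d. \<forall>b<d. reals \<sigma>' (pre @ ''H1'') a b = eprev d m wt u l' r A a b) \<and>
    reals \<sigma>' (pre @ ''Psi'') l 0 = ecoeff d m wt u l r A \<and>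
    reals \<sigma>' (pre @ ''Psi'') l' 0 = ecoeff d m wt u l' r A) \<sigma>0"
  proof (rule wpt_For[where n = l and T = "2 * mat_time d + level_time d l + 1" and Inv = ?I])
    fix n \<tau> assume n: "n < l" and f: "frame (insert (pre @ ''p'') (nmods ?c)) (rmods ?c) \<sigma>0 \<tau>"
      and pn: "nats \<tau> (pre @ ''p'') 0 = n" and I: "?I n \<tau>"
    have G: "reals \<tau> (pre @ ''G'') a b = emat d m wt u n r A a b" if "a < d" "b < d" for a b
      using I[THEN conjunct1, rule_format, of 0 a b] n that by simp
    show "wpt ?c (2 * mat_time d + level_time d l + 1) (\<lambda>\<sigma>''. ?I (Suc n) (nupdate (pre @ ''p'') 0 (Suc n) \<sigma>'')) \<tau>"
    proof (rule wpt_Seq_frame[OF wpt_MS[where d = d and off = 0 and F = "\<lambda>a b. eprev d m wt u (Suc n) r A a b"]])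
      fix \<tau>1 assume f1: "frame (nmods ?c1) (rmods ?c1) \<tau> \<tau>1"
        and H: "(\<forall>a<d. \<forall>b<d. reals \<tau>1 (pre @ ''H'') (0 + a) b = eprev d m wt u (Suc n) r A a b) \<and>
          (\<forall>a b. \<not> (0 \<le> a \<and> a < 0 + d \<and> b < d) \<longrightarrow> reals \<tau>1 (pre @ ''H'') a b = reals \<tau> (pre @ ''H'') a b)"
      let ?Q = "\<lambda>\<sigma>'. \<forall>a<d. \<forall>b<d. reals \<sigma>' (pre @ ''H1'') a b = eprev d m wt u (min (Suc n) l') r A a b"
      have "wpt ?c2 (1 + mat_time d) ?Q \<tau>1"
      proof (rule wpt_If[OF _ _ order_refl])
        assume "bval (NLess (nv ''p'') (nv ''l1'')) \<tau>1"
        hence "n < l'" using f0 f f1 l1 pn by (simp add: frame_def)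
        thus "wpt (MS (pre @ ''H1'') (NConst 0) (rm ''G'')) (mat_time d) ?Q \<tau>1"
          using f0 f f1 d G
          by (intro wpt_conseq[OF wpt_MS[where d = d and off = 0 and F = "\<lambda>a b. eprev d m wt u (Suc n) r A a b"]])
             (auto simp: frame_def eprev_def)
      next
        assume "\<not> bval (NLess (nv ''p'') (nv ''l1'')) \<tau>1"
        hence "min (Suc n) l' = min n l'" using f0 f f1 l1 pn by (simp add: frame_def)
        thus "wpt Skip (mat_time d) ?Q \<tau>1"
          using f1 I mat_time_ge[of d] by (intro wpt_Skip) (auto simp: frame_def)
      qed
      thus "wpt (Seq ?c2 level_com) (mat_time d + level_time d l + 1)
          (\<lambda>\<sigma>''. ?I (Suc n) (nupdate (pre @ ''p'') 0 (Suc n) \<sigma>'')) \<tau>1"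
      proof (rule wpt_Seq_frame)
        fix \<tau>2 assume f2: "frame (nmods ?c2) (rmods ?c2) \<tau>1 \<tau>2" and H1: "?Q \<tau>2"
        show "wpt level_com (level_time d l) (\<lambda>\<sigma>''. ?I (Suc n) (nupdate (pre @ ''p'') 0 (Suc n) \<sigma>'')) \<tau>2"
        proof (rule wpt_conseq[OF wpt_level_com[where d = d and l = l and r = r and p = n and A = A
              and m = m and wt = wt and u = u] order_refl])
          fix \<tau>3 assume f3: "frame (nmods level_com) (rmods level_com) \<tau>2 \<tau>3"
            and L: "(\<forall>q a b. Suc n + q \<le> l \<longrightarrow> a < d \<longrightarrow> b < d \<longrightarrow>
              reals \<tau>3 (pre @ ''G'') (q * d + a) b = emat d m wt u (Suc n) (r - q) A a b) \<and>
            reals \<tau>3 (pre @ ''Psi'') (Suc n) 0 = ecoeff d m wt u (Suc n) r A \<and>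
            (\<forall>p'. p' \<noteq> Suc n \<longrightarrow> reals \<tau>3 (pre @ ''Psi'') p' = reals \<tau>2 (pre @ ''Psi'') p')"
          have "reals \<tau>3 (pre @ ''Psi'') p' 0 = ecoeff d m wt u p' r A" if "p' \<le> Suc n" for p'
            using L I that f1 f2 by (cases "p' = Suc n") (auto simp: frame_def)
          thus "?I (Suc n) (nupdate (pre @ ''p'') 0 (Suc n) \<tau>3)"
            using L H H1 f2 f3 by (auto simp: frame_def)
        qed (use f0 f f1 f2 d l r pn n ld A Y I in \<open>auto simp: frame_def\<close>)
      qed simp
    qed (use f0 f d G in \<open>auto simp: frame_def eprev_def\<close>)
  qed (use f0 R0 l wt ll in \<open>auto simp: frame_def eprev_def emat_0 ecoeff_0\<close>)
qed (use d l in \<open>auto simp: table_time_def\<close>)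

section \<open>Evaluating and comparing the candidates\<close>

definition quad_com :: "string \<Rightarrow> string \<Rightarrow> string \<Rightarrow> com" where
  "quad_com acc h e = Seq (rset acc (RArr (pre @ ''Psi'') (nv e) (NConst 0)))
     (For (pre @ ''a'') (nv ''d'') (For (pre @ ''b'') (nv ''d'') (rset acc (RPlus (rs acc)
       (RTimes (RTimes (RArr (pre @ ''V'') (nv ''i'') (nv ''a'')) (rm h)) (RArr (pre @ ''V'') (nv ''i'') (nv ''b'')))))))"

lemma mods_quad_com [simp]:
  "nmods (quad_com acc h e) = {pre @ ''a'', pre @ ''b''}"
  "rmods (quad_com acc h e) = {pre @ acc}"
  by (auto simp: quad_com_def)

lemma wpt_quad_com:
  assumes d: "nats \<sigma> (pre @ ''d'') 0 = d" and i: "nats \<sigma> (pre @ ''i'') 0 = i"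
    and acc: "acc \<noteq> ''V''" "acc \<noteq> h"
    and V: "\<And>a. a < d \<Longrightarrow> reals \<sigma> (pre @ ''V'') i a = v a"
    and H: "\<And>a b. a < d \<Longrightarrow> b < d \<Longrightarrow> reals \<sigma> (pre @ h) a b = H a b"
    and c: "reals \<sigma> (pre @ ''Psi'') (nats \<sigma> (pre @ e) 0) 0 = c"
  shows "wpt (quad_com acc h e) (mat_time d + 1)
    (\<lambda>\<sigma>'. reals \<sigma>' (pre @ acc) 0 0 = c + (\<Sum>a<d. \<Sum>b<d. v a * H a b * v b)) \<sigma>"
  unfolding quad_com_def
proof (rule wpt_Seq[OF wpt_RAssign[where T = 1]])
  let ?c2 = "rset acc (RPlus (rs acc)
       (RTimes (RTimes (RArr (pre @ ''V'') (nv ''i'') (nv ''a'')) (rm h)) (RArr (pre @ ''V'') (nv ''i'') (nv ''b''))))"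
  let ?c1 = "For (pre @ ''b'') (nv ''d'') ?c2"
  let ?s = "rupdate (pre @ acc) (nval (NConst 0) \<sigma>) (nval (NConst 0) \<sigma>)
      (rval (RArr (pre @ ''Psi'') (nv e) (NConst 0)) \<sigma>) \<sigma>"
  show "wpt (For (pre @ ''a'') (nv ''d'') ?c1) (mat_time d)
    (\<lambda>\<sigma>'. reals \<sigma>' (pre @ acc) 0 0 = c + (\<Sum>a<d. \<Sum>b<d. v a * H a b * v b)) ?s"
  proof (rule wpt_For[where n = d and T = "2 + real d * 3" and
        Inv = "\<lambda>n \<sigma>'. reals \<sigma>' (pre @ acc) 0 0 = c + (\<Sum>a<n. \<Sum>b<d. v a * H a b * v b)"])
    fix n \<tau> assume n: "n < d" and f: "frame (insert (pre @ ''a'') (nmods ?c1)) (rmods ?c1) ?s \<tau>"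
      and an: "nats \<tau> (pre @ ''a'') 0 = n"
      and I: "reals \<tau> (pre @ acc) 0 0 = c + (\<Sum>a<n. \<Sum>b<d. v a * H a b * v b)"
    show "wpt ?c1 (2 + real d * 3) (\<lambda>\<sigma>''. reals (nupdate (pre @ ''a'') 0 (Suc n) \<sigma>'') (pre @ acc) 0 0
        = c + (\<Sum>a<Suc n. \<Sum>b<d. v a * H a b * v b)) \<tau>"
    proof (rule wpt_For[where n = d and T = 1 and Inv = "\<lambda>k \<sigma>'. reals \<sigma>' (pre @ acc) 0 0
        = c + (\<Sum>a<n. \<Sum>b<d. v a * H a b * v b) + (\<Sum>b<k. v n * H n b * v b)"])
      fix k \<tau>' assume "k < d" "frame (insert (pre @ ''b'') (nmods ?c2)) (rmods ?c2) \<tau> \<tau>'"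
        "nats \<tau>' (pre @ ''b'') 0 = k" "reals \<tau>' (pre @ acc) 0 0
        = c + (\<Sum>a<n. \<Sum>b<d. v a * H a b * v b) + (\<Sum>b<k. v n * H n b * v b)"
      thus "wpt ?c2 1 (\<lambda>\<sigma>''. reals (nupdate (pre @ ''b'') 0 (Suc k) \<sigma>'') (pre @ acc) 0 0
        = c + (\<Sum>a<n. \<Sum>b<d. v a * H a b * v b) + (\<Sum>b<Suc k. v n * H n b * v b)) \<tau>'"
        using n f an i acc V H by (intro wpt_RAssign) (auto simp: frame_def)
    qed (use n f an I d in \<open>auto simp: frame_def\<close>)
  qed (use d c in \<open>auto simp: frame_def mat_time_def algebra_simps\<close>)
qed auto

text \<open>
  Quotients are compared by cross multiplication; the initial value \<open>1 / 0\<close> loses against every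
  candidate with a positive denominator, and a candidate with denominator \<open>0\<close> is never taken.
\<close>
definition cand_com :: com where
  "cand_com = Seq (rset ''bn'' (ROfNat (NConst 1))) (Seq (rset ''bd'' (ROfNat (NConst 0))) (Seq (nset ''best'' (NConst 0))
     (For (pre @ ''i'') (nv ''m'')
       (Seq (quad_com ''nu'' ''H1'' ''l1'')
       (Seq (quad_com ''de'' ''H'' ''l'')
         (If (RLess (RTimes (rs ''nu'') (rs ''bd'')) (RTimes (rs ''bn'') (rs ''de'')))
           (Seq (rset ''bn'' (rs ''nu'')) (Seq (rset ''bd'' (rs ''de'')) (nset ''best'' (nv ''i'')))) Skip))))))"

lemma mods_cand_com [simp]:
  "nmods cand_com = {pre @ ''a'', pre @ ''b'', pre @ ''i'', pre @ ''best''}"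
  "rmods cand_com = {pre @ ''nu'', pre @ ''de'', pre @ ''bn'', pre @ ''bd''}"
  by (auto simp: cand_com_def)

definition cand_time :: "nat \<Rightarrow> nat \<Rightarrow> real" where
  "cand_time d m = 5 + real m * (2 * mat_time d + 8)"

lemma wpt_cand_com:
  assumes d: "nats \<sigma> (pre @ ''d'') 0 = d" and m: "nats \<sigma> (pre @ ''m'') 0 = m" "0 < m"
    and l: "nats \<sigma> (pre @ ''l'') 0 = l" and l1: "nats \<sigma> (pre @ ''l1'') 0 = l'"
    and V: "\<And>i a. i < m \<Longrightarrow> a < d \<Longrightarrow> reals \<sigma> (pre @ ''V'') i a = u i a"
    and num: "\<And>i. i < m \<Longrightarrow> num i = reals \<sigma> (pre @ ''Psi'') l' 0 + (\<Sum>a<d. \<Sum>b<d. u i a * reals \<sigma> (pre @ ''H1'') a b * u i b)"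
    and den: "\<And>i. i < m \<Longrightarrow> den i = reals \<sigma> (pre @ ''Psi'') l 0 + (\<Sum>a<d. \<Sum>b<d. u i a * reals \<sigma> (pre @ ''H'') a b * u i b)"
    and pos: "\<And>i. i < m \<Longrightarrow> 0 \<le> num i" "\<And>i. i < m \<Longrightarrow> 0 \<le> den i"
  shows "wpt cand_com (cand_time d m) (\<lambda>\<sigma>'. let b = nats \<sigma>' (pre @ ''best'') 0 in b < m \<and>
    ((\<exists>i<m. 0 < den i) \<longrightarrow> 0 < den b \<and> (\<forall>i<m. num b * den i \<le> num i * den b))) \<sigma>"
proof -
  let ?c1 = "quad_com ''nu'' ''H1'' ''l1''" and ?c2 = "quad_com ''de'' ''H'' ''l''"
  let ?c4 = "Seq (rset ''bn'' (rs ''nu'')) (Seq (rset ''bd'' (rs ''de'')) (nset ''best'' (nv ''i'')))"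
  let ?b = "RLess (RTimes (rs ''nu'') (rs ''bd'')) (RTimes (rs ''bn'') (rs ''de''))"
  let ?c3 = "If ?b ?c4 Skip"
  let ?c = "Seq ?c1 (Seq ?c2 ?c3)"
  let ?s = "nupdate (pre @ ''best'') 0 0 (rupdate (pre @ ''bd'') 0 0 0 (rupdate (pre @ ''bn'') 0 0 1 \<sigma>))"
  let ?R = "\<lambda>\<sigma>'. let b = nats \<sigma>' (pre @ ''best'') 0 in b < m \<and>
    ((\<exists>i<m. 0 < den i) \<longrightarrow> 0 < den b \<and> (\<forall>i<m. num b * den i \<le> num i * den b))"
  \<comment> \<open>While the record is still 1 / 0, the first conjunct says that den i <= 0 for all
    i seen so far; otherwise it says that the record is the least quotient. The default index 0 is a
    legal output because m is positive.\<close>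
  define J where "J n best bn bd \<longleftrightarrow> (\<forall>i<n. bn * den i \<le> num i * bd) \<and>
      (best = 0 \<and> bn = 1 \<and> bd = 0 \<or> best < n \<and> bn = num best \<and> bd = den best \<and> 0 < bd)" for n best bn bd
  let ?I = "\<lambda>n \<sigma>'. J n (nats \<sigma>' (pre @ ''best'') 0) (reals \<sigma>' (pre @ ''bn'') 0 0) (reals \<sigma>' (pre @ ''bd'') 0 0)"
  have main: "wpt (For (pre @ ''i'') (nv ''m'') ?c) (2 + real m * (2 * mat_time d + 8)) ?R ?s"
  proof (rule wpt_For[where n = m and T = "2 * mat_time d + 6" and Inv = ?I])
    fix n \<tau> assume n: "n < m" and f: "frame (insert (pre @ ''i'') (nmods ?c)) (rmods ?c) ?s \<tau>"
      and i: "nats \<tau> (pre @ ''i'') 0 = n" and I: "?I n \<tau>"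
    show "wpt ?c (2 * mat_time d + 6) (\<lambda>\<sigma>''. ?I (Suc n) (nupdate (pre @ ''i'') 0 (Suc n) \<sigma>'')) \<tau>"
    proof (rule wpt_Seq_frame[OF wpt_quad_com[where d = d and i = n and v = "u n"
            and H = "reals \<sigma> (pre @ ''H1'')" and c = "reals \<sigma> (pre @ ''Psi'') l' 0"]])
      fix \<tau>1 assume f1: "frame (nmods ?c1) (rmods ?c1) \<tau> \<tau>1" and nu: "reals \<tau>1 (pre @ ''nu'') 0 0 =
        reals \<sigma> (pre @ ''Psi'') l' 0 + (\<Sum>a<d. \<Sum>b<d. u n a * reals \<sigma> (pre @ ''H1'') a b * u n b)"
      show "wpt (Seq ?c2 ?c3) (mat_time d + 5) (\<lambda>\<sigma>''. ?I (Suc n) (nupdate (pre @ ''i'') 0 (Suc n) \<sigma>'')) \<tau>1"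
      proof (rule wpt_Seq_frame[OF wpt_quad_com[where d = d and i = n and v = "u n"
            and H = "reals \<sigma> (pre @ ''H'')" and c = "reals \<sigma> (pre @ ''Psi'') l 0"]])
        fix \<tau>2 assume f2: "frame (nmods ?c2) (rmods ?c2) \<tau>1 \<tau>2" and de: "reals \<tau>2 (pre @ ''de'') 0 0 =
          reals \<sigma> (pre @ ''Psi'') l 0 + (\<Sum>a<d. \<Sum>b<d. u n a * reals \<sigma> (pre @ ''H'') a b * u n b)"
        have vals: "reals \<tau>2 (pre @ ''nu'') 0 0 = num n" "reals \<tau>2 (pre @ ''de'') 0 0 = den n"
          "nats \<tau>2 (pre @ ''i'') 0 = n"
          using nu de f1 f2 num[OF n] den[OF n] i by (auto simp: frame_def)
        have I2: "?I n \<tau>2" using I f1 f2 by (simp add: frame_def)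
        show "wpt ?c3 4 (\<lambda>\<sigma>''. ?I (Suc n) (nupdate (pre @ ''i'') 0 (Suc n) \<sigma>'')) \<tau>2"
        proof (rule wpt_If[where ?T1.0 = 3])
          assume "bval ?b \<tau>2"
          hence b: "num n * reals \<tau>2 (pre @ ''bd'') 0 0 < reals \<tau>2 (pre @ ''bn'') 0 0 * den n"
            by (simp add: vals)
          have "J (Suc n) n (num n) (den n)"
          proof (cases "reals \<tau>2 (pre @ ''bd'') 0 0 = 0")
            case True
            hence bn: "reals \<tau>2 (pre @ ''bn'') 0 0 = 1" using I2 by (auto simp: J_def)
            hence "den n > 0" using b True by simp
            moreover have "den i = 0" if "i < n" for i
              using I2 True bn that pos(2)[of i] n unfolding J_def by force
            ultimately show ?thesis
              using pos n by (auto simp: J_def less_Suc_eq intro!: mult_nonneg_nonneg)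
          next
            case False
            define bn bd where "bn = reals \<tau>2 (pre @ ''bn'') 0 0" and "bd = reals \<tau>2 (pre @ ''bd'') 0 0"
            have bd: "bd > 0" and bn: "bn \<ge> 0" and le: "\<And>i. i < n \<Longrightarrow> bn * den i \<le> num i * bd"
              using I2 False pos n unfolding J_def bn_def bd_def by auto
            have b': "num n * bd < bn * den n" using b by (simp add: bn_def bd_def)
            have "0 \<le> num n * bd" using pos(1)[OF n] bd by simp
            hence dn: "den n > 0" using b' bn pos(2)[OF n]
              by (metis less_eq_real_def mult_zero_right not_less)
            \<comment> \<open>Transitivity through the old record bn / bd, multiplied by bd because
              den i may be zero.\<close>
            have "num n * den i \<le> num i * den n" if "i < n" for i
            proof -
              have "bd * (num n * den i) \<le> (bn * den n) * den i"
                using mult_right_mono[of "num n * bd" "bn * den n" "den i"] b' pos(2)[of i] that n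
                by (simp add: mult_ac)
              also have "\<dots> \<le> den n * (num i * bd)"
                using mult_left_mono[OF le[OF that], of "den n"] dn by (simp add: mult_ac)
              finally have "bd * (num n * den i) \<le> bd * (num i * den n)" by (simp add: mult_ac)
              thus ?thesis using bd by simp
            qed
            thus ?thesis using dn by (auto simp: J_def less_Suc_eq)
          qed
          thus "wpt ?c4 3 (\<lambda>\<sigma>''. ?I (Suc n) (nupdate (pre @ ''i'') 0 (Suc n) \<sigma>'')) \<tau>2"
            by (intro wpt_Seq[OF wpt_RAssign[where T = 1]] wpt_Seq[OF wpt_RAssign[where T = 1], where ?T2.0 = 1 and T = 2]
                  wpt_NAssign) (auto simp: vals)
        next
          assume "\<not> bval ?b \<tau>2"
          hence "reals \<tau>2 (pre @ ''bn'') 0 0 * den n \<le> num n * reals \<tau>2 (pre @ ''bd'') 0 0"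
            by (simp add: vals)
          hence "?I (Suc n) \<tau>2" using I2 by (auto simp: J_def less_Suc_eq)
          thus "wpt Skip 3 (\<lambda>\<sigma>''. ?I (Suc n) (nupdate (pre @ ''i'') 0 (Suc n) \<sigma>'')) \<tau>2"
            by (intro wpt_Skip) auto
        qed simp
      qed (use f f1 d i l V n in \<open>auto simp: frame_def\<close>)
    qed (use f d i l1 V n in \<open>auto simp: frame_def\<close>)
  next
    fix \<tau> assume "?I m \<tau>"
    thus "?R \<tau>" using m(2) by (force simp: J_def Let_def)
  qed (use m in \<open>auto simp: frame_def J_def\<close>)
  show ?thesis
    unfolding cand_com_def
    by (rule wpt_Seq_RAssign[where T = "4 + real m * (2 * mat_time d + 8)"],
        rule wpt_Seq_RAssign[where T = "3 + real m * (2 * mat_time d + 8)"],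
        rule wpt_Seq_NAssign[where T = "2 + real m * (2 * mat_time d + 8)"])
       (use main in \<open>simp_all add: cand_time_def\<close>)
qed

section \<open>The greedy loop\<close>

text \<open>Here r = k - (j + 1) counts the samples that remain after position j has been filled, so
  the candidates are evaluated by expectations over the later positions only.\<close>

definition choose_com :: com where
  "choose_com = Seq (nset ''r'' (NMinus (nv ''k'') (NPlus (nv ''j'') (NConst 1))))
    (Seq table_com (Seq cand_com (Seq (NAssign (pre @ ''s'') (nv ''j'') (nv ''best''))
      (MS (pre @ ''A'') (NConst 0) (RPlus (rm ''A'')
        (RTimes (RArr (pre @ ''V'') (nv ''best'') (nv ''a'')) (RArr (pre @ ''V'') (nv ''best'') (nv ''b''))))))))"

lemma mods_choose_com [simp]:
  "nmods choose_com = {''n'', pre @ ''a'', pre @ ''b'', pre @ ''q'', pre @ ''o'', pre @ ''p'', pre @ ''i'',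
    pre @ ''best'', pre @ ''r'', pre @ ''s''} \<union> nmods P"
  "rmods choose_com = {''A'', ''B'', pre @ ''W'', pre @ ''tr'', pre @ ''Psi'', pre @ ''G'', pre @ ''H'', pre @ ''H1'',
    pre @ ''nu'', pre @ ''de'', pre @ ''bn'', pre @ ''bd'', pre @ ''A''} \<union> rmods P"
  by (auto simp: choose_com_def)

definition choose_time :: "nat \<Rightarrow> nat \<Rightarrow> nat \<Rightarrow> real" where
  "choose_time d m l = 2 + table_time d l + cand_time d m + mat_time d"

definition env :: "nat \<Rightarrow> nat \<Rightarrow> nat \<Rightarrow> nat \<Rightarrow> nat \<Rightarrow> (nat \<Rightarrow> real) \<Rightarrow> (nat \<Rightarrow> nat \<Rightarrow> real) \<Rightarrow> state \<Rightarrow> bool" where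
  "env d m k l' l wt u \<sigma> \<longleftrightarrow> nats \<sigma> (pre @ ''d'') 0 = d \<and> nats \<sigma> (pre @ ''m'') 0 = m \<and>
    nats \<sigma> (pre @ ''k'') 0 = k \<and> nats \<sigma> (pre @ ''l1'') 0 = l' \<and> nats \<sigma> (pre @ ''l'') 0 = l \<and>
    (\<forall>i<m. \<forall>a<d. reals \<sigma> (pre @ ''V'') i a = u i a) \<and>
    (\<forall>a<d. \<forall>b<d. reals \<sigma> (pre @ ''Y'') a b = mean_outer m wt u a b)"

lemma wpt_choose_com:
  assumes env: "env d m k l' l wt u \<sigma>" and j: "nats \<sigma> (pre @ ''j'') 0 = j"
    and ll: "l' < l" "l \<le> d" and m: "0 < m"
    and A: "\<And>a b. a < d \<Longrightarrow> b < d \<Longrightarrow> reals \<sigma> (pre @ ''A'') a b = A a b" and psd: "psd_sum A"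
    and wt: "(\<Sum>i<m. wt i) = 1" "\<And>i. i < m \<Longrightarrow> 0 \<le> wt i"
  defines "e \<equiv> \<lambda>p i. ecoeff d m wt u p (k - Suc j) (add_outer A (u i))"
  shows "wpt choose_com (choose_time d m l) (\<lambda>\<sigma>'. let b = nats \<sigma>' (pre @ ''s'') j in
    nats \<sigma>' (pre @ ''s'') = (nats \<sigma> (pre @ ''s''))(j := b) \<and> b < m \<and>
    (\<forall>x<d. \<forall>y<d. reals \<sigma>' (pre @ ''A'') x y = add_outer A (u b) x y) \<and>
    ((\<exists>i<m. 0 < e l i) \<longrightarrow> 0 < e l b \<and> (\<forall>i<m. e l' b * e l i \<le> e l' i * e l b))) \<sigma>"
  unfolding choose_com_def
proof (rule wpt_Seq_NAssign)
  let ?r = "k - Suc j"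
  let ?s = "nupdate (pre @ ''r'') (nval (NConst 0) \<sigma>) (nval (NMinus (nv ''k'') (NPlus (nv ''j'') (NConst 1))) \<sigma>) \<sigma>"
  let ?c4 = "NAssign (pre @ ''s'') (nv ''j'') (nv ''best'')"
  let ?c5 = "MS (pre @ ''A'') (NConst 0) (RPlus (rm ''A'')
        (RTimes (RArr (pre @ ''V'') (nv ''best'') (nv ''a'')) (RArr (pre @ ''V'') (nv ''best'') (nv ''b''))))"
  let ?R = "\<lambda>\<sigma>'. let b = nats \<sigma>' (pre @ ''s'') j in
    nats \<sigma>' (pre @ ''s'') = (nats \<sigma> (pre @ ''s''))(j := b) \<and> b < m \<and>
    (\<forall>x<d. \<forall>y<d. reals \<sigma>' (pre @ ''A'') x y = add_outer A (u b) x y) \<and>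
    ((\<exists>i<m. 0 < e l i) \<longrightarrow> 0 < e l b \<and> (\<forall>i<m. e l' b * e l i \<le> e l' i * e l b))"
  have psd': "psd_sum (add_outer A (u i))" for i using psd by (rule psd_sum_add_outer)
  show "wpt (Seq table_com (Seq cand_com (Seq ?c4 ?c5))) (choose_time d m l - 1) ?R ?s"
  proof (rule wpt_Seq_frame[OF wpt_table_com[where d = d and l = l and l' = l' and r = ?r and A = A
        and m = m and wt = wt and u = u]])
    fix \<sigma>1 assume f1: "frame (nmods table_com) (rmods table_com) ?s \<sigma>1"
      and T: "(\<forall>a<d. \<forall>b<d. reals \<sigma>1 (pre @ ''H'') a b = eprev d m wt u l ?r A a b) \<and>
        (\<forall>a<d. \<forall>b<d. reals \<sigma>1 (pre @ ''H1'') a b = eprev d m wt u l' ?r A a b) \<and>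
        reals \<sigma>1 (pre @ ''Psi'') l 0 = ecoeff d m wt u l ?r A \<and>
        reals \<sigma>1 (pre @ ''Psi'') l' 0 = ecoeff d m wt u l' ?r A"
    show "wpt (Seq cand_com (Seq ?c4 ?c5)) (choose_time d m l - 1 - table_time d l) ?R \<sigma>1"
    proof (rule wpt_Seq_frame[OF wpt_cand_com[where d = d and m = m and l = l and l' = l' and u = u
          and num = "e l'" and den = "e l"]])
      fix \<sigma>2 assume f2: "frame (nmods cand_com) (rmods cand_com) \<sigma>1 \<sigma>2"
        and C: "let b = nats \<sigma>2 (pre @ ''best'') 0 in b < m \<and>
          ((\<exists>i<m. 0 < e l i) \<longrightarrow> 0 < e l b \<and> (\<forall>i<m. e l' b * e l i \<le> e l' i * e l b))"
      define b where "b = nats \<sigma>2 (pre @ ''best'') 0"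
      have j2: "nats \<sigma>2 (pre @ ''j'') 0 = j" using f1 f2 j by (simp add: frame_def)
      have bm: "b < m" using C by (simp add: b_def Let_def)
      show "wpt (Seq ?c4 ?c5) (mat_time d + 1) ?R \<sigma>2"
      proof (rule wpt_Seq_NAssign)
        let ?t = "nupdate (pre @ ''s'') (nval (nv ''j'') \<sigma>2) (nval (nv ''best'') \<sigma>2) \<sigma>2"
        show "wpt ?c5 (mat_time d) ?R ?t"
        proof (rule wpt_conseq[OF wpt_MS[where d = d and off = 0 and F = "\<lambda>x y. add_outer A (u b) x y"]])
          fix \<tau> x y assume "x < d" "y < d" "frame {pre @ ''a'', pre @ ''b''} {pre @ ''A''} ?t \<tau>"
            "nats \<tau> (pre @ ''a'') 0 = x" "nats \<tau> (pre @ ''b'') 0 = y"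
            "reals \<tau> (pre @ ''A'') (0 + x) y = reals ?t (pre @ ''A'') (0 + x) y"
          thus "rval (RPlus (rm ''A'') (RTimes (RArr (pre @ ''V'') (nv ''best'') (nv ''a''))
              (RArr (pre @ ''V'') (nv ''best'') (nv ''b'')))) \<tau> = add_outer A (u b) x y"
            using f1 f2 A env bm by (simp add: frame_def b_def env_def add_outer_def)
        next
          fix \<tau> assume f: "frame (nmods ?c5) (rmods ?c5) ?t \<tau>"
            and "(\<forall>x<d. \<forall>y<d. reals \<tau> (pre @ ''A'') (0 + x) y = add_outer A (u b) x y) \<and>
              (\<forall>x y. \<not> (0 \<le> x \<and> x < 0 + d \<and> y < d) \<longrightarrow> reals \<tau> (pre @ ''A'') x y = reals ?t (pre @ ''A'') x y)"
          moreover have s: "nats \<tau> (pre @ ''s'') = (nats \<sigma> (pre @ ''s''))(j := b)"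
            using f f1 f2 j2 by (simp add: frame_def b_def)
          ultimately show "?R \<tau>"
            using C unfolding b_def[symmetric] Let_def s by auto
        qed (use f1 f2 env in \<open>auto simp: frame_def env_def\<close>)
      qed simp
    next
      fix i assume i: "i < m"
      show "e l' i = reals \<sigma>1 (pre @ ''Psi'') l' 0 + (\<Sum>a<d. \<Sum>b<d. u i a * reals \<sigma>1 (pre @ ''H1'') a b * u i b)"
        "e l i = reals \<sigma>1 (pre @ ''Psi'') l 0 + (\<Sum>a<d. \<Sum>b<d. u i a * reals \<sigma>1 (pre @ ''H'') a b * u i b)"
        using T ll wt by (simp_all add: e_def ecoeff_add_outer_eprev)
      show "0 \<le> e l' i" "0 \<le> e l i"
        unfolding e_def using ll by (auto intro!: ecoeff_nonneg wt psd')
    qed (use f1 env m in \<open>auto simp: frame_def env_def choose_time_def\<close>)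
  qed (use env j A ll wt in \<open>auto simp: frame_def env_def\<close>)
qed simp

definition rounding_com :: com where
  "rounding_com = For (pre @ ''j'') (nv ''k'') choose_com"

lemma mods_rounding_com [simp]:
  "nmods rounding_com = insert (pre @ ''j'') (nmods choose_com)"
  "rmods rounding_com = rmods choose_com"
  by (simp_all add: rounding_com_def)

text \<open>The quotient of the conditional expectations never exceeds N0 / D0. After k choices no
  sample is left and the expectations are the coefficients of the chosen matrix itself.\<close>

lemma wpt_rounding_com:
  assumes env: "env d m k l' l wt u \<sigma>"
    and ll: "l' < l" "l \<le> d" and m: "0 < m"
    and A: "\<And>a b. a < d \<Longrightarrow> b < d \<Longrightarrow> reals \<sigma> (pre @ ''A'') a b = 0"
    and wt: "(\<Sum>i<m. wt i) = 1" "\<And>i. i < m \<Longrightarrow> 0 \<le> wt i"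
  defines "D0 \<equiv> ecoeff d m wt u l k (\<lambda>a b. 0)" and "N0 \<equiv> ecoeff d m wt u l' k (\<lambda>a b. 0)"
  shows "wpt rounding_com (2 + real k * (choose_time d m l + 2)) (\<lambda>\<sigma>'.
    let s = nats \<sigma>' (pre @ ''s''); S = mean_outer k (\<lambda>_. 1) (\<lambda>j. u (s j)) in
      (\<forall>j<k. s j < m) \<and>
      (0 < D0 \<longrightarrow> 0 < fl_coeff d S l \<and> fl_coeff d S l' * D0 \<le> fl_coeff d S l * N0)) \<sigma>"
  unfolding rounding_com_def
proof -
  define S where "S n s = mean_outer n (\<lambda>_. 1) (\<lambda>j. u (s j))" for n and s :: "nat \<Rightarrow> nat"
  have S_Suc: "S (Suc n) s = add_outer (S n s) (u (s n))" for n s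
    by (simp add: S_def mean_outer_def add_outer_def)
  have S_cong: "S n s = S n s'" if "\<And>j. j < n \<Longrightarrow> s j = s' j" for n s s'
    using that by (simp add: S_def mean_outer_def)
  define J where "J n s \<longleftrightarrow> (\<forall>j<n. s j < m) \<and> (0 < D0 \<longrightarrow> 0 < ecoeff d m wt u l (k - n) (S n s) \<and>
    ecoeff d m wt u l' (k - n) (S n s) * D0 \<le> ecoeff d m wt u l (k - n) (S n s) * N0)" for n and s :: "nat \<Rightarrow> nat"
  let ?I = "\<lambda>n \<sigma>'. J n (nats \<sigma>' (pre @ ''s'')) \<and>
    (\<forall>x<d. \<forall>y<d. reals \<sigma>' (pre @ ''A'') x y = S n (nats \<sigma>' (pre @ ''s'')) x y)"
  show "wpt (For (pre @ ''j'') (nv ''k'') choose_com) (2 + real k * (choose_time d m l + 2)) (\<lambda>\<sigma>'.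
    let s = nats \<sigma>' (pre @ ''s''); S = mean_outer k (\<lambda>_. 1) (\<lambda>j. u (s j)) in
      (\<forall>j<k. s j < m) \<and>
      (0 < D0 \<longrightarrow> 0 < fl_coeff d S l \<and> fl_coeff d S l' * D0 \<le> fl_coeff d S l * N0)) \<sigma>"
  proof (rule wpt_For[where n = k and T = "choose_time d m l" and Inv = ?I])
    have "S 0 s = (\<lambda>a b. 0)" for s by (simp add: S_def mean_outer_def)
    thus "?I 0 (nupdate (pre @ ''j'') 0 0 \<sigma>)"
      using A by (simp add: J_def D0_def N0_def mult.commute)
  next
    fix n \<tau> assume n: "n < k" and f: "frame (insert (pre @ ''j'') (nmods choose_com)) (rmods choose_com) \<sigma> \<tau>"
      and j: "nats \<tau> (pre @ ''j'') 0 = n" and I: "?I n \<tau>"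
    define s where "s = nats \<tau> (pre @ ''s'')"
    have psd: "psd_sum (S n s)" unfolding S_def by (rule psd_sum_mean_outer) simp
    show "wpt choose_com (choose_time d m l) (\<lambda>\<sigma>''. ?I (Suc n) (nupdate (pre @ ''j'') 0 (Suc n) \<sigma>'')) \<tau>"
    proof (rule wpt_conseq[OF wpt_choose_com[where d = d and m = m and k = k and l' = l' and l = l
          and wt = wt and u = u and j = n and A = "S n s"] order_refl])
      fix \<tau>' :: state assume *: "let b = nats \<tau>' (pre @ ''s'') n in nats \<tau>' (pre @ ''s'') = (nats \<tau> (pre @ ''s''))(n := b) \<and> b < m \<and>
        (\<forall>x<d. \<forall>y<d. reals \<tau>' (pre @ ''A'') x y = add_outer (S n s) (u b) x y) \<and>
        ((\<exists>i<m. 0 < ecoeff d m wt u l (k - Suc n) (add_outer (S n s) (u i))) \<longrightarrow>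
          0 < ecoeff d m wt u l (k - Suc n) (add_outer (S n s) (u b)) \<and>
          (\<forall>i<m. ecoeff d m wt u l' (k - Suc n) (add_outer (S n s) (u b)) * ecoeff d m wt u l (k - Suc n) (add_outer (S n s) (u i))
            \<le> ecoeff d m wt u l' (k - Suc n) (add_outer (S n s) (u i)) * ecoeff d m wt u l (k - Suc n) (add_outer (S n s) (u b))))"
      define s' where "s' = nats \<tau>' (pre @ ''s'')"
      let ?b = "s' n"
      have s': "s' = s(n := ?b)" and b: "?b < m"
        and A': "\<forall>x<d. \<forall>y<d. reals \<tau>' (pre @ ''A'') x y = add_outer (S n s) (u ?b) x y"
        and best: "(\<exists>i<m. 0 < ecoeff d m wt u l (k - Suc n) (add_outer (S n s) (u i))) \<longrightarrow>
          0 < ecoeff d m wt u l (k - Suc n) (add_outer (S n s) (u ?b)) \<and>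
          (\<forall>i<m. ecoeff d m wt u l' (k - Suc n) (add_outer (S n s) (u ?b)) * ecoeff d m wt u l (k - Suc n) (add_outer (S n s) (u i))
            \<le> ecoeff d m wt u l' (k - Suc n) (add_outer (S n s) (u i)) * ecoeff d m wt u l (k - Suc n) (add_outer (S n s) (u ?b)))"
        using * unfolding Let_def s'_def[symmetric] s_def[symmetric] by auto
      have "s' j = s j" if "j < n" for j by (subst s') (use that in simp)
      hence "S n s' = S n s" by (rule S_cong)
      hence SS: "S (Suc n) s' = add_outer (S n s) (u ?b)" by (simp add: S_Suc)
      \<comment> \<open>With this form of the index, \<open>ecoeff_step\<close> presents the
        invariant of the current prefix as an average over its extensions, as
        \<open>greedy_step\<close> requires.\<close>
      have kn: "k - n = Suc (k - Suc n)" using n by simp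
      have Jn: "J n s" using I by (simp add: s_def)
      have lt: "s' j < m" if "j < Suc n" for j
      proof (cases "j = n")
        case False
        hence "s' j = s j" by (subst s') simp
        thus ?thesis using Jn that False by (simp add: J_def)
      qed (use b in simp)
      have "J (Suc n) s'"
        unfolding J_def
      proof (intro conjI impI allI)
        show "s' j < m" if "j < Suc n" for j using lt that .
        assume D0: "0 < D0"
        have "0 < ecoeff d m wt u l (k - Suc n) (add_outer (S n s) (u ?b)) \<and>
          ecoeff d m wt u l' (k - Suc n) (add_outer (S n s) (u ?b)) * D0
            \<le> ecoeff d m wt u l (k - Suc n) (add_outer (S n s) (u ?b)) * N0"
          by (rule greedy_step[where wt = wt and m = m and b = ?b
              and N = "\<lambda>i. ecoeff d m wt u l' (k - Suc n) (add_outer (S n s) (u i))"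
              and D = "\<lambda>i. ecoeff d m wt u l (k - Suc n) (add_outer (S n s) (u i))"])
             (use wt Jn D0 best in \<open>auto simp: J_def kn ecoeff_step\<close>)
        thus "0 < ecoeff d m wt u l (k - Suc n) (S (Suc n) s')"
          "ecoeff d m wt u l' (k - Suc n) (S (Suc n) s') * D0 \<le> ecoeff d m wt u l (k - Suc n) (S (Suc n) s') * N0"
          unfolding SS by auto
      qed
      thus "?I (Suc n) (nupdate (pre @ ''j'') 0 (Suc n) \<tau>')"
        using A' by (simp add: SS flip: s'_def)
    qed (use f env j ll m I psd wt in \<open>auto simp: frame_def env_def s_def\<close>)
  next
    fix \<tau> :: state assume I: "?I k \<tau>"
    define s where "s = nats \<tau> (pre @ ''s'')"
    have "J k s" using I by (simp add: s_def)
    thus "let s = nats \<tau> (pre @ ''s''); S = mean_outer k (\<lambda>_. 1) (\<lambda>j. u (s j)) in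
      (\<forall>j<k. s j < m) \<and>
      (0 < D0 \<longrightarrow> 0 < fl_coeff d S l \<and> fl_coeff d S l' * D0 \<le> fl_coeff d S l * N0)"
      unfolding s_def[symmetric] Let_def by (simp add: J_def S_def ecoeff_def)
  qed (use env in \<open>auto simp: frame_def env_def\<close>)
qed

section \<open>Input, output and the complete program\<close>

text \<open>All input that is needed later is moved to private names before the first call of
  \<open>P\<close>. The weights x(i) / k occur only in \<open>Y\<close>, so \<open>x\<close> itself
  is not copied.\<close>

definition load_com :: com where
  "load_com = Seq (nset ''d'' (NArr ''d'' (NConst 0))) (Seq (nset ''m'' (NArr ''m'' (NConst 0)))
    (Seq (nset ''k'' (NArr ''k'' (NConst 0))) (Seq (nset ''l1'' (NArr ''l1'' (NConst 0)))
    (Seq (nset ''l'' (NArr ''l'' (NConst 0)))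
    (Seq (MatSet (pre @ ''a'') (pre @ ''b'') (nv ''m'') (nv ''d'') (pre @ ''V'') (NConst 0) (RArr ''v'' (nv ''a'') (nv ''b'')))
    (Seq (MS (pre @ ''A'') (NConst 0) (ROfNat (NConst 0)))
    (Seq (MS (pre @ ''Y'') (NConst 0) (ROfNat (NConst 0)))
      (For (pre @ ''i'') (nv ''m'') (MS (pre @ ''Y'') (NConst 0) (RPlus (rm ''Y'')
        (RTimes (RDivide (RArr ''x'' (nv ''i'') (NConst 0)) (ROfNat (nv ''k'')))
          (RTimes (RArr (pre @ ''V'') (nv ''i'') (nv ''a'')) (RArr (pre @ ''V'') (nv ''i'') (nv ''b''))))))))))))))"

lemma mods_load_com [simp]:
  "nmods load_com = {pre @ ''d'', pre @ ''m'', pre @ ''k'', pre @ ''l1'', pre @ ''l'', pre @ ''a'', pre @ ''b'', pre @ ''i''}"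
  "rmods load_com = {pre @ ''V'', pre @ ''A'', pre @ ''Y''}"
  by (auto simp: load_com_def)

definition load_time :: "nat \<Rightarrow> nat \<Rightarrow> real" where
  "load_time d m = 9 + real m * (4 + real d * 3) + 2 * mat_time d + real m * (mat_time d + 2)"

lemma wpt_load_com:
  assumes inp: "holds_input \<sigma> d m v k l' l x"
  shows "wpt load_com (load_time d m) (\<lambda>\<sigma>'. env d m k l' l (\<lambda>i. x i / real k) (\<lambda>i a. v i $ a) \<sigma>' \<and>
    (\<forall>a<d. \<forall>b<d. reals \<sigma>' (pre @ ''A'') a b = 0)) \<sigma>"
proof -
  let ?u = "\<lambda>i a. v i $ a"
  let ?s = "nupdate (pre @ ''l'') 0 l (nupdate (pre @ ''l1'') 0 l' (nupdate (pre @ ''k'') 0 k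
    (nupdate (pre @ ''m'') 0 m (nupdate (pre @ ''d'') 0 d \<sigma>))))"
  let ?c1 = "MatSet (pre @ ''a'') (pre @ ''b'') (nv ''m'') (nv ''d'') (pre @ ''V'') (NConst 0) (RArr ''v'' (nv ''a'') (nv ''b''))"
  let ?c2 = "MS (pre @ ''A'') (NConst 0) (ROfNat (NConst 0))" and ?c3 = "MS (pre @ ''Y'') (NConst 0) (ROfNat (NConst 0))"
  let ?c5 = "MS (pre @ ''Y'') (NConst 0) (RPlus (rm ''Y'')
        (RTimes (RDivide (RArr ''x'' (nv ''i'') (NConst 0)) (ROfNat (nv ''k'')))
          (RTimes (RArr (pre @ ''V'') (nv ''i'') (nv ''a'')) (RArr (pre @ ''V'') (nv ''i'') (nv ''b'')))))"
  let ?c4 = "For (pre @ ''i'') (nv ''m'') ?c5"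
  let ?R = "\<lambda>\<sigma>'. env d m k l' l (\<lambda>i. x i / real k) ?u \<sigma>' \<and> (\<forall>a<d. \<forall>b<d. reals \<sigma>' (pre @ ''A'') a b = 0)"
  have "wpt (Seq ?c1 (Seq ?c2 (Seq ?c3 ?c4))) (load_time d m - 5) ?R ?s"
  proof (rule wpt_Seq, rule wpt_MatSet[where nr = m and nc = d and off = 0 and F = ?u])
    fix \<sigma>1 assume f1: "frame {pre @ ''a'', pre @ ''b''} {pre @ ''V''} ?s \<sigma>1"
      and V: "\<And>i a. i < m \<Longrightarrow> a < d \<Longrightarrow> reals \<sigma>1 (pre @ ''V'') (0 + i) a = v i $ a"
    show "wpt (Seq ?c2 (Seq ?c3 ?c4)) (2 * mat_time d + 2 + real m * (mat_time d + 2)) ?R \<sigma>1"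
    proof (rule wpt_Seq_frame[OF wpt_MS[where d = d and off = 0 and F = "\<lambda>a b. 0"]])
      fix \<sigma>2 assume f2: "frame (nmods ?c2) (rmods ?c2) \<sigma>1 \<sigma>2"
        and A: "(\<forall>a<d. \<forall>b<d. reals \<sigma>2 (pre @ ''A'') (0 + a) b = 0) \<and>
          (\<forall>a b. \<not> (0 \<le> a \<and> a < 0 + d \<and> b < d) \<longrightarrow> reals \<sigma>2 (pre @ ''A'') a b = reals \<sigma>1 (pre @ ''A'') a b)"
      show "wpt (Seq ?c3 ?c4) (mat_time d + 2 + real m * (mat_time d + 2)) ?R \<sigma>2"
      proof (rule wpt_Seq_frame[OF wpt_MS[where d = d and off = 0 and F = "\<lambda>a b. 0"]])
        fix \<sigma>3 assume f3: "frame (nmods ?c3) (rmods ?c3) \<sigma>2 \<sigma>3"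
          and Y: "(\<forall>a<d. \<forall>b<d. reals \<sigma>3 (pre @ ''Y'') (0 + a) b = 0) \<and>
            (\<forall>a b. \<not> (0 \<le> a \<and> a < 0 + d \<and> b < d) \<longrightarrow> reals \<sigma>3 (pre @ ''Y'') a b = reals \<sigma>2 (pre @ ''Y'') a b)"
        let ?I = "\<lambda>n \<sigma>'. \<forall>a<d. \<forall>b<d. reals \<sigma>' (pre @ ''Y'') a b = mean_outer n (\<lambda>i. x i / real k) ?u a b"
        show "wpt ?c4 (2 + real m * (mat_time d + 2)) ?R \<sigma>3"
        proof (rule wpt_For[where n = m and T = "mat_time d" and Inv = ?I])
          fix n \<tau> assume "n < m" "frame (insert (pre @ ''i'') (nmods ?c5)) (rmods ?c5) \<sigma>3 \<tau>"
            "nats \<tau> (pre @ ''i'') 0 = n" "?I n \<tau>"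
          thus "wpt ?c5 (mat_time d) (\<lambda>\<sigma>''. ?I (Suc n) (nupdate (pre @ ''i'') 0 (Suc n) \<sigma>'')) \<tau>"
            using f1 f2 f3 V inp
            by (intro wpt_conseq[OF wpt_MS[where d = d and off = 0 and F = "mean_outer (Suc n) (\<lambda>i. x i / real k) ?u"]])
               (auto simp: frame_def mean_outer_def holds_input_def)
        qed (use f1 f2 f3 V A Y in \<open>auto simp: frame_def mean_outer_def env_def\<close>)
      qed (use f1 f2 in \<open>auto simp: frame_def\<close>)
    qed (use f1 in \<open>auto simp: frame_def\<close>)
  qed (use inp in \<open>auto simp: frame_def holds_input_def load_time_def\<close>)
  thus ?thesis
    unfolding load_com_def using inp
    by (intro wpt_Seq_NAssign[where T = "load_time d m - 5" and T' = "load_time d m - 4"]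
        wpt_Seq_NAssign[where T = "load_time d m - 4" and T' = "load_time d m - 3"]
        wpt_Seq_NAssign[where T = "load_time d m - 3" and T' = "load_time d m - 2"]
        wpt_Seq_NAssign[where T = "load_time d m - 2" and T' = "load_time d m - 1"]
        wpt_Seq_NAssign[where T = "load_time d m - 1" and T' = "load_time d m"])
       (auto simp: holds_input_def)
qed

text \<open>For m < l constant output satisfies the guarantee, since the relaxed value is infinite.
  In the other branch the result reaches the public array only after the last call of
  \<open>P\<close>, which could have overwritten it.\<close>

definition program :: com where
  "program = If (NLess (NArr ''m'' (NConst 0)) (NArr ''l'' (NConst 0)))
     (For (pre @ ''j'') (NArr ''k'' (NConst 0)) (NAssign ''s'' (nv ''j'') (NConst 0)))
     (Seq load_com (Seq rounding_com
       (For (pre @ ''j'') (nv ''k'') (NAssign ''s'' (nv ''j'') (NArr (pre @ ''s'') (nv ''j''))))))"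

definition program_time :: "nat \<Rightarrow> nat \<Rightarrow> nat \<Rightarrow> nat \<Rightarrow> real" where
  "program_time d m k l = load_time d m + (2 + real k * (choose_time d m l + 2)) + (2 + real k * 3) + 1"

lemma wpt_program_degenerate:
  assumes inp: "holds_input \<sigma> d m v k l' l x" and "m < l" "0 < m"
  shows "wpt program (3 + real k * 3) (\<lambda>\<sigma>'. design_feasible m k (nats \<sigma>' ''s'')) \<sigma>"
  unfolding program_def
proof (rule wpt_If[where ?T1.0 = "2 + real k * 3"])
  show "wpt (For (pre @ ''j'') (NArr ''k'' (NConst 0)) (NAssign ''s'' (nv ''j'') (NConst 0))) (2 + real k * 3)
     (\<lambda>\<sigma>'. design_feasible m k (nats \<sigma>' ''s'')) \<sigma>"
    by (rule wpt_For[where n = k and T = 1 and Inv = "\<lambda>n \<sigma>'. \<forall>j<n. nats \<sigma>' ''s'' j = 0"])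
       (use assms in \<open>auto simp: frame_def holds_input_def design_feasible_def less_Suc_eq intro!: wpt_NAssign\<close>)
qed (use assms in \<open>auto simp: holds_input_def\<close>)

lemma wpt_program:
  assumes inp: "holds_input \<sigma> d m v k l' l x"
    and ll: "l' < l" "l \<le> d" and m: "0 < m" "l \<le> m"
    and x: "(\<Sum>i<m. x i) = real k" "\<And>i. i < m \<Longrightarrow> 0 \<le> x i" "0 < k"
  defines "wt \<equiv> \<lambda>i. x i / real k" and "u \<equiv> \<lambda>i a. v i $ a"
  defines "D0 \<equiv> ecoeff d m wt u l k (\<lambda>a b. 0)" and "N0 \<equiv> ecoeff d m wt u l' k (\<lambda>a b. 0)"
  shows "wpt program (program_time d m k l) (\<lambda>\<sigma>'.
    let s = nats \<sigma>' ''s''; S = mean_outer k (\<lambda>_. 1) (\<lambda>j. u (s j)) in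
      design_feasible m k s \<and>
      (0 < D0 \<longrightarrow> 0 < fl_coeff d S l \<and> fl_coeff d S l' * D0 \<le> fl_coeff d S l * N0)) \<sigma>"
  unfolding program_def
proof (rule wpt_If[where ?T1.0 = "program_time d m k l - 1"])
  let ?c3 = "For (pre @ ''j'') (nv ''k'') (NAssign ''s'' (nv ''j'') (NArr (pre @ ''s'') (nv ''j'')))"
  define good where "good s \<longleftrightarrow> (let S = mean_outer k (\<lambda>_. 1) (\<lambda>j. u (s j)) in (\<forall>j<k. s j < m) \<and>
      (0 < D0 \<longrightarrow> 0 < fl_coeff d S l \<and> fl_coeff d S l' * D0 \<le> fl_coeff d S l * N0))" for s :: "nat \<Rightarrow> nat"
  have good_cong: "good s" if "good s'" "\<forall>j<k. s j = s' j" for s s'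
  proof -
    have "mean_outer k (\<lambda>_. 1) (\<lambda>j. u (s j)) = mean_outer k (\<lambda>_. 1) (\<lambda>j. u (s' j))"
      using that(2) by (simp add: mean_outer_def)
    thus ?thesis using that by (simp add: good_def)
  qed
  show "wpt (Seq load_com (Seq rounding_com ?c3)) (program_time d m k l - 1) (\<lambda>\<sigma>'.
    let s = nats \<sigma>' ''s''; S = mean_outer k (\<lambda>_. 1) (\<lambda>j. u (s j)) in
      design_feasible m k s \<and>
      (0 < D0 \<longrightarrow> 0 < fl_coeff d S l \<and> fl_coeff d S l' * D0 \<le> fl_coeff d S l * N0)) \<sigma>"
    unfolding design_feasible_def Let_def good_def[unfolded Let_def, symmetric]
  proof (rule wpt_Seq_frame[OF wpt_load_com[OF inp]])
    fix \<sigma>1 assume L: "env d m k l' l (\<lambda>i. x i / real k) (\<lambda>i a. v i $ a) \<sigma>1 \<and>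
      (\<forall>a<d. \<forall>b<d. reals \<sigma>1 (pre @ ''A'') a b = 0)"
    hence env: "env d m k l' l wt u \<sigma>1" by (simp add: wt_def u_def)
    have wt1: "(\<Sum>i<m. wt i) = 1" using x by (simp add: wt_def flip: sum_divide_distrib)
    have "wpt rounding_com (2 + real k * (choose_time d m l + 2)) (\<lambda>\<sigma>'. good (nats \<sigma>' (pre @ ''s''))) \<sigma>1"
      using wpt_rounding_com[OF env ll m(1) _ wt1] L x
      by (simp add: good_def Let_def wt_def D0_def N0_def)
    thus "wpt (Seq rounding_com ?c3) (2 + real k * (choose_time d m l + 2) + (2 + real k * 3)) (\<lambda>\<sigma>'. good (nats \<sigma>' ''s'')) \<sigma>1"
    proof (rule wpt_Seq_frame)
      fix \<sigma>2 assume f2: "frame (nmods rounding_com) (rmods rounding_com) \<sigma>1 \<sigma>2"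
        and g: "good (nats \<sigma>2 (pre @ ''s''))"
      show "wpt ?c3 (2 + real k * 3) (\<lambda>\<sigma>'. good (nats \<sigma>' ''s'')) \<sigma>2"
        by (rule wpt_For[where n = k and T = 1 and Inv = "\<lambda>n \<sigma>'. \<forall>j<n. nats \<sigma>' ''s'' j = nats \<sigma>2 (pre @ ''s'') j"])
           (use f2 L g in \<open>auto simp: frame_def env_def less_Suc_eq intro!: wpt_NAssign elim: good_cong\<close>)
    qed simp
  qed (simp add: program_time_def)
qed (use inp m in \<open>auto simp: holds_input_def\<close>)

end

section \<open>The approximation guarantee\<close>

text \<open>Every cost is measured in one of the scales D = d^w (one product), L = l D (one level)
  and Q = m d D (one chosen index); lower-order terms are absorbed since each scale is at least 1.
  The coefficient 2 of \<open>K\<close> comes from the two products in each table step.\<close>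

lemma (in fresh_matmul) program_time_le:
  assumes K: "0 \<le> K" and w: "2 \<le> w" and l: "1 \<le> l" "l \<le> d" "l \<le> m" and k: "1 \<le> k"
  shows "program_time d m k l \<le> (260 + 2 * K) * (real k * real m * real d powr (w + 1))"
proof -
  define D where "D = real d powr w"
  have d: "1 \<le> d" and m: "1 \<le> m" using l by auto
  have "real d powr 2 \<le> D" unfolding D_def using w d by (intro powr_mono) auto
  hence dD: "real d * real d \<le> D" using d by (simp add: powr_numeral power2_eq_square)
  have "real d * 1 \<le> real d * real d" using d by (intro mult_left_mono) auto
  hence dD1: "real d \<le> D" using dD by simp
  have D1: "1 \<le> D" using dD1 d by simp
  have mat: "mat_time d \<le> 9 * D"
    unfolding mat_time_def using dD dD1 D1 by (simp add: algebra_simps)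
  have mul: "mul_time d \<le> (28 + K) * D"
    unfolding mul_time_def D_def[symmetric] using mat D1 by (simp add: algebra_simps)
  have step: "step_time d \<le> (81 + 2 * K) * D"
    unfolding step_time_def using mat mul dD1 D1 by (simp add: algebra_simps)
  define L where "L = real l * D"
  have "1 * D \<le> L" unfolding L_def using l D1 by (intro mult_right_mono) auto
  hence DL: "D \<le> L" "1 \<le> L" using D1 by auto
  have "real l * 1 \<le> L" unfolding L_def using D1 by (intro mult_left_mono) auto
  hence lL: "real l \<le> L" by simp
  have lm: "real l * t \<le> c * L" if "t \<le> c * D" for t c
    using mult_left_mono[OF that, of "real l"] by (simp add: L_def mult_ac)
  have level: "level_time d l \<le> (87 + 2 * K) * L"
    using lm[of "step_time d + 3" "84 + 2 * K"] step D1 DL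
    unfolding level_time_def by (simp add: algebra_simps)
  have init: "init_time d l \<le> 46 * L"
    using lm[of "mat_time d + 3" 12] mat D1 DL
    unfolding init_time_def by (simp add: algebra_simps)
  define Q where "Q = real m * (real d * D)"
  \<comment> \<open>There are l levels of l slots: one factor l is charged to m, the other to
    d.\<close>
  have "real l * L = (real l * real l) * D" by (simp add: L_def)
  also have "\<dots> \<le> (real m * real d) * D"
    using l D1 by (intro mult_right_mono mult_mono) auto
  finally have lQ: "real l * L \<le> Q" by (simp add: Q_def mult_ac)
  have "1 * L \<le> real l * L" using l DL by (intro mult_right_mono) auto
  hence LQ: "L \<le> Q" using lQ by simp
  have tab: "table_time d l \<le> (156 + 2 * K) * Q"
  proof -
    have "real l * (2 * mat_time d + level_time d l + 3) \<le> real l * ((108 + 2 * K) * L)"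
      using mat level DL D1 by (intro mult_left_mono) (auto simp: algebra_simps)
    also have "\<dots> = (108 + 2 * K) * (real l * L)" by simp
    also have "\<dots> \<le> (108 + 2 * K) * Q" using lQ K by (intro mult_left_mono) auto
    finally show ?thesis unfolding table_time_def using init LQ DL by (simp add: algebra_simps)
  qed
  have DQ: "D \<le> Q" "1 \<le> Q" using DL LQ by auto
  have "real d * 1 \<le> real d * D" using D1 by (intro mult_left_mono) auto
  hence ddD: "real d \<le> real d * D" by simp
  have "1 * D \<le> real d * D" using d D1 by (intro mult_right_mono) auto
  hence dD2: "D \<le> real d * D" by simp
  have mQ: "real m * t \<le> c * Q" if "t \<le> c * (real d * D)" for t c
    using mult_left_mono[OF that, of "real m"] by (simp add: Q_def mult_ac)
  have "2 * mat_time d + 8 \<le> 26 * (real d * D)" using mat D1 dD2 by linarith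
  hence cand: "cand_time d m \<le> 31 * Q"
    using mQ[of "2 * mat_time d + 8" 26] DQ unfolding cand_time_def by linarith
  have choose: "choose_time d m l \<le> (198 + 2 * K) * Q"
    unfolding choose_time_def using tab cand mat DQ by (simp add: algebra_simps)
  have "4 + real d * 3 \<le> 7 * (real d * D)" "mat_time d + 2 \<le> 11 * (real d * D)"
    using mat D1 dD2 ddD by linarith+
  hence load: "load_time d m \<le> 45 * Q"
    using mQ[of "4 + real d * 3" 7] mQ[of "mat_time d + 2" 11] mat DQ
    unfolding load_time_def by linarith
  have "real k * (choose_time d m l + 2) \<le> real k * ((200 + 2 * K) * Q)"
    using choose DQ by (intro mult_left_mono) (auto simp: algebra_simps)
  also have "\<dots> = (200 + 2 * K) * (real k * Q)" by simp
  finally have kc: "real k * (choose_time d m l + 2) \<le> (200 + 2 * K) * (real k * Q)" .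
  have "1 * Q \<le> real k * Q" using k DQ by (intro mult_right_mono) auto
  hence Qk: "Q \<le> real k * Q" by simp
  have "real k * 1 \<le> real k * Q" using DQ by (intro mult_left_mono) auto
  hence kQ: "real k \<le> real k * Q" by simp
  \<comment> \<open>The sum is 45 for loading, 200 + 2 K for the greedy loop and 8 for the remaining
    steps; 260 is a rounded bound.\<close>
  have "program_time d m k l \<le> (260 + 2 * K) * (real k * Q)"
    unfolding program_time_def distrib_right using load kc[unfolded distrib_right] Qk kQ DQ by linarith
  also have "real k * Q = real k * real m * real d powr (w + 1)"
    using d by (simp add: Q_def D_def powr_add mult_ac)
  finally show ?thesis .
qed

section \<open>Comparing relaxation, design and rounded solution\<close>

lemma relax_opt_eq:
  assumes "relax_optimal_solution d m v k l' l x"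
  shows "relax_opt d m v k l' l = relax_obj d m v l' l x"
  unfolding relax_opt_def
  using assms by (intro antisym INF_lower INF_greatest) (auto simp: relax_optimal_solution_def)

text \<open>The vector of multiplicities of a design is feasible for the relaxation and produces the
  same matrix.\<close>

lemma relax_opt_le_design_opt: "relax_opt d m v k l' l \<le> design_opt d m v k l' l"
  unfolding design_opt_def
proof (rule INF_greatest, clarsimp)
  fix s assume s: "design_feasible m k s"
  define y where "y i = real (card {j \<in> {..<k}. s j = i})" for i
  have img: "s ` {..<k} \<subseteq> {..<m}" using s by (auto simp: design_feasible_def)
  have group: "(\<Sum>i<m. y i * f i) = (\<Sum>j<k. f (s j))" for f :: "nat \<Rightarrow> real"
  proof -
    have "(\<Sum>j<k. f (s j)) = (\<Sum>i<m. \<Sum>j\<in>{j \<in> {..<k}. s j = i}. f (s j))"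
      by (rule sum.group[symmetric]) (use img in auto)
    also have "\<dots> = (\<Sum>i<m. y i * f i)" by (simp add: y_def)
    finally show ?thesis by simp
  qed
  have "relax_feasible m k y"
    using group[of "\<lambda>_. 1"] by (simp add: relax_feasible_def y_def)
  moreover have "design_obj d v k l' l s = relax_obj d m v l' l y"
    unfolding design_obj_def relax_obj_def sum_outer_def
    using group[of "\<lambda>i. v i $ _ * v i $ _"] by simp
  ultimately show "relax_opt d m v k l' l \<le> design_obj d v k l' l s"
    unfolding relax_opt_def by (auto intro: INF_lower)
qed

lemma approx_factor_pos: "0 < k \<Longrightarrow> 0 < approx_factor k l' l"
  by (simp add: approx_factor_def)

text \<open>N0 / D0 is the relaxed quotient times (k-l)!/(k-l')! * k^(l-l'), and the power 1/(l-l')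
  turns this constant into \<open>approx_factor\<close>. If E_l vanishes at x, the right-hand side
  is infinite and the premise on \<open>s\<close> says nothing.\<close>

lemma design_obj_le:
  fixes v :: "nat \<Rightarrow> real vec" and s :: "nat \<Rightarrow> nat"
  assumes ll: "l' < l" "l \<le> d" "d \<le> k"
    and x: "\<And>i. i < m \<Longrightarrow> 0 \<le> x i" "(\<Sum>i<m. x i) = real k"
  defines "wt \<equiv> \<lambda>i. x i / real k" and "u \<equiv> \<lambda>i a. v i $ a"
  defines "D0 \<equiv> ecoeff d m wt u l k (\<lambda>a b. 0)" and "N0 \<equiv> ecoeff d m wt u l' k (\<lambda>a b. 0)"
    and "S \<equiv> mean_outer k (\<lambda>_. 1) (\<lambda>j. u (s j))"
  assumes S: "0 < D0 \<longrightarrow> 0 < fl_coeff d S l \<and> fl_coeff d S l' * D0 \<le> fl_coeff d S l * N0"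
  shows "design_obj d v k l' l s \<le> ereal (approx_factor k l' l) * relax_obj d m v l' l x"
proof (cases "E l (sum_outer d m x v) = 0")
  case True
  have "0 < approx_factor k l' l" using ll by (intro approx_factor_pos) simp
  then show ?thesis using True by (simp add: relax_obj_def gen_ratio_def)
next
  case False
  have k: "0 < k" using ll by simp
  let ?Y = "mean_outer m wt u"
  have Xp: "E p (sum_outer d m x v) = real k ^ p * fl_coeff d ?Y p" if "p \<le> d" for p
  proof -
    have "mean_outer m x u = (\<lambda>a b. real k * ?Y a b)"
      using k by (simp add: mean_outer_def wt_def sum_distrib_left)
    thus ?thesis
      using E_sum_outer[OF that, of m x v] by (simp add: u_def fl_coeff_scale)
  qed
  define e e' where "e = E l (sum_outer d m x v)" and "e' = E l' (sum_outer d m x v)"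
  have e_pos: "0 < e" and e'_nonneg: "0 \<le> e'"
    using False E_sum_outer_nonneg[of m x l d v] E_sum_outer_nonneg[of m x l' d v] x
    by (auto simp: e_def e'_def)
  have wt1: "(\<Sum>i<m. wt i) = 1" using x k by (simp add: wt_def flip: sum_divide_distrib)
  \<comment> \<open>The falling factorial is k!/(k-p)!, and the power of k in the denominator comes
    from replacing the mean matrix by the relaxed one.\<close>
  have c: "ecoeff d m wt u p k (\<lambda>a b. 0) = fact k / (fact (k - p) * real k ^ p) * E p (sum_outer d m x v)"
    if "p \<le> d" for p
  proof -
    have "real (falling k p) * fact (k - p) = fact k"
      using falling_times_fact[of p k] that ll by (metis of_nat_fact of_nat_mult order_trans)
    hence "real (falling k p) = fact k / fact (k - p)" by (simp add: field_simps)
    thus ?thesis using k by (simp add: ecoeff_zero_matrix[OF wt1 that] Xp[OF that])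
  qed
  have D0: "D0 = fact k / (fact (k - l) * real k ^ l) * e" and N0: "N0 = fact k / (fact (k - l') * real k ^ l') * e'"
    using c ll by (auto simp: D0_def N0_def e_def e'_def)
  have D0_pos: "0 < D0" unfolding D0 using e_pos k by simp
  let ?M = "sum_outer d k (\<lambda>j. 1) (\<lambda>j. v (s j))"
  have ES: "E p ?M = fl_coeff d S p" if "p \<le> d" for p
    using E_sum_outer[OF that] by (simp add: S_def u_def)
  have pos: "0 < E l ?M" and le: "E l' ?M * D0 \<le> E l ?M * N0"
    using S D0_pos ES ll by auto
  have nonneg: "0 \<le> E l' ?M" by (rule E_sum_outer_nonneg) simp
  define h where "h = 1 / (real l - real l')"
  have h: "h > 0" using ll by (simp add: h_def)
  have "E l' ?M / E l ?M \<le> N0 / D0"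
    using pos le D0_pos by (simp add: field_simps)
  also have "N0 / D0 = fact (k - l) / fact (k - l') * real k ^ (l - l') * (e' / e)"
  proof -
    have "real k ^ l = real k ^ (l - l') * real k ^ l'"
      using ll by (simp flip: power_add)
    thus ?thesis unfolding N0 D0 using k e_pos by (simp add: field_simps)
  qed
  finally have "(E l' ?M / E l ?M) powr h \<le> (fact (k - l) / fact (k - l') * real k ^ (l - l') * (e' / e)) powr h"
    using pos nonneg h by (intro powr_mono2) auto
  also have "\<dots> = (fact (k - l) / fact (k - l')) powr h * (real k ^ (l - l')) powr h * (e' / e) powr h"
    by (simp only: powr_mult)
  also have "(real k ^ (l - l')) powr h = real k"
  proof -
    have "(real k ^ (l - l')) powr h = (real k powr real (l - l')) powr h"
      using k by (simp add: powr_realpow)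
    also have "\<dots> = real k powr (real (l - l') * h)" by (simp add: powr_powr)
    also have "real (l - l') * h = 1" using ll by (simp add: h_def of_nat_diff)
    finally show ?thesis using k by simp
  qed
  finally have "(E l' ?M / E l ?M) powr h \<le> approx_factor k l' l * (e' / e) powr h"
    by (simp add: approx_factor_def h_def mult_ac)
  moreover have "design_obj d v k l' l s = ereal ((E l' ?M / E l ?M) powr h)"
    using pos by (simp add: design_obj_def gen_ratio_def h_def)
  moreover have "relax_obj d m v l' l x = ereal ((e' / e) powr h)"
    using e_pos by (simp add: relax_obj_def gen_ratio_def h_def e_def e'_def)
  ultimately show ?thesis by simp
qed

lemma relax_obj_eq_infinity:
  assumes "m < l" "l \<le> d" "\<And>i. i < m \<Longrightarrow> 0 \<le> x i"
  shows "relax_obj d m v l' l x = \<infinity>"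
proof -
  have "E l (sum_outer d m x v) = 0"
    using E_sum_outer[OF assms(2)] fl_coeff_mean_outer_eq_0[OF assms(3,1,2)] by simp
  thus ?thesis by (simp add: relax_obj_def gen_ratio_def)
qed

text \<open>A program names finitely many arrays; a prefix longer than all these names remains
  longer under any extension.\<close>

lemma ex_fresh_prefix: "\<exists>pre. 3 \<le> length pre \<and> (\<forall>s. pre @ s \<notin> nmods c \<and> pre @ s \<notin> rmods c)"
proof -
  define N where "N = Max (insert 3 (length ` (nmods c \<union> rmods c)))"
  have fin: "finite (insert 3 (length ` (nmods c \<union> rmods c)))"
    by (simp add: finite_nmods finite_rmods)
  have len: "length a \<le> N" if "a \<in> nmods c \<union> rmods c" for a
    unfolding N_def using that by (intro Max_ge fin) auto
  have "replicate (Suc N) CHR ''_'' @ s \<notin> nmods c \<union> rmods c" for s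
    using len[of "replicate (Suc N) CHR ''_'' @ s"] by auto
  moreover have "3 \<le> N" unfolding N_def by (intro Max_ge fin) auto
  ultimately show ?thesis by (intro exI[of _ "replicate (Suc N) CHR ''_''"]) auto
qed

theorem theoremA3:
  fixes \<omega> :: real
  assumes "matmul_exponent \<omega>"
  shows "\<exists>(P :: com) (C :: real).
    \<forall>(d :: nat) (m :: nat) (v :: nat \<Rightarrow> real vec) (k :: nat) (l' :: nat) (l :: nat)
       (x :: nat \<Rightarrow> real) (\<sigma> :: state).
      (\<forall>i<m. v i \<in> carrier_vec d) \<and> d \<le> k \<and> l' < l \<and> l \<le> d \<and>
      relax_optimal_solution d m v k l' l x \<and> (\<Sum>i<m. x i) = real k \<and>
      holds_input \<sigma> d m v k l' l x \<longrightarrow>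
      (\<exists>t \<sigma>' s. run P \<sigma> t \<sigma>' \<and> s = nats \<sigma>' ''s'' \<and>
        design_feasible m k s \<and>
        design_obj d v k l' l s \<le> ereal (approx_factor k l' l) * relax_opt d m v k l' l \<and>
        design_obj d v k l' l s \<le> ereal (approx_factor k l' l) * design_opt d m v k l' l \<and>
        real t \<le> C * (real k * real m * real d powr (\<omega> + 1)))"
proof -
  obtain P K where w: "2 \<le> \<omega>" and P: "\<And>n \<sigma>. 1 \<le> n \<and> nats \<sigma> ''n'' 0 = n \<Longrightarrow>
       (\<exists>t \<sigma>'. run P \<sigma> t \<sigma>' \<and> real t \<le> K * real n powr \<omega> \<and>
         (\<forall>i<n. \<forall>j<n. reals \<sigma>' ''C'' i j = (\<Sum>p<n. reals \<sigma> ''A'' i p * reals \<sigma> ''B'' p j)))"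
    using assms unfolding matmul_exponent_def by blast
  obtain pre where pre: "3 \<le> length pre" "\<And>s. pre @ s \<notin> nmods P \<and> pre @ s \<notin> rmods P"
    using ex_fresh_prefix by blast
  \<comment> \<open>\<open>matmul_exponent\<close> states no sign for its constant, whereas the
    estimates of the running time use a nonnegative one.\<close>
  define K' where "K' = max K 0"
  have K': "0 \<le> K'" "\<And>n. K * real n powr \<omega> \<le> K' * real n powr \<omega>"
    by (auto simp: K'_def intro: mult_right_mono)
  interpret fresh_matmul P pre K' \<omega>
  proof
    fix n and \<sigma> :: state assume "1 \<le> n" "nats \<sigma> ''n'' 0 = n"
    thus "wpt P (K' * real n powr \<omega>) (\<lambda>\<sigma>'. \<forall>i<n. \<forall>j<n. reals \<sigma>' ''C'' i j
        = (\<Sum>p<n. reals \<sigma> ''A'' i p * reals \<sigma> ''B'' p j)) \<sigma>"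
      unfolding wpt_def using P[of n \<sigma>] K'(2)[of n] by (meson order_trans)
  qed (use pre in auto)
  show ?thesis
  proof (intro exI[of _ program] exI[of _ "260 + 2 * K'"] allI impI)
    fix d m v k l' l x \<sigma>
    assume "(\<forall>i<m. v i \<in> carrier_vec d) \<and> d \<le> k \<and> l' < l \<and> l \<le> d \<and>
      relax_optimal_solution d m v k l' l x \<and> (\<Sum>i<m. x i) = real k \<and>
      holds_input \<sigma> d m v k l' l x"
    hence dk: "d \<le> k" and ll: "l' < l" "l \<le> d" and opt: "relax_optimal_solution d m v k l' l x"
      and sum: "(\<Sum>i<m. x i) = real k" and inp: "holds_input \<sigma> d m v k l' l x" by auto
    have x: "0 \<le> x i" if "i < m" for i
      using opt that by (simp add: relax_optimal_solution_def relax_feasible_def)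
    have k: "0 < k" using dk ll by simp
    hence m: "0 < m" using sum by (cases m) auto
    have d: "1 \<le> d" using ll by simp
    have main: "\<exists>t \<sigma>'. run program \<sigma> t \<sigma>' \<and> real t \<le> (260 + 2 * K') * (real k * real m * real d powr (\<omega> + 1)) \<and>
      design_feasible m k (nats \<sigma>' ''s'') \<and>
      design_obj d v k l' l (nats \<sigma>' ''s'') \<le> ereal (approx_factor k l' l) * relax_obj d m v l' l x"
    proof (cases "m < l")
      case True
      obtain t \<sigma>' where t: "run program \<sigma> t \<sigma>'" "real t \<le> 3 + real k * 3" "design_feasible m k (nats \<sigma>' ''s'')"
        using wpt_program_degenerate[OF inp True m] unfolding wpt_def by blast
      have "1 * (1 * 1) \<le> real k * (real m * real d powr (\<omega> + 1))"
        using k m d w by (intro mult_mono ge_one_powr_ge_zero) auto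
      hence 1: "1 \<le> real k * real m * real d powr (\<omega> + 1)" by (simp add: mult.assoc)
      have "real k * (1 * 1) \<le> real k * (real m * real d powr (\<omega> + 1))"
        using k m d w by (intro mult_left_mono mult_mono ge_one_powr_ge_zero) auto
      hence "real k \<le> real k * real m * real d powr (\<omega> + 1)" by (simp add: mult.assoc)
      hence "3 + real k * 3 \<le> 6 * (real k * real m * real d powr (\<omega> + 1))" using 1 by linarith
      also have "\<dots> \<le> (260 + 2 * K') * (real k * real m * real d powr (\<omega> + 1))"
        using K'(1) by (intro mult_right_mono) auto
      finally have "real t \<le> (260 + 2 * K') * (real k * real m * real d powr (\<omega> + 1))"
        using t(2) by linarith
      moreover have "design_obj d v k l' l (nats \<sigma>' ''s'') \<le> ereal (approx_factor k l' l) * relax_obj d m v l' l x"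
        using relax_obj_eq_infinity[OF True ll(2) x] approx_factor_pos[OF k, of l' l] by simp
      ultimately show ?thesis using t by blast
    next
      case False
      obtain t \<sigma>' where t: "run program \<sigma> t \<sigma>'" "real t \<le> program_time d m k l"
        and R: "let s = nats \<sigma>' ''s''; S = mean_outer k (\<lambda>_. 1) (\<lambda>j. (\<lambda>i a. v i $ a) (s j));
            wt = \<lambda>i. x i / real k; u = \<lambda>i a. v i $ a in design_feasible m k s \<and>
            (0 < ecoeff d m wt u l k (\<lambda>a b. 0) \<longrightarrow> 0 < fl_coeff d S l \<and>
              fl_coeff d S l' * ecoeff d m wt u l k (\<lambda>a b. 0) \<le> fl_coeff d S l * ecoeff d m wt u l' k (\<lambda>a b. 0))"
        using wpt_program[OF inp ll m _ sum x k] False unfolding wpt_def by (auto simp: Let_def)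
      have "real t \<le> (260 + 2 * K') * (real k * real m * real d powr (\<omega> + 1))"
        using t(2) program_time_le[OF K'(1) w _ ll(2), of m k] ll False k by linarith
      moreover have "design_obj d v k l' l (nats \<sigma>' ''s'') \<le> ereal (approx_factor k l' l) * relax_obj d m v l' l x"
        by (rule design_obj_le[OF ll dk x sum]) (use R in \<open>auto simp: Let_def\<close>)
      ultimately show ?thesis using t R by (auto simp: Let_def)
    qed
    \<comment> \<open>The bound against the best design follows from the bound against the
      relaxation, as the factor is positive.\<close>
    have "ereal (approx_factor k l' l) * relax_opt d m v k l' l \<le> ereal (approx_factor k l' l) * design_opt d m v k l' l"
      using approx_factor_pos[OF k, of l' l] by (intro ereal_mult_left_mono relax_opt_le_design_opt) auto
    with main show "\<exists>t \<sigma>' s. run program \<sigma> t \<sigma>' \<and> s = nats \<sigma>' ''s'' \<and> design_feasible m k s \<and>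
        design_obj d v k l' l s \<le> ereal (approx_factor k l' l) * relax_opt d m v k l' l \<and>
        design_obj d v k l' l s \<le> ereal (approx_factor k l' l) * design_opt d m v k l' l \<and>
        real t \<le> (260 + 2 * K') * (real k * real m * real d powr (\<omega> + 1))"
      unfolding relax_opt_eq[OF opt] by (meson order_trans)
  qed
qed

end
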